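(* Let $j_1, j_2, j \in \{0, \tfrac12, 1, \tfrac32, \dots\}$, let $W^{(j_2)}$ and $W^{(j)}$ be the irreducible representation spaces of the Jordanian quantum algebra ${\cal U}_h(sl(2))$ with highest weights $j_2$ and $j$, and let $T^{(j_1)} = \{ t_{j_1 m_1} : m_1 = -j_1, -j_1+1, \dots, j_1\}$ be a set of rank $j_1$ tensor operators for ${\cal U}_h(sl(2))$, where each $t_{j_1 m_1}$ is a linear map $W^{(j_2)} \to W^{(j)}$. Then there is a constant $I(j_1 j_2 j)$, independent of $m_1$, $m_2$ and $m$, such that for all $m_1 \in \{-j_1,\dots,j_1\}$, $m_2 \in \{-j_2,\dots,j_2\}$, $m \in \{-j,\dots,j\}$ (in integer steps), $$\langle jm |\, t_{j_1 m_1}\, | j_2 m_2\rangle = I(j_1 j_2 j) \sum_{n_1=-j_1}^{j_1}\ \sum_{n_2=-j_2}^{j_2} \alpha_{-m_1,-m_2}^{-n_1,-n_2}\; C_{n_1,\,n_2,\,m}^{j_1,\,j_2,\,j},$$ where $C_{n_1,n_2,m}^{j_1,j_2,j}$ are the $sl(2)$ Clebsch-Gordan coefficients and $\alpha_{k_1,k_2}^{m_1,m_2}$ are the explicit coefficients (for the pair $j_1,j_2$) defined in the context.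
   Context: **The algebra.** Let $h\neq 0$ be the (complex) deformation parameter. The Jordanian quantum algebra ${\cal U}_h(sl(2))$ is the unital associative Hopf algebra generated by $X, Y, H$ with relations $$[X,Y]=H,\qquad [H,X]=\frac{2\sinh hX}{h},\qquad [H,Y]=-Y(\cosh hX)-(\cosh hX)Y,$$ coproduct $$\Delta(X)=X\otimes 1+1\otimes X,\quad \Delta(Y)=Y\otimes e^{hX}+e^{-hX}\otimes Y,\quad \Delta(H)=H\otimes e^{hX}+e^{-hX}\otimes H,$$ counit $\epsilon(X)=\epsilon(Y)=\epsilon(H)=0$ and antipode $$S(X)=-X,\quad S(Y)=-e^{hX}Ye^{-hX},\quad S(H)=-e^{hX}He^{-hX}.$$ Functions of $X$ are understood as power series; on the finite-dimensional representations below $X$ acts nilpotently. **Irreducible representations.** Put $$Z_+=\frac{2}{h}\tanh\frac{hX}{2},\qquad Z_-=\Big(\cosh\frac{hX}{2}\Big)Y\Big(\cosh\frac{hX}{2}\Big).$$ Then $[H,Z_\pm]=\pm 2Z_\pm$ and $[Z_+,Z_-]=H$. For $j\in\{0,\tfrac12,1,\dots\}$, the irreducible representation space $W^{(j)}$ with highest weight $j$ has basis $|jm\rangle$, $m=-j,-j+1,\dots,j$, with $$Z_\pm|jm\rangle=\sqrt{(j\mp m)(j\pm m+1)}\,|j\,m\pm1\rangle,\qquad H|jm\rangle=2m|jm\rangle.$$ The actions of $X$ and $Y$ are obtained by solving for them: $$X=\frac2h\,\mathrm{arctanh}\Big(\frac h2 Z_+\Big),\qquad Y=\sqrt{1-(\tfrac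 h2Z_+)^2}\;Z_-\,\sqrt{1-(\tfrac h2Z_+)^2},$$ as power series in the nilpotent operator $Z_+$. The bra vectors $\langle jm|$ are the dual basis: $\langle jm|jm'\rangle=\delta_{m,m'}$. For $c\in{\cal U}_h(sl(2))$ let $D(c)^{(j)}_{km}=\langle jk|c|jm\rangle$ be the representation matrix with highest weight $j$. **Tensor operators.** For representation spaces $W,W'$ of ${\cal U}_h(sl(2))$, a linear operator $t:W\to W'$ and $c\in{\cal U}_h(sl(2))$ with $\Delta(c)=\sum_i c_i\otimes c_i'$, the adjoint action is $$ad\,c(t)=\sum_i c_i\,t\,S(c_i').$$ Operators $t_{jm}$, $m=-j,\dots,j$, are called rank $j$ tensor operators if $$ad\,c(t_{jm})=\sum_k D(c)^{(j)}_{km}\,t_{jk}\qquad\text{for all } c\in{\cal U}_h(sl(2)).$$ **The coefficients $\alpha$.** For fixed $j_1,j_2$, and $m_i,k_i\in\{-j_i,-j_i+1,\dots,j_i\}$, $$\alpha_{k_1,k_2}^{m_1,m_2}=(-1)^{k_2-m_2}\Big(\frac h2\Big)^{k_1+k_2-m_1-m_2}D_{k_1,k_2}^{m_1,m_2}\big(b_{k_1,k_2}^{m_1,m_2}-b_{k_1-1,k_2-1}^{m_1,m_2}\big),$$ $$D_{k_1,k_2}^{m_1,m_2}=\left\{\frac{(j_1-m_1)!\,(j_1+k_1)!\,(j_2-m_2)!\,(j_2+k_2)!}{(j_1+m_1)!\,(j_1-k_1)!\,(j_2+m_2)!\,(j_2-k_2)!}\right\}^{1/2},$$ $$b_{k_1,k_2}^{m_1,m_2}=\binom{m_1+k_1}{k_2-m_2}\binom{m_2+k_2}{k_1-m_1},$$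 where for integers $n,m$ (with $n$ possibly negative) $\binom nm=\frac{n(n-1)\cdots(n-m+1)}{m!}$ if $m\ge0$ and $\binom nm=0$ if $m<0$. In particular $\alpha_{k_1,k_2}^{m_1,m_2}=0$ unless $k_1\ge m_1$ and $k_2\ge m_2$. The dependence of $\alpha$ on $j_1,j_2$ is suppressed in the notation. **Clebsch-Gordan coefficients.** $C_{n_1,n_2,m}^{j_1,j_2,j}$ denotes the usual (undeformed) Clebsch-Gordan coefficient of $sl(2)$, i.e. the coefficient of $|j_1n_1\rangle\otimes|j_2n_2\rangle$ in the standard basis vector $|jm\rangle$ of the spin-$j$ component of the tensor product of the spin-$j_1$ and spin-$j_2$ representations of $sl(2)$. It is zero unless $n_1+n_2=m$ and $j\in\{|j_1-j_2|,|j_1-j_2|+1,\dots,j_1+j_2\}$. *)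

theory Defs
  imports
    Complex_Main
    "HOL-Library.Groups_Big_Fun"
    "HOL-Computational_Algebra.Formal_Power_Series"
begin

section \<open>Spins, weights and the spaces \<open>W\<^sup>(\<^sup>j\<^sup>)\<close>\<close>

definition spins :: "real set" where
  "spins = {real n / 2 | n :: nat. True}"

definition wts :: "real \<Rightarrow> real set" where
  "wts j = {- j + real k | k :: nat. - j + real k \<le> j}"

text \<open>A vector is given by its coordinates in the basis \<open>|j m\<rangle>\<close>, \<open>m \<in> wts j\<close>;
  accordingly \<open>\<langle>j' m'| t |j m\<rangle>\<close> is \<open>t (ket m) m'\<close>.\<close>

definition W :: "real \<Rightarrow> (real \<Rightarrow> complex) set" where
  "W j = {v. \<forall>m. m \<notin> wts j \<longrightarrow> v m = 0}"

definition ket :: "real \<Rightarrow> real \<Rightarrow> complex" where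
  "ket m = (\<lambda>p. if p = m then 1 else 0)"

definition linear_between ::
  "('a \<Rightarrow> complex) set \<Rightarrow> ('b \<Rightarrow> complex) set \<Rightarrow> (('a \<Rightarrow> complex) \<Rightarrow> 'b \<Rightarrow> complex) \<Rightarrow> bool" where
  "linear_between V V' t \<longleftrightarrow>
     (\<forall>v\<in>V. t v \<in> V') \<and>
     (\<forall>v\<in>V. \<forall>w\<in>V. t (\<lambda>p. v p + w p) = (\<lambda>p. t v p + t w p)) \<and>
     (\<forall>a. \<forall>v\<in>V. t (\<lambda>p. a * v p) = (\<lambda>p. a * t v p))"

text \<open>The linear operator on \<open>W j\<close> with \<open>|j m\<rangle> \<mapsto> f m\<close>.\<close>

definition lin_ext :: "real \<Rightarrow> (real \<Rightarrow> real \<Rightarrow> complex) \<Rightarrow> (real \<Rightarrow> complex) \<Rightarrow> real \<Rightarrow> complex" where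
  "lin_ext j f v = (\<lambda>p. \<Sum>m\<in>wts j. v m * f m p)"

definition Zplus :: "real \<Rightarrow> (real \<Rightarrow> complex) \<Rightarrow> real \<Rightarrow> complex" where
  "Zplus j = lin_ext j (\<lambda>m p. complex_of_real (sqrt ((j - m) * (j + m + 1))) * ket (m + 1) p)"

definition Zminus :: "real \<Rightarrow> (real \<Rightarrow> complex) \<Rightarrow> real \<Rightarrow> complex" where
  "Zminus j = lin_ext j (\<lambda>m p. complex_of_real (sqrt ((j + m) * (j - m + 1))) * ket (m - 1) p)"

definition Hop :: "real \<Rightarrow> (real \<Rightarrow> complex) \<Rightarrow> real \<Rightarrow> complex" where
  "Hop j = lin_ext j (\<lambda>m p. complex_of_real (2 * m) * ket m p)"


section \<open>The algebra \<open>U\<^sub>h(sl(2))\<close>\<close>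

datatype gen = gX | gY | gH

text \<open>Power series in \<open>X\<close> such as \<open>exp(hX)\<close> belong to the algebra, so its elements are represented
  by noncommutative formal series in \<open>X, Y, H\<close> (coefficient functions on words) that are polynomial
  in \<open>Y\<close> and \<open>H\<close>: the number of letters other than \<open>X\<close> is bounded on the support.\<close>

type_synonym series = "gen list \<Rightarrow> complex"
type_synonym series2 = "gen list \<times> gen list \<Rightarrow> complex"

definition nonX :: "gen list \<Rightarrow> nat" where
  "nonX w = length (filter (\<lambda>g. g \<noteq> gX) w)"

definition free_alg :: "series set" where
  "free_alg = {c. \<exists>N. \<forall>w. N < nonX w \<longrightarrow> c w = 0}"

definition free_alg2 :: "series2 set" where
  "free_alg2 = {c. \<exists>N. \<forall>u v. N < nonX u + nonX v \<longrightarrow> c (u, v) = 0}"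

definition s_one :: series where
  "s_one = (\<lambda>w. if w = [] then 1 else 0)"

definition s_gen :: "gen \<Rightarrow> series" where
  "s_gen g = (\<lambda>w. if w = [g] then 1 else 0)"

definition s_mult :: "series \<Rightarrow> series \<Rightarrow> series" (infixl \<open>\<star>\<close> 70) where
  "a \<star> b = (\<lambda>w. \<Sum>i\<le>length w. a (take i w) * b (drop i w))"

definition s_fX :: "complex fps \<Rightarrow> series" where
  "s_fX f = (\<lambda>w. if nonX w = 0 then fps_nth f (length w) else 0)"

definition fps_cosh :: "complex \<Rightarrow> complex fps" where
  "fps_cosh h = fps_const (1/2) * (fps_exp h + fps_exp (- h))"

definition fps_sinh :: "complex \<Rightarrow> complex fps" where
  "fps_sinh h = fps_const (1/2) * (fps_exp h - fps_exp (- h))"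

definition rel_XY :: series where
  "rel_XY = (\<lambda>w. (s_gen gX \<star> s_gen gY) w - (s_gen gY \<star> s_gen gX) w - s_gen gH w)"

definition rel_HX :: "complex \<Rightarrow> series" where
  "rel_HX h = (\<lambda>w. (s_gen gH \<star> s_gen gX) w - (s_gen gX \<star> s_gen gH) w
                     - 2 / h * s_fX (fps_sinh h) w)"

definition rel_HY :: "complex \<Rightarrow> series" where
  "rel_HY h = (\<lambda>w. (s_gen gH \<star> s_gen gY) w - (s_gen gY \<star> s_gen gH) w
                     + (s_gen gY \<star> s_fX (fps_cosh h)) w + (s_fX (fps_cosh h) \<star> s_gen gY) w)"

text \<open>\<open>insert_rel q r\<close> is the (possibly infinite) combination \<open>\<Sum> q(u,v) u r v\<close> over all pairs
  of words.  Infinite combinations are needed: \<open>[H, exp(hX)] = exp(2hX) - 1\<close>, for instance,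
  follows from the relations only by a power series computation.\<close>

definition insert_rel :: "series2 \<Rightarrow> series \<Rightarrow> series" where
  "insert_rel q r = (\<lambda>w. \<Sum>i\<le>length w. \<Sum>k\<le>length w - i.
      q (take i w, drop (i + k) w) * r (take k (drop i w)))"

definition rel_ideal :: "complex \<Rightarrow> series set" where
  "rel_ideal h = {\<lambda>w. insert_rel q1 rel_XY w + insert_rel q2 (rel_HX h) w + insert_rel q3 (rel_HY h) w
                   | q1 q2 q3. q1 \<in> free_alg2 \<and> q2 \<in> free_alg2 \<and> q3 \<in> free_alg2}"

text \<open>The carrier of \<open>U\<^sub>h(sl(2))\<close>: classes of series modulo the relations.  The Hopf structure and
  the representations are given below on representatives.\<close>

definition U_h :: "complex \<Rightarrow> series set set" where
  "U_h h = free_alg // {(a, b). a \<in> free_alg \<and> b \<in> free_alg \<and> (\<lambda>w. a w - b w) \<in> rel_ideal h}"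


subsection \<open>Coproduct and antipode\<close>

text \<open>\<open>series2\<close> represents the completed tensor square of the algebra.\<close>

definition s_tensor :: "series \<Rightarrow> series \<Rightarrow> series2" (infixl \<open>\<otimes>\<^sub>s\<close> 75) where
  "a \<otimes>\<^sub>s b = (\<lambda>(u, v). a u * b v)"

definition s_mult2 :: "series2 \<Rightarrow> series2 \<Rightarrow> series2" where
  "s_mult2 a b = (\<lambda>(u, v). \<Sum>i\<le>length u. \<Sum>k\<le>length v.
      a (take i u, take k v) * b (drop i u, drop k v))"

fun coprod_gen :: "complex \<Rightarrow> gen \<Rightarrow> series2" where
  "coprod_gen h gX = (\<lambda>p. (s_gen gX \<otimes>\<^sub>s s_one) p + (s_one \<otimes>\<^sub>s s_gen gX) p)"
| "coprod_gen h gY = (\<lambda>p. (s_gen gY \<otimes>\<^sub>s s_fX (fps_exp h)) p + (s_fX (fps_exp (- h)) \<otimes>\<^sub>s s_gen gY) p)"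
| "coprod_gen h gH = (\<lambda>p. (s_gen gH \<otimes>\<^sub>s s_fX (fps_exp h)) p + (s_fX (fps_exp (- h)) \<otimes>\<^sub>s s_gen gH) p)"

fun coprod_word :: "complex \<Rightarrow> gen list \<Rightarrow> series2" where
  "coprod_word h [] = s_one \<otimes>\<^sub>s s_one"
| "coprod_word h (g # w) = s_mult2 (coprod_gen h g) (coprod_word h w)"

text \<open>The sum is finite at each \<open>p = (u, v)\<close>: only words \<open>w\<close> with
  \<open>length w \<le> length u + length v\<close> contribute.\<close>

definition coprod :: "complex \<Rightarrow> series \<Rightarrow> series2" where
  "coprod h c = (\<lambda>p. Sum_any (\<lambda>w. c w * coprod_word h w p))"

fun antipode_gen :: "complex \<Rightarrow> gen \<Rightarrow> series" where
  "antipode_gen h gX = (\<lambda>w. - s_gen gX w)"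
| "antipode_gen h gY = (\<lambda>w. - (s_fX (fps_exp h) \<star> s_gen gY \<star> s_fX (fps_exp (- h))) w)"
| "antipode_gen h gH = (\<lambda>w. - (s_fX (fps_exp h) \<star> s_gen gH \<star> s_fX (fps_exp (- h))) w)"

fun antipode_word :: "complex \<Rightarrow> gen list \<Rightarrow> series" where
  "antipode_word h [] = s_one"
| "antipode_word h (g # w) = antipode_word h w \<star> antipode_gen h g"


section \<open>Representations and tensor operators\<close>

text \<open>A representation is given by the operators \<open>\<pi> g\<close> of the generators.  When \<open>\<pi> gX\<close> is nilpotent,
  as in all uses below, the \<open>Sum_any\<close>s below have finitely many nonzero terms for
  \<open>c \<in> free_alg\<close>.\<close>

type_synonym 'b rep = "gen \<Rightarrow> ('b \<Rightarrow> complex) \<Rightarrow> 'b \<Rightarrow> complex"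

definition act_word :: "'b rep \<Rightarrow> gen list \<Rightarrow> ('b \<Rightarrow> complex) \<Rightarrow> 'b \<Rightarrow> complex" where
  "act_word \<pi> w = foldr (\<lambda>g A. \<pi> g \<circ> A) w id"

definition act :: "'b rep \<Rightarrow> series \<Rightarrow> ('b \<Rightarrow> complex) \<Rightarrow> 'b \<Rightarrow> complex" where
  "act \<pi> c v = (\<lambda>p. Sum_any (\<lambda>w. c w * act_word \<pi> w v p))"

text \<open>A power series evaluated at a nilpotent operator.\<close>

definition fps_op :: "complex fps \<Rightarrow> (('b \<Rightarrow> complex) \<Rightarrow> 'b \<Rightarrow> complex) \<Rightarrow> ('b \<Rightarrow> complex) \<Rightarrow> 'b \<Rightarrow> complex" where
  "fps_op f A v = (\<lambda>p. Sum_any (\<lambda>k. fps_nth f k * (A ^^ k) v p))"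

definition fps_arctanh :: "complex fps" where
  "fps_arctanh = Abs_fps (\<lambda>n. if odd n then 1 / of_nat n else 0)"

definition fps_sqrt_one_minus_sq :: "complex fps" where
  "fps_sqrt_one_minus_sq = fps_binomial (1/2) oo (- (fps_X ^ 2))"

definition half_hZ :: "complex \<Rightarrow> real \<Rightarrow> (real \<Rightarrow> complex) \<Rightarrow> real \<Rightarrow> complex" where
  "half_hZ h j v = (\<lambda>p. h / 2 * Zplus j v p)"

fun irrep :: "complex \<Rightarrow> real \<Rightarrow> real rep" where
  "irrep h j gX = (\<lambda>v p. 2 / h * fps_op fps_arctanh (half_hZ h j) v p)"
| "irrep h j gY = fps_op fps_sqrt_one_minus_sq (half_hZ h j) \<circ> Zminus j
                    \<circ> fps_op fps_sqrt_one_minus_sq (half_hZ h j)"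
| "irrep h j gH = Hop j"

text \<open>The matrix element \<open>D(c)\<^sup>(\<^sup>j\<^sup>)\<close> in row \<open>k\<close> and column \<open>m\<close>.\<close>

definition rep_matrix :: "complex \<Rightarrow> real \<Rightarrow> series \<Rightarrow> real \<Rightarrow> real \<Rightarrow> complex" where
  "rep_matrix h j c k m = act (irrep h j) c (ket m) k"

text \<open>\<open>ad c(t) = \<Sum> c\<^sub>i t S(c\<^sub>i')\<close>, with \<open>\<Delta>(c)\<close> expanded over pairs of words \<open>u \<otimes> v\<close>;
  \<open>t\<close> maps the space of \<open>\<pi>\<close> to the space of \<open>\<pi>'\<close>.\<close>

definition ad :: "complex \<Rightarrow> 'b rep \<Rightarrow> 'a rep \<Rightarrow> series \<Rightarrow>
    (('a \<Rightarrow> complex) \<Rightarrow> 'b \<Rightarrow> complex) \<Rightarrow> ('a \<Rightarrow> complex) \<Rightarrow> 'b \<Rightarrow> complex" where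
  "ad h \<pi>' \<pi> c t x = (\<lambda>p. Sum_any (\<lambda>(u, v).
      coprod h c (u, v) * act_word \<pi>' u (t (act \<pi> (antipode_word h v) x)) p))"

text \<open>\<open>t m\<close>, for \<open>m \<in> wts j1\<close>, are rank \<open>j1\<close> tensor operators from \<open>W j2\<close> to \<open>W j\<close>.  Both sides of the
  equation depend only on the class \<open>C\<close> of \<open>c\<close>, since the relations hold in the irreducible
  representations and are respected by the coproduct and the antipode.\<close>

definition tensor_operators :: "complex \<Rightarrow> real \<Rightarrow> real \<Rightarrow> real \<Rightarrow>
    (real \<Rightarrow> (real \<Rightarrow> complex) \<Rightarrow> real \<Rightarrow> complex) \<Rightarrow> bool" where
  "tensor_operators h j1 j2 j t \<longleftrightarrow>
     (\<forall>m\<in>wts j1. linear_between (W j2) (W j) (t m)) \<and>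
     (\<forall>C\<in>U_h h. \<forall>c\<in>C. \<forall>m\<in>wts j1. \<forall>x\<in>W j2.
        ad h (irrep h j) (irrep h j2) c (t m) x
          = (\<lambda>p. \<Sum>k\<in>wts j1. rep_matrix h j1 c k m * t k x p))"


section \<open>The coefficients \<open>\<alpha>\<close>\<close>

text \<open>The arguments of the next two functions are integers, presented as reals.\<close>

definition rfact :: "real \<Rightarrow> real" where
  "rfact x = fact (nat \<lfloor>x\<rfloor>)"

definition rbinom :: "real \<Rightarrow> real \<Rightarrow> real" where
  "rbinom x y = (if y \<ge> 0 then x gchoose nat \<lfloor>y\<rfloor> else 0)"

definition b_coeff :: "real \<Rightarrow> real \<Rightarrow> real \<Rightarrow> real \<Rightarrow> real" where
  "b_coeff m1 m2 k1 k2 = rbinom (m1 + k1) (k2 - m2) * rbinom (m2 + k2) (k1 - m1)"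

definition D_coeff :: "real \<Rightarrow> real \<Rightarrow> real \<Rightarrow> real \<Rightarrow> real \<Rightarrow> real \<Rightarrow> real" where
  "D_coeff j1 j2 m1 m2 k1 k2 =
     sqrt ((rfact (j1 - m1) * rfact (j1 + k1) * rfact (j2 - m2) * rfact (j2 + k2)) /
           (rfact (j1 + m1) * rfact (j1 - k1) * rfact (j2 + m2) * rfact (j2 - k2)))"

text \<open>\<open>alpha h j1 j2 m1 m2 k1 k2\<close> has the superscripts \<open>m1, m2\<close> first, then the subscripts \<open>k1, k2\<close>.\<close>

definition alpha :: "complex \<Rightarrow> real \<Rightarrow> real \<Rightarrow> real \<Rightarrow> real \<Rightarrow> real \<Rightarrow> real \<Rightarrow> complex" where
  "alpha h j1 j2 m1 m2 k1 k2 =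
     (- 1) powi \<lfloor>k2 - m2\<rfloor> * (h / 2) powi \<lfloor>k1 + k2 - m1 - m2\<rfloor> *
     complex_of_real (D_coeff j1 j2 m1 m2 k1 k2 *
       (b_coeff m1 m2 k1 k2 - b_coeff m1 m2 (k1 - 1) (k2 - 1)))"


section \<open>Clebsch-Gordan coefficients of \<open>sl(2)\<close>\<close>

text \<open>\<open>A \<otimes> 1 + 1 \<otimes> B\<close> on coordinates with respect to \<open>|j1 n1\<rangle> \<otimes> |j2 n2\<rangle>\<close>.\<close>

definition tensor_sum :: "((real \<Rightarrow> complex) \<Rightarrow> real \<Rightarrow> complex) \<Rightarrow> ((real \<Rightarrow> complex) \<Rightarrow> real \<Rightarrow> complex) \<Rightarrow>
    (real \<times> real \<Rightarrow> complex) \<Rightarrow> real \<times> real \<Rightarrow> complex" where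
  "tensor_sum A B \<psi> = (\<lambda>(p, q). A (\<lambda>r. \<psi> (r, q)) p + B (\<lambda>r. \<psi> (p, r)) q)"

text \<open>\<open>\<Psi> m\<close> is the standard basis vector \<open>|j m\<rangle>\<close> of the spin \<open>j\<close> component of the tensor product, with
  unit norm and the Condon-Shortley phase; it suffices to fix these at \<open>m = j\<close>.  On each \<open>W j\<close> the
  standard undeformed \<open>sl(2)\<close> generators are \<open>Zplus\<close>, \<open>Zminus\<close>, \<open>Hop\<close>.\<close>

definition coupled_basis :: "real \<Rightarrow> real \<Rightarrow> real \<Rightarrow> (real \<Rightarrow> real \<times> real \<Rightarrow> complex) \<Rightarrow> bool" where
  "coupled_basis j1 j2 j \<Psi> \<longleftrightarrow>
     (\<forall>m p. m \<notin> wts j \<or> p \<notin> wts j1 \<times> wts j2 \<longrightarrow> \<Psi> m p = 0) \<and>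
     (\<forall>m\<in>wts j.
        tensor_sum (Hop j1) (Hop j2) (\<Psi> m) = (\<lambda>p. complex_of_real (2 * m) * \<Psi> m p) \<and>
        tensor_sum (Zplus j1) (Zplus j2) (\<Psi> m)
          = (\<lambda>p. complex_of_real (sqrt ((j - m) * (j + m + 1))) * \<Psi> (m + 1) p) \<and>
        tensor_sum (Zminus j1) (Zminus j2) (\<Psi> m)
          = (\<lambda>p. complex_of_real (sqrt ((j + m) * (j - m + 1))) * \<Psi> (m - 1) p)) \<and>
     (\<Sum>p\<in>wts j1 \<times> wts j2. (norm (\<Psi> j p))\<^sup>2) = 1 \<and>
     (\<exists>r>0. \<Psi> j (j1, j - j1) = complex_of_real r)"

definition clebsch_gordan :: "real \<Rightarrow> real \<Rightarrow> real \<Rightarrow> real \<Rightarrow> real \<Rightarrow> real \<Rightarrow> complex" where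
  "clebsch_gordan j1 j2 j n1 n2 m =
     (if j \<in> {\<bar>j1 - j2\<bar> + real k | k :: nat. \<bar>j1 - j2\<bar> + real k \<le> j1 + j2}
      then (THE \<Psi>. coupled_basis j1 j2 j \<Psi>) m (n1, n2) else 0)"

end

theory Submission
  imports Defs
begin

text \<open>
  Put \<open>\<Phi>(v \<otimes> x) = \<Sum> v\<^sub>m t\<^sub>m x\<close>.  Unfolding the coproduct and the antipode, the tensor operator
  conditions for \<open>X\<close> and \<open>H\<close> become intertwining relations for this one linear map from
  \<open>W(j1) \<otimes> W(j2)\<close> to \<open>W(j)\<close>, namely \<open>X \<Phi> = \<Phi> (X \<otimes> 1 + 1 \<otimes> X)\<close> and
  \<open>H \<Phi> = \<Phi> (H \<otimes> exp(hX) + exp(-hX) \<otimes> H)\<close> (lemmas \<open>tensor_map_X\<close> and \<open>tensor_map_H\<close>).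

  Let \<open>z\<^sup>k\<close> stand for the vector \<open>Z\<^sub>+\<^sup>k |j, -j\<rangle>\<close>.  Then \<open>W(j)\<close> is the space of polynomials in \<open>z\<close> truncated
  at degree \<open>2j\<close>, \<open>Z\<^sub>+\<close> is multiplication by \<open>z\<close>, and \<open>exp(hX)\<close> is multiplication by the
  Cayley transform \<open>(1 + az) / (1 - az)\<close> with \<open>a = h/2\<close>.  On polynomials in two variables the deformed
  action is conjugate to the usual \<open>sl(2)\<close> action by the substitution
  \<open>B f = U\<^sup>N\<^sup>1 V\<^sup>N\<^sup>2 f(z1 / U\<^sup>2, z2 / V\<^sup>2)\<close>, where \<open>N1 = 2 j1\<close>, \<open>N2 = 2 j2\<close> and the power series \<open>U\<close>, \<open>V\<close>
  solve \<open>U V = V - a z2 = U + a z1\<close>.  Lagrange-Good inversion expands \<open>U\<^sup>c V\<^sup>d\<close> into differences of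
  products of binomial coefficients, and these are the coefficients \<open>\<alpha>\<close> up to the norms of the basis
  vectors (\<open>alpha_twist_coeff\<close>).  All identities between \<open>U\<close>, \<open>V\<close>, \<open>z1\<close>, \<open>z2\<close> reduce to two Pascal-type
  recurrences.  The matrix of \<open>B\<close> is unitriangular, so \<open>\<Phi> = \<chi> \<circ> B\<close> with a unique \<open>\<chi>\<close>, and \<open>\<chi>\<close>
  commutes with the undeformed \<open>Z\<^sub>+\<close> and \<open>H\<close> (\<open>untwist\<close>).

  It remains to see that \<open>\<chi>\<close> is a multiple of the Clebsch-Gordan coefficients.  Read as a family of
  vectors \<open>f m\<close> in \<open>W(j1) \<otimes> W(j2)\<close>, one for each weight \<open>m\<close>, it is compatible with the lowering
  operators, and a norm computation shows that it is then compatible with the raising operators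
  (\<open>raising_defect_zero\<close>).  A highest weight vector in the tensor product is determined by a single
  coordinate, which gives the triangle condition for \<open>j\<close> as well as existence and uniqueness of the
  normalised coupled basis whenever \<open>f\<close> is nonzero (\<open>coupled_clebsch_gordan\<close>).
\<close>

section \<open>Power series of nilpotent operators\<close>

definition vspace :: "('b \<Rightarrow> complex) set \<Rightarrow> bool" where
  "vspace V \<longleftrightarrow> (\<lambda>p. 0) \<in> V \<and> (\<forall>v\<in>V. \<forall>w\<in>V. (\<lambda>p. v p + w p) \<in> V) \<and> (\<forall>c. \<forall>v\<in>V. (\<lambda>p. c * v p) \<in> V)"

abbreviation "linear_op A \<equiv> linear_between UNIV UNIV A"

lemma vspace_UNIV [simp]: "vspace UNIV" by (simp add: vspace_def)
lemma vspace_W [simp]: "vspace (W j)" by (simp add: vspace_def W_def)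

lemma vspace_sum:
  assumes "vspace V" "\<And>i. i \<in> I \<Longrightarrow> f i \<in> V"
  shows "(\<lambda>p. \<Sum>i\<in>I. c i * f i p) \<in> V"
  using assms(2)
proof (induction I rule: infinite_finite_induct)
  case (insert i I)
  then show ?case using assms(1) by (simp add: vspace_def)
qed (use assms(1) in \<open>simp_all add: vspace_def\<close>)

text \<open>Tensor operators are linear on a subspace only, the operators of a representation on all
  coordinate functions; both cases are covered by a subspace \<open>V\<close>.\<close>

lemma linear_between_sum:
  assumes V: "vspace V" and t: "linear_between V V' t" and f: "\<And>i. i \<in> I \<Longrightarrow> f i \<in> V"
  shows "t (\<lambda>p. \<Sum>i\<in>I. c i * f i p) = (\<lambda>p. \<Sum>i\<in>I. c i * t (f i) p)"
proof -
  have add: "t (\<lambda>p. v p + w p) = (\<lambda>p. t v p + t w p)" if "v \<in> V" "w \<in> V" for v w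
    using that t unfolding linear_between_def by blast
  have scale: "t (\<lambda>p. b * v p) = (\<lambda>p. b * t v p)" if "v \<in> V" for b v
    using that t unfolding linear_between_def by blast
  have scale_in: "(\<lambda>p. b * v p) \<in> V" if "v \<in> V" for b v
    using that V unfolding vspace_def by blast
  have zero: "t (\<lambda>p. 0) = (\<lambda>p. 0)"
    using scale[of "\<lambda>p. 0" 0] V by (simp add: vspace_def)
  show ?thesis
    using f
  proof (induction I rule: infinite_finite_induct)
    case (insert i I)
    have sum_in: "(\<lambda>p. \<Sum>i\<in>I. c i * f i p) \<in> V"
      by (rule vspace_sum[OF V]) (use insert.prems in auto)
    have fi: "f i \<in> V" and IH: "t (\<lambda>p. \<Sum>i\<in>I. c i * f i p) = (\<lambda>p. \<Sum>i\<in>I. c i * t (f i) p)"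
      using insert by simp_all
    have "t (\<lambda>p. \<Sum>i\<in>insert i I. c i * f i p) = t (\<lambda>p. c i * f i p + (\<Sum>i\<in>I. c i * f i p))"
      using insert.hyps by simp
    also have "\<dots> = (\<lambda>p. c i * t (f i) p + (\<Sum>i\<in>I. c i * t (f i) p))"
      unfolding add[OF scale_in[OF fi] sum_in] scale[OF fi] IH ..
    finally show ?case using insert.hyps by simp
  qed (simp_all add: zero)
qed

lemmas linear_op_sum = linear_between_sum[where V = UNIV and V' = UNIV, OF vspace_UNIV _ UNIV_I]

lemma linear_op_zero: "linear_op A \<Longrightarrow> A (\<lambda>p. 0) = (\<lambda>p. 0)"
  using linear_op_sum[of A "\<lambda>_. 0" "\<lambda>_. \<lambda>p. 0" "{()}"] by simp

lemma linear_op_add: "linear_op A \<Longrightarrow> A (\<lambda>p. v p + w p) = (\<lambda>p. A v p + A w p)"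
  and linear_op_scale: "linear_op A \<Longrightarrow> A (\<lambda>p. c * v p) = (\<lambda>p. c * A v p)"
  by (simp_all add: linear_between_def)

lemma linear_op_funpow:
  fixes A :: "('b \<Rightarrow> complex) \<Rightarrow> 'b \<Rightarrow> complex"
  shows "linear_op A \<Longrightarrow> linear_op (A ^^ k)"
  by (induction k) (simp_all add: linear_between_def)

definition nilpotent :: "(('b \<Rightarrow> complex) \<Rightarrow> 'b \<Rightarrow> complex) \<Rightarrow> nat \<Rightarrow> bool" where
  "nilpotent A M \<longleftrightarrow> linear_op A \<and> (\<forall>v. (A ^^ M) v = (\<lambda>p. 0))"

lemma nilpotentD: "nilpotent A M \<Longrightarrow> M \<le> k \<Longrightarrow> (A ^^ k) v = (\<lambda>p. 0)"
  using funpow_add[of M "k - M" A] by (simp add: nilpotent_def)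

lemma nilpotent_mono: "nilpotent A M \<Longrightarrow> M \<le> k \<Longrightarrow> nilpotent A k"
  using nilpotentD[of A M k] by (simp add: nilpotent_def)

lemma fps_op_eq_sum:
  assumes "nilpotent A M"
  shows "fps_op f A v = (\<lambda>p. \<Sum>k<M. fps_nth f k * (A ^^ k) v p)"
proof
  fix p
  have "{k. fps_nth f k * (A ^^ k) v p \<noteq> 0} \<subseteq> {..<M}"
    using nilpotentD[OF assms, of _ v] by (force simp: not_less[symmetric])
  then show "fps_op f A v p = (\<Sum>k<M. fps_nth f k * (A ^^ k) v p)"
    unfolding fps_op_def by (intro Sum_any.expand_superset) simp_all
qed

lemma linear_op_fps_op: "nilpotent A M \<Longrightarrow> linear_op (fps_op f A)"
  using linear_op_funpow[of A]
  by (auto simp: linear_between_def nilpotent_def fps_op_eq_sum sum.distrib sum_distrib_left algebra_simps intro!: ext)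

text \<open>Cauchy products of finite sums: a square of indices can be replaced by a triangle when the terms
  beyond the triangle vanish, as they do for powers of nilpotent operators.\<close>

lemma sum_square_eq_triangle:
  fixes x :: "nat \<Rightarrow> nat \<Rightarrow> 'a::comm_monoid_add"
  assumes "\<And>i k. M \<le> i + k \<Longrightarrow> x i k = 0"
  shows "(\<Sum>i<M. \<Sum>k<M. x i k) = (\<Sum>n<M. \<Sum>i\<le>n. x i (n - i))"
proof -
  have "(\<Sum>i<M. \<Sum>k<M. x i k) = (\<Sum>(i, k)\<in>{(i, k). i + k < M}. x i k)"
    unfolding sum.cartesian_product
    by (rule sum.mono_neutral_right) (use assms in \<open>force simp: not_less\<close>)+
  then show ?thesis by (simp add: sum.triangle_reindex)
qed

lemma fps_op_mult:
  assumes A: "nilpotent A M"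
  shows "fps_op f A (fps_op g A v) = fps_op (f * g) A v"
proof
  fix p
  have lin: "linear_op (A ^^ i)" for i using A linear_op_funpow by (auto simp: nilpotent_def)
  have "fps_op f A (fps_op g A v) p
      = (\<Sum>i<M. \<Sum>k<M. fps_nth f i * fps_nth g k * (A ^^ (i + k)) v p)"
    unfolding fps_op_eq_sum[OF A] linear_op_sum[OF lin]
    by (simp add: funpow_add sum_distrib_left mult.assoc)
  also have "\<dots> = (\<Sum>n<M. \<Sum>i\<le>n. fps_nth f i * fps_nth g (n - i) * (A ^^ (i + (n - i))) v p)"
    by (rule sum_square_eq_triangle) (simp add: nilpotentD[OF A])
  also have "\<dots> = fps_op (f * g) A v p"
    unfolding fps_op_eq_sum[OF A] fps_mult_nth
    by (intro sum.cong refl) (simp add: sum_distrib_right atLeast0AtMost)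
  finally show "fps_op f A (fps_op g A v) p = fps_op (f * g) A v p" .
qed

lemma fps_op_1: "nilpotent A M \<Longrightarrow> fps_op 1 A v = v"
proof -
  assume "nilpotent A M"
  then have "nilpotent A (Suc M)" by (rule nilpotent_mono) simp
  then show ?thesis by (intro ext) (simp add: fps_op_eq_sum fps_one_nth if_distrib[of "\<lambda>c. c * _"] sum.delta del: sum.lessThan_Suc cong: if_cong)
qed

lemma fps_op_X: "nilpotent A M \<Longrightarrow> fps_op fps_X A v = A v"
proof -
  assume "nilpotent A M"
  then have "nilpotent A (Suc (Suc M))" by (rule nilpotent_mono) simp
  then show ?thesis by (intro ext) (simp add: fps_op_eq_sum fps_X_def if_distrib[of "\<lambda>c. c * _"] sum.delta del: sum.lessThan_Suc cong: if_cong)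
qed

lemma fps_op_add: "nilpotent A M \<Longrightarrow> fps_op (f + g) A v = (\<lambda>p. fps_op f A v p + fps_op g A v p)"
  by (simp add: fps_op_eq_sum sum.distrib algebra_simps)

lemma fps_op_diff: "nilpotent A M \<Longrightarrow> fps_op (f - g) A v = (\<lambda>p. fps_op f A v p - fps_op g A v p)"
  by (simp add: fps_op_eq_sum sum_subtractf algebra_simps)

lemma fps_op_const_mult: "nilpotent A M \<Longrightarrow> fps_op (fps_const c * f) A v = (\<lambda>p. c * fps_op f A v p)"
  by (simp add: fps_op_eq_sum sum_distrib_left algebra_simps)

lemma fps_op_power: "nilpotent A M \<Longrightarrow> (fps_op g A ^^ n) v = fps_op (g ^ n) A v"
  by (induction n) (simp_all add: fps_op_1 fps_op_mult)

lemma nilpotent_fps_op: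
  assumes A: "nilpotent A M" and g: "fps_nth g 0 = 0"
  shows "nilpotent (fps_op g A) M"
proof -
  have "fps_op (g ^ M) A v = (\<lambda>p. 0)" for v
    using startsby_zero_power_prefix[OF g] by (auto simp: fps_op_eq_sum[OF A] intro!: ext sum.neutral)
  then show ?thesis by (simp add: nilpotent_def fps_op_power[OF A] linear_op_fps_op[OF A])
qed

text \<open>Evaluating a power series at \<open>g(A)\<close> is evaluating the composition at \<open>A\<close>, because \<open>g\<^sup>n\<close> starts in
  degree \<open>n\<close> at least and both sums are finite.\<close>

lemma fps_op_compose:
  assumes A: "nilpotent A M" and g: "fps_nth g 0 = 0"
  shows "fps_op f (fps_op g A) v = fps_op (f oo g) A v"
proof
  fix p
  have "fps_op f (fps_op g A) v p = (\<Sum>n<M. \<Sum>k<M. fps_nth f n * (fps_nth (g ^ n) k * (A ^^ k) v p))"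
    unfolding fps_op_eq_sum[OF nilpotent_fps_op[OF A g]] fps_op_power[OF A]
    by (simp add: fps_op_eq_sum[OF A] sum_distrib_left)
  also have "\<dots> = (\<Sum>k<M. \<Sum>n<M. fps_nth f n * (fps_nth (g ^ n) k * (A ^^ k) v p))"
    by (rule sum.swap)
  also have "\<dots> = (\<Sum>k<M. \<Sum>n\<le>k. fps_nth f n * (fps_nth (g ^ n) k * (A ^^ k) v p))"
    using startsby_zero_power_prefix[OF g]
    by (intro sum.cong refl sum.mono_neutral_right) auto
  also have "\<dots> = fps_op (f oo g) A v p"
    by (simp add: fps_op_eq_sum[OF A] fps_compose_nth sum_distrib_right atLeast0AtMost mult.assoc)
  finally show "fps_op f (fps_op g A) v p = fps_op (f oo g) A v p" .
qed

lemma fps_op_in: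
  assumes "nilpotent A M" "vspace V" "v \<in> V" "\<And>w. w \<in> V \<Longrightarrow> A w \<in> V"
  shows "fps_op f A v \<in> V"
proof -
  have "(A ^^ k) v \<in> V" for k by (induction k) (use assms in simp_all)
  then show ?thesis unfolding fps_op_eq_sum[OF assms(1)] by (intro vspace_sum assms)
qed

section \<open>The exponential of the inverse hyperbolic tangent\<close>

lemma fps_deriv_arctanh: "(1 - fps_X\<^sup>2) * fps_deriv fps_arctanh = 1"
proof (rule fps_ext)
  fix n
  have D: "fps_nth (fps_deriv fps_arctanh) n = (if even n then 1 else 0)" for n
    by (simp add: fps_arctanh_def del: of_nat_Suc of_nat_add)
  show "fps_nth ((1 - fps_X\<^sup>2) * fps_deriv fps_arctanh) n = fps_nth 1 n"
    by (auto simp: left_diff_distrib fps_X_power_mult_nth D simp del: fps_deriv_nth)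
qed

text \<open>Comparing coefficients, the differential equation is a two-term recurrence that determines the
  series from its constant term; the recurrence gives coefficient \<open>1\<close> in degree \<open>1\<close> and breaks off.\<close>

lemma fps_cayley_ode_unique:
  fixes g :: "complex fps"
  assumes "(1 + fps_X) * fps_deriv g = g" and "fps_nth g 0 = 1"
  shows "g = 1 + fps_X"
proof -
  have rec: "of_nat (n + 1) * fps_nth g (n + 1) + of_nat n * fps_nth g n = fps_nth g n" for n
  proof -
    have "fps_nth ((1 + fps_X) * fps_deriv g) n
        = of_nat (n + 1) * fps_nth g (n + 1) + of_nat n * fps_nth g n"
      by (cases n) (simp_all add: distrib_right)
    then show ?thesis by (simp add: assms(1))
  qed
  have G1: "fps_nth g 1 = 1" using rec[of 0] assms(2) by simp
  have G2: "fps_nth g (n + 2) = 0" for n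
  proof (induction n)
    case 0
    then show ?case using rec[of 1] G1 by (simp add: numeral_2_eq_2)
  next
    case (Suc n)
    then have "of_nat (n + 2 + 1) * fps_nth g (n + 2 + 1) = 0" using rec[of "n + 2"] by simp
    then have "fps_nth g (n + 2 + 1) = 0" unfolding mult_eq_0_iff of_nat_eq_0_iff by simp
    then show ?case by simp
  qed
  show ?thesis
  proof (rule fps_ext)
    fix n :: nat
    consider "n = 0" | "n = 1" | "n = (n - 2) + 2" by linarith
    then show "fps_nth g n = fps_nth (1 + fps_X) n"
    proof cases
      case 3
      then have "2 \<le> n" by simp
      moreover have "fps_nth g n = 0" using G2[of "n - 2"] unfolding 3[symmetric] .
      ultimately show ?thesis by simp
    qed (use assms(2) G1 in simp_all)
  qed
qed

text \<open>The power series form of \<open>exp(2 arctanh x) = (1 + x) / (1 - x)\<close>, with the denominator cleared.\<close>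

lemma fps_exp_arctanh:
  assumes "h \<noteq> 0"
  shows "(1 - fps_X) * (fps_exp h oo (fps_const (2 / h) * fps_arctanh)) = 1 + fps_X" (is "(1 - fps_X) * ?F = _")
proof -
  let ?G = "(1 - fps_X) * ?F"
  have a0: "fps_nth (fps_const (2 / h) * fps_arctanh) 0 = 0" by (simp add: fps_arctanh_def)
  have dF: "fps_deriv ?F = fps_const 2 * ?F * fps_deriv fps_arctanh"
    using assms by (simp add: fps_compose_deriv[OF a0] fps_exp_deriv fps_compose_mult_distrib[OF a0]
        mult.assoc[symmetric] fps_const_mult[symmetric] del: fps_const_mult)
       (simp add: fps_const_mult mult.commute mult.left_commute)
  \<comment> \<open>multiplying by the denominator turns \<open>F' = 2 F / (1 - x\<^sup>2)\<close> into an equation with a polynomial solution\<close>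
  have "(1 + fps_X) * fps_deriv ?G = (1 - fps_X\<^sup>2) * fps_deriv ?F - (1 + fps_X) * ?F"
    by (simp add: algebra_simps power2_eq_square)
  also have "(1 - fps_X\<^sup>2) * fps_deriv ?F = 2 * ?F * ((1 - fps_X\<^sup>2) * fps_deriv fps_arctanh)"
    unfolding dF by (simp add: mult_ac numeral_fps_const)
  finally have "(1 + fps_X) * fps_deriv ?G = ?G"
    unfolding fps_deriv_arctanh by (simp add: algebra_simps)
  then show ?thesis by (rule fps_cayley_ode_unique) (simp add: a0)
qed

lemma fps_exp_minus_arctanh:
  assumes "h \<noteq> 0"
  shows "(1 + fps_X) * (fps_exp (- h) oo (fps_const (2 / h) * fps_arctanh)) = 1 - fps_X" (is "_ * ?F' = _")
proof -
  let ?F = "fps_exp h oo (fps_const (2 / h) * fps_arctanh)"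
  have "?F * ?F' = (fps_exp h * fps_exp (- h)) oo (fps_const (2 / h) * fps_arctanh)"
    by (rule fps_compose_mult_distrib[symmetric]) (simp add: fps_arctanh_def)
  also have "\<dots> = 1" by (simp add: fps_exp_add_mult[symmetric])
  finally have "(1 - fps_X) * (?F * ?F') = 1 - fps_X" by simp
  then show ?thesis unfolding mult.assoc[symmetric] fps_exp_arctanh[OF assms] .
qed

section \<open>The adjoint action of the generators\<close>

lemma sum_single:
  fixes f :: "'i \<Rightarrow> 'a::comm_monoid_add"
  assumes "finite I" "i \<in> I" "\<And>k. k \<in> I \<Longrightarrow> k \<noteq> i \<Longrightarrow> f k = 0"
  shows "sum f I = f i"
  using assms by (subst sum.remove[of I i]) (auto intro!: sum.neutral)

text \<open>Every representative lies in its own class, so the tensor operator condition may be applied to any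
  series with boundedly many letters other than \<open>X\<close>.\<close>

lemma mem_U_h_class:
  assumes "c \<in> free_alg"
  shows "\<exists>C\<in>U_h h. c \<in> C"
proof -
  let ?R = "{(a, b). a \<in> free_alg \<and> b \<in> free_alg \<and> (\<lambda>w. a w - b w) \<in> rel_ideal h}"
  let ?z = "\<lambda>_. 0 :: complex"
  have "?z \<in> free_alg2" by (simp add: free_alg2_def)
  then have "(\<lambda>w. insert_rel ?z rel_XY w + insert_rel ?z (rel_HX h) w + insert_rel ?z (rel_HY h) w) \<in> rel_ideal h"
    unfolding rel_ideal_def by blast
  moreover have "insert_rel ?z r = (\<lambda>_. 0)" for r by (simp add: insert_rel_def)
  ultimately have "(\<lambda>w. 0) \<in> rel_ideal h" by simp
  then have "(c, c) \<in> ?R" using assms by simp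
  then have "c \<in> ?R `` {c}" by (rule ImageI[OF _ singletonI])
  moreover have "?R `` {c} \<in> U_h h" unfolding U_h_def by (rule quotientI[OF assms])
  ultimately show ?thesis by (rule bexI)
qed

lemma s_gen_free_alg: "s_gen g \<in> free_alg"
  unfolding free_alg_def s_gen_def by (intro CollectI exI[of _ 1]) (auto simp: nonX_def)

definition word_series :: "gen list \<Rightarrow> complex \<Rightarrow> series" where
  "word_series u c = (\<lambda>w. if w = u then c else 0)"

lemma word_series_mult: "word_series u c \<star> word_series u' c' = word_series (u @ u') (c * c')"
proof
  fix w
  show "(word_series u c \<star> word_series u' c') w = word_series (u @ u') (c * c') w"
  proof (cases "w = u @ u'")
    case True
    then have "(word_series u c \<star> word_series u' c') w
        = word_series u c (take (length u) w) * word_series u' c' (drop (length u) w)"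
      unfolding s_mult_def
    proof (intro sum_single)
      fix k assume "k \<in> {..length w}" "k \<noteq> length u"
      then have "length (take k w) \<noteq> length u" by simp
      then have "take k w \<noteq> u" by (rule contrapos_nn) (rule arg_cong)
      then show "word_series u c (take k w) * word_series u' c' (drop k w)
          = 0" by (simp add: word_series_def)
    qed simp_all
    then show ?thesis using True by (simp add: word_series_def)
  next
    case False
    then have "word_series u c (take i w) * word_series u' c' (drop i w) = 0" for i
      using append_take_drop_id[of i w] by (auto simp: word_series_def)
    then have "(word_series u c \<star> word_series u' c') w = 0" unfolding s_mult_def
    by (intro sum.neutral) simp
    then show ?thesis using False by (simp add: word_series_def[of "u @ u'"])
  qed
qed

lemma s_one_word_series:
  "s_one = word_series [] 1" and s_gen_word_series: "s_gen g = word_series [g] 1"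
  by (auto simp: s_one_def s_gen_def word_series_def)

lemma s_one_mult: "s_one \<star> b = b"
proof
  fix w
  show "(s_one \<star> b) w = b w"
    unfolding s_mult_def s_one_def by (subst sum_single[of _ 0]) auto
qed

lemma act_word_series: "act \<pi> (word_series u c) v = (\<lambda>p. c * act_word \<pi> u v p)"
  unfolding act_def word_series_def
  by (rule ext, subst Sum_any.expand_superset[of "{u}"]) auto

lemma act_word_Nil: "act_word \<pi> [] v = v"
  and act_word_Cons: "act_word \<pi> (g # w) v = \<pi> g (act_word \<pi> w v)"
  by (simp_all add: act_word_def)

lemma act_word_append: "act_word \<pi> (u @ w) v = act_word \<pi> u (act_word \<pi> w v)"
  by (induction u) (simp_all add: act_word_Nil act_word_Cons)

lemma act_word_replicate: "act_word \<pi> (replicate n g) v = (\<pi> g ^^ n) v"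
  by (induction n) (simp_all add: act_word_Nil act_word_Cons)

lemma act_s_gen: "act \<pi> (s_gen g) v = \<pi> g v"
  by (simp add: s_gen_word_series act_word_series act_word_Nil act_word_Cons)

lemma coprod_s_gen: "coprod h (s_gen g) = coprod_gen h g"
proof
  fix p :: "gen list \<times> gen list"
  obtain u v where p: "p = (u, v)" by fastforce
  have "coprod h (s_gen g) p = coprod_word h [g] p"
    unfolding coprod_def s_gen_def by (subst Sum_any.expand_superset[of "{[g]}"]) auto
  also have "\<dots> = (\<Sum>i\<le>length u. \<Sum>k\<le>length v. coprod_gen h g (take i u, take k v)
      * (s_one \<otimes>\<^sub>s s_one) (drop i u, drop k v))"
    by (simp add: s_mult2_def p)
  also have "\<dots> = (\<Sum>k\<le>length v. coprod_gen h g (take (length u) u, take k v)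
      * (s_one \<otimes>\<^sub>s s_one) (drop (length u) u, drop k v))"
    by (rule sum_single) (auto simp: s_tensor_def s_one_def)
  also have "\<dots> = coprod_gen h g (take (length u) u, take (length v) v)
      * (s_one \<otimes>\<^sub>s s_one) (drop (length u) u, drop (length v) v)"
    by (rule sum_single) (auto simp: s_tensor_def s_one_def)
  finally show "coprod h (s_gen g) p = coprod_gen h g p"
    by (simp add: p s_tensor_def s_one_def)
qed

lemma antipode_X_power:
  "antipode_word h (replicate n gX) = word_series (replicate n gX) ((- 1) ^ n)"
proof (induction n)
  case (Suc n)
  have "antipode_gen h gX = word_series [gX] (- 1)" by (auto simp: s_gen_def word_series_def)
  with Suc show ?case by (simp add: word_series_mult replicate_append_same del: antipode_gen.simps)
qed (simp add: s_one_word_series)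

lemma nonX_eq_0: "nonX w = 0 \<longleftrightarrow> w = replicate (length w) gX"
proof -
  have "nonX w = 0 \<longleftrightarrow> (\<forall>g\<in>set w. g = gX)"
    by (auto simp: nonX_def filter_empty_conv)
  then show ?thesis by (metis in_set_replicate replicate_eqI)
qed

lemma s_fX_replicate: "s_fX f (replicate n gX) = fps_nth f n"
  by (simp add: s_fX_def nonX_def)

lemma s_fX_nonzero: "s_fX f w \<noteq> 0 \<Longrightarrow> \<exists>n. w = replicate n gX"
  using nonX_eq_0 by (auto simp: s_fX_def split: if_splits)

abbreviation "sandwich i g k \<equiv> replicate i gX @ g # replicate k gX"

lemma sandwich_inj:
  assumes "g \<noteq> gX" "sandwich i g k = sandwich i' g k'"
  shows "i = i' \<and> k = k'"
proof -
  have *: "takeWhile (\<lambda>x. x = gX) (sandwich i g k) = replicate i gX" for i k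
    using assms(1) by (subst takeWhile_append2) auto
  have "replicate i gX = replicate i' gX"
    using arg_cong[OF assms(2), of "takeWhile (\<lambda>x. x = gX)"] by (simp only: *)
  then have "i = i'" by (metis length_replicate)
  then show ?thesis using arg_cong[OF assms(2), of length] by simp
qed

lemma s_fX_mult_gen:
  shows "(s_fX f \<star> s_gen g) (replicate i gX @ [g]) = fps_nth f i"
    and "(s_fX f \<star> s_gen g) u \<noteq> 0 \<Longrightarrow> \<exists>i. u = replicate i gX @ [g]"
proof -
  let ?u = "replicate i gX @ [g]"
  have "(s_fX f \<star> s_gen g) ?u = s_fX f (take i ?u) * s_gen g (drop i ?u)"
    unfolding s_mult_def
  proof (rule sum_single)
    fix q assume q: "q \<in> {..length ?u}" "q \<noteq> i"
    then have "length (drop q ?u) \<noteq> 1" by auto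
    then have "drop q ?u \<noteq> [g]" by (rule contrapos_nn) (simp only: length_Cons list.size One_nat_def)
    then show "s_fX f (take q ?u) * s_gen g (drop q ?u) = 0" by (simp add: s_gen_def)
  qed simp_all
  then show "(s_fX f \<star> s_gen g) ?u = fps_nth f i" by (simp add: s_fX_replicate s_gen_def)
next
  assume "(s_fX f \<star> s_gen g) u \<noteq> 0"
  then obtain q where "s_fX f (take q u) * s_gen g (drop q u) \<noteq> 0"
    unfolding s_mult_def by (meson sum.neutral)
  then have "s_fX f (take q u) \<noteq> 0" "drop q u = [g]" by (auto simp: s_gen_def split: if_splits)
  then show "\<exists>i. u = replicate i gX @ [g]" by (metis append_take_drop_id s_fX_nonzero)
qed

text \<open>A word with exactly one letter \<open>g\<close> and otherwise only letters \<open>X\<close> is split in a unique way, so the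
  convolution has a single term.  These are the words that occur in the antipode of \<open>H\<close>.\<close>

lemma s_fX_gen_s_fX:
  assumes "g \<noteq> gX"
  shows "(s_fX f \<star> s_gen g \<star> s_fX f') (sandwich i g k) = fps_nth f i * fps_nth f' k"
    and "(s_fX f \<star> s_gen g \<star> s_fX f') w \<noteq> 0 \<Longrightarrow> \<exists>i k. w = sandwich i g k"
proof -
  let ?c = "s_fX f \<star> s_gen g" and ?w = "sandwich i g k"
  have "(?c \<star> s_fX f') ?w = ?c (take (Suc i) ?w) * s_fX f' (drop (Suc i) ?w)"
    unfolding s_mult_def[of ?c]
  proof (rule sum_single)
    fix q assume q: "q \<in> {..length ?w}" "q \<noteq> Suc i"
    show "?c (take q ?w) * s_fX f' (drop q ?w) = 0"
    proof (rule ccontr)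
      assume "\<not> ?thesis"
      then have "?c (take q ?w) \<noteq> 0" "s_fX f' (drop q ?w) \<noteq> 0" by auto
      then obtain i' k' where *: "take q ?w = replicate i' gX @ [g]" "drop q ?w = replicate k' gX"
        using s_fX_mult_gen(2) s_fX_nonzero by meson
      then have "sandwich i' g k' = ?w" using append_take_drop_id[of q ?w] by simp
      then have "i' = i" using sandwich_inj[OF assms] by blast
      then have "q = Suc i" using arg_cong[OF *(1), of length] q by auto
      with q show False by simp
    qed
  qed simp_all
  then show "(?c \<star> s_fX f') ?w = fps_nth f i * fps_nth f' k"
    by (simp add: s_fX_mult_gen(1) s_fX_replicate)
next
  let ?c = "s_fX f \<star> s_gen g"
  assume "(?c \<star> s_fX f') w \<noteq> 0"
  then obtain q where "?c (take q w) * s_fX f' (drop q w) \<noteq> 0"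
    unfolding s_mult_def[of ?c] by (meson sum.neutral)
  then have "?c (take q w) \<noteq> 0" "s_fX f' (drop q w) \<noteq> 0" by auto
  then obtain i k where *: "take q w = replicate i gX @ [g]" "drop q w = replicate k gX"
    using s_fX_mult_gen(2) s_fX_nonzero by meson
  then have "sandwich i g k = w" using append_take_drop_id[of q w] by simp
  then show "\<exists>i k. w = sandwich i g k" by blast
qed

text \<open>The series is the antipode of \<open>H\<close> when \<open>g = H\<close>, \<open>f = exp(hX)\<close> and \<open>f' = exp(-hX)\<close>; it acts by composing the
  three operators, the infinite sum over words being cut off by nilpotency on either side of \<open>g\<close>.\<close>

lemma act_sandwich:
  assumes "g \<noteq> gX" and X: "nilpotent (\<pi> gX) M" and g: "linear_op (\<pi> g)"
  shows "act \<pi> (\<lambda>w. - (s_fX f \<star> s_gen g \<star> s_fX f') w) x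
     = (\<lambda>p. - fps_op f (\<pi> gX) (\<pi> g (fps_op f' (\<pi> gX) x)) p)"
proof
  fix p
  let ?c = "s_fX f \<star> s_gen g \<star> s_fX f'" and ?\<iota> = "\<lambda>(i, k). sandwich i g k"
  let ?J = "{..<M} \<times> {..<M}"
  have lin: "linear_op (\<pi> gX ^^ i)" for i
    using X linear_op_funpow by (auto simp: nilpotent_def)
  have word: "act_word \<pi> (sandwich i g k) x = (\<pi> gX ^^ i) (\<pi> g ((\<pi> gX ^^ k) x))" for i k
    by (simp add: act_word_append act_word_Cons act_word_replicate)
  have inj: "inj_on ?\<iota> ?J"
  proof (rule inj_onI)
    fix a b assume "?\<iota> a = ?\<iota> b"
    then have "sandwich (fst a) g (snd a)
        = sandwich (fst b) g (snd b)" by (simp only: case_prod_beta)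
    from sandwich_inj[OF assms(1) this] show "a = b" by (simp only: prod_eq_iff)
  qed
  have "act \<pi> (\<lambda>w. - ?c w) x p = (\<Sum>w\<in>?\<iota> ` ?J. - ?c w * act_word \<pi> w x p)"
    unfolding act_def
  proof (rule Sum_any.expand_superset)
    show "{w. - ?c w * act_word \<pi> w x p \<noteq> 0} \<subseteq> ?\<iota> ` ?J"
    proof
      fix w assume "w \<in> {w. - ?c w * act_word \<pi> w x p \<noteq> 0}"
      then have nz: "?c w \<noteq> 0" "act_word \<pi> w x p \<noteq> 0" by auto
      then obtain i k where w: "w = sandwich i g k" using s_fX_gen_s_fX(2)[OF assms(1)] by meson
      have "i < M"
        using nz(2) nilpotentD[OF X, of i] unfolding w word by (metis not_less)
      moreover have "k < M"
        using nz(2) nilpotentD[OF X, of k] linear_op_zero[OF g] linear_op_zero[OF lin[of i]]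
        unfolding w word by (metis not_less)
      ultimately show "w \<in> ?\<iota> ` ?J" unfolding w by force
    qed
  qed simp
  also have "\<dots> = (\<Sum>i<M. \<Sum>k<M. - (fps_nth f i * fps_nth f' k) * (\<pi> gX ^^ i) (\<pi> g ((\<pi> gX ^^ k) x)) p)"
    unfolding sum.reindex[OF inj] sum.cartesian_product
    by (intro sum.cong refl) (auto simp: s_fX_gen_s_fX(1)[OF assms(1)] word)
  also have "\<dots> = - fps_op f (\<pi> gX) (\<pi> g (fps_op f' (\<pi> gX) x)) p"
    unfolding fps_op_eq_sum[OF X] linear_op_sum[OF g] linear_op_sum[OF lin]
    by (simp add: sum_distrib_left sum_negf mult.assoc)
  finally show "act \<pi> (\<lambda>w. - ?c w) x p = - fps_op f (\<pi> gX) (\<pi> g (fps_op f' (\<pi> gX) x)) p" .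
qed

lemma ad_X:
  assumes t: "linear_between V V' t" and x: "x \<in> V" "\<pi> gX x \<in> V"
  shows "ad h \<pi>' \<pi> (s_gen gX) t x = (\<lambda>p. \<pi>' gX (t x) p - t (\<pi> gX x) p)"
proof
  fix p
  have S0: "act \<pi> (antipode_word h []) x = x"
    by (simp add: s_one_word_series act_word_series act_word_Nil)
  have SX: "act \<pi> (antipode_word h [gX]) x = (\<lambda>p. - \<pi> gX x p)"
    using antipode_X_power[of h 1] by (simp add: act_word_series act_word_Nil act_word_Cons del: antipode_word.simps)
  have "t (\<lambda>p. - 1 * \<pi> gX x p) = (\<lambda>p. - 1 * t (\<pi> gX x) p)"
    using t x unfolding linear_between_def by blast
  then have tX: "t (\<lambda>p. - \<pi> gX x p) = (\<lambda>p. - t (\<pi> gX x) p)" by simp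
  have "ad h \<pi>' \<pi> (s_gen gX) t x p = (\<Sum>(u, v)\<in>{([gX], []), ([], [gX])}.
      coprod_gen h gX (u, v) * act_word \<pi>' u (t (act \<pi> (antipode_word h v) x)) p)"
    unfolding ad_def coprod_s_gen
    by (rule Sum_any.expand_superset) (auto simp: s_tensor_def s_gen_def s_one_def split: if_splits)
  also have "\<dots> = \<pi>' gX (t x) p - t (\<pi> gX x) p"
    by (simp add: s_tensor_def s_gen_def s_one_def S0 SX tX act_word_Nil act_word_Cons del: antipode_word.simps)
  finally show "ad h \<pi>' \<pi> (s_gen gX) t x p = \<pi>' gX (t x) p - t (\<pi> gX x) p" .
qed

text \<open>The coproduct of \<open>H\<close> is supported on the two families of pairs \<open>(H, X\<^sup>n)\<close> and \<open>(X\<^sup>n, H)\<close>; summing each of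
  them yields one of the two terms.\<close>

lemma ad_H:
  assumes t: "linear_between V V' t" and V: "vspace V" and x: "x \<in> V"
    and VX: "\<And>v. v \<in> V \<Longrightarrow> \<pi> gX v \<in> V" and VH: "\<And>v. v \<in> V \<Longrightarrow> \<pi> gH v \<in> V"
    and X: "nilpotent (\<pi> gX) M" and X': "nilpotent (\<pi>' gX) M"
    and H: "linear_op (\<pi> gH)" and H': "linear_op (\<pi>' gH)"
  shows "ad h \<pi>' \<pi> (s_gen gH) t x = (\<lambda>p. \<pi>' gH (t (fps_op (fps_exp (- h)) (\<pi> gX) x)) p
     - fps_op (fps_exp (- h)) (\<pi>' gX) (t (fps_op (fps_exp h) (\<pi> gX) (\<pi> gH (fps_op (fps_exp (- h)) (\<pi> gX) x)))) p)"
proof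
  fix p
  define y where "y = fps_op (fps_exp h) (\<pi> gX) (\<pi> gH (fps_op (fps_exp (- h)) (\<pi> gX) x))"
  have yV: "y \<in> V" unfolding y_def by (intro fps_op_in[OF X V] VX VH x)
  have powV: "(\<pi> gX ^^ n) x \<in> V" for n by (induction n) (simp_all add: x VX)
  have scale: "t (\<lambda>p. c * v p) = (\<lambda>p. c * t v p)" if "v \<in> V" for c v
    using that t unfolding linear_between_def by blast
  have t0: "t (\<lambda>p. 0) = (\<lambda>p. 0)" using scale[of "\<lambda>p. 0" 0] V by (simp add: vspace_def)
  have linX': "linear_op (\<pi>' gX ^^ n)" for n using X' linear_op_funpow by (auto simp: nilpotent_def)
  have fX_gH: "s_fX f [gH] = 0" for f by (simp add: s_fX_def nonX_def)
  have neg: "(\<pi>' gX ^^ n) (\<lambda>p. - 1 * w p) = (\<lambda>p. - 1 * (\<pi>' gX ^^ n) w p)" for n w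
    by (rule linear_op_scale[OF linX'])
  have SX: "act \<pi> (antipode_word h (replicate n gX)) x = (\<lambda>p. (- 1) ^ n * (\<pi> gX ^^ n) x p)" for n
    unfolding antipode_X_power act_word_series act_word_replicate ..
  have SH: "act \<pi> (antipode_word h [gH]) x = (\<lambda>p. - y p)"
    unfolding y_def by (simp add: s_one_mult act_sandwich[OF _ X H])
  have tX: "t (\<lambda>p. (- 1) ^ n * (\<pi> gX ^^ n) x p) = (\<lambda>p. (- 1) ^ n * t ((\<pi> gX ^^ n) x) p)" for n
    by (rule scale[OF powV])
  have tH: "t (\<lambda>p. - y p) = (\<lambda>p. - 1 * t y p)" using scale[OF yV, of "- 1"] by simp
  define F where "F
      = (\<lambda>(u, v). coprod_gen h gH (u, v) * act_word \<pi>' u (t (act \<pi> (antipode_word h v) x)) p)"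
  let ?\<iota> = "\<lambda>n. ([gH], replicate n gX)" and ?\<kappa> = "\<lambda>n. (replicate n gX, [gH])"
  have ne: "replicate n gX \<noteq> [gH]" for n by (cases n) auto
  have F1: "F (?\<iota> n) = fps_nth (fps_exp (- h)) n * \<pi>' gH (t ((\<pi> gX ^^ n) x)) p" for n
    unfolding F_def using ne[of n]
    by (simp add: s_tensor_def s_fX_replicate s_gen_def fX_gH SX tX
         act_word_Nil act_word_Cons linear_op_scale[OF H'] power_minus' del: antipode_word.simps)
  have F2: "F (?\<kappa> n) = - (fps_nth (fps_exp (- h)) n * (\<pi>' gX ^^ n) (t y) p)" for n
    unfolding F_def using ne[of n]
    by (simp add: s_tensor_def s_fX_replicate s_gen_def fX_gH SH tH
         act_word_replicate neg[simplified] del: antipode_word.simps)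
  have supp: "{q. F q \<noteq> 0} \<subseteq> ?\<iota> ` {..<M} \<union> ?\<kappa> ` {..<M}"
  proof
    fix q assume "q \<in> {q. F q \<noteq> 0}"
    then have nz: "F q \<noteq> 0" by simp
    obtain u v where q: "q = (u, v)" by fastforce
    from nz have "coprod_gen h gH (u, v) \<noteq> 0" unfolding F_def q by auto
    then have "(u = [gH] \<and> s_fX (fps_exp h) v \<noteq> 0) \<or> (v = [gH] \<and> s_fX (fps_exp (- h)) u \<noteq> 0)"
      by (auto simp: s_tensor_def s_gen_def split: if_splits)
    then have "(\<exists>n. q = ?\<iota> n) \<or> (\<exists>n. q = ?\<kappa> n)"
      unfolding q using s_fX_nonzero[of "fps_exp h" v] s_fX_nonzero[of "fps_exp (- h)" u] by auto
    then consider n where "q = ?\<iota> n" | n where "q = ?\<kappa> n" by blast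
    then show "q \<in> ?\<iota> ` {..<M} \<union> ?\<kappa> ` {..<M}"
    proof cases
      case 1
      have "n < M"
      proof (rule ccontr)
        assume "\<not> n < M"
        then have "(\<pi> gX ^^ n) x = (\<lambda>p. 0)" using nilpotentD[OF X] by simp
        then show False using nz unfolding 1 F1 by (simp add: t0 linear_op_zero[OF H'])
      qed
      with 1 show ?thesis by blast
    next
      case 2
      have "n < M"
      proof (rule ccontr)
        assume "\<not> n < M"
        then have "(\<pi>' gX ^^ n) (t y) = (\<lambda>p. 0)" using nilpotentD[OF X'] by simp
        then show False using nz unfolding 2 F2 by simp
      qed
      with 2 show ?thesis by blast
    qed
  qed
  have "ad h \<pi>' \<pi> (s_gen gH) t x p = Sum_any F"
    unfolding ad_def coprod_s_gen F_def ..
  also have "\<dots> = (\<Sum>q\<in>?\<iota> ` {..<M} \<union> ?\<kappa> ` {..<M}. F q)"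
    by (rule Sum_any.expand_superset[OF _ supp]) simp
  also have "\<dots> = (\<Sum>q\<in>?\<iota> ` {..<M}. F q) + (\<Sum>q\<in>?\<kappa> ` {..<M}. F q)"
    by (rule sum.union_disjoint) (auto simp: ne ne[symmetric])
  also have "(\<Sum>q\<in>?\<iota> ` {..<M}. F q) = (\<Sum>n<M. F (?\<iota> n))"
    by (subst sum.reindex) (auto simp: inj_on_def)
  also have "(\<Sum>q\<in>?\<kappa> ` {..<M}. F q) = (\<Sum>n<M. F (?\<kappa> n))"
    by (subst sum.reindex) (auto simp: inj_on_def)
  finally have "ad h \<pi>' \<pi> (s_gen gH) t x p = \<pi>' gH (t (fps_op (fps_exp (- h)) (\<pi> gX) x)) p
     - fps_op (fps_exp (- h)) (\<pi>' gX) (t y) p"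
    unfolding F1 F2 fps_op_eq_sum[OF X, of "fps_exp (- h)" x] fps_op_eq_sum[OF X', of _ "t y"]
      linear_between_sum[OF V t powV] linear_op_sum[OF H']
    by (simp add: sum_negf)
  then show "ad h \<pi>' \<pi> (s_gen gH) t x p = \<pi>' gH (t (fps_op (fps_exp (- h)) (\<pi> gX) x)) p
     - fps_op (fps_exp (- h)) (\<pi>' gX) (t (fps_op (fps_exp h) (\<pi> gX) (\<pi> gH (fps_op (fps_exp (- h)) (\<pi> gX) x)))) p"
    unfolding y_def .
qed

section \<open>The monomial basis of an irreducible representation\<close>

declare irrep.simps [simp del]

lemma spins_half: "j \<in> spins \<longleftrightarrow> (\<exists>N::nat. j = real N / 2)"
  by (auto simp: spins_def)

lemma wts_half: "wts (real N / 2) = (\<lambda>k. - (real N / 2) + real k) ` {..N}"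
  by (auto simp: wts_def)

lemma finite_wts [simp]: "j \<in> spins \<Longrightarrow> finite (wts j)"
  unfolding spins_half by (elim exE) (simp only: wts_half finite_imageI finite_atMost)

lemma ket_W: "m \<in> wts j \<Longrightarrow> ket m \<in> W j"
  by (auto simp: W_def ket_def)

lemma linear_lin_ext: "linear_op (lin_ext j f)"
  by (auto simp: linear_between_def lin_ext_def sum.distrib sum_distrib_left algebra_simps)

lemma W_eqI:
  assumes "\<And>p. p \<notin> wts j \<Longrightarrow> v p = 0" shows "v \<in> W j"
  using assms by (simp add: W_def)

lemma W_expand:
  assumes "j \<in> spins" "v \<in> W j"
  shows "v = (\<lambda>p. \<Sum>m\<in>wts j. v m * ket m p)"
proof
  fix p
  show "v p = (\<Sum>m\<in>wts j. v m * ket m p)"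
    using assms by (simp add: ket_def W_def if_distrib[of "\<lambda>c. _ * c"] cong: if_cong)
qed

lemma linear_op_expand:
  assumes "linear_op A" "j \<in> spins" "v \<in> W j"
  shows "A v = (\<lambda>p. \<Sum>m\<in>wts j. v m * A (ket m) p)"
  by (subst W_expand[OF assms(2,3)]) (rule linear_op_sum[OF assms(1)])

lemma lin_ext_ket: "j \<in> spins \<Longrightarrow> m \<in> wts j \<Longrightarrow> lin_ext j f (ket m) = f m"
  by (auto simp: lin_ext_def ket_def if_distrib[of "\<lambda>c. c * _"] cong: if_cong)

text \<open>The coefficient of \<open>Z\<^sub>+\<close> from weight \<open>m\<close> to weight \<open>m + 1\<close>, which is also that of \<open>Z\<^sub>-\<close> from \<open>m + 1\<close>
  to \<open>m\<close>.  It vanishes at both ends of the weight string, so that \<open>Z\<^sub>+\<close> and \<open>Z\<^sub>-\<close> are weighted shifts on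
  coordinates without any boundary case.\<close>

definition ladder :: "real \<Rightarrow> real \<Rightarrow> complex" where
  "ladder j m = complex_of_real (sqrt ((j - m) * (j + m + 1)))"

lemma Zplus_apply:
  assumes "j \<in> spins" "v \<in> W j"
  shows "Zplus j v p = ladder j (p - 1) * v (p - 1)"
proof -
  have "Zplus j v p = (\<Sum>m\<in>wts j. if m = p - 1 then v m * ladder j m else 0)"
    unfolding Zplus_def lin_ext_def by (intro sum.cong refl) (auto simp: ket_def ladder_def)
  also have "\<dots> = ladder j (p - 1) * v (p - 1)"
    using assms by (simp add: W_def)
  finally show ?thesis .
qed

lemma Zminus_apply:
  assumes "j \<in> spins" "v \<in> W j"
  shows "Zminus j v p = ladder j p * v (p + 1)"
proof -
  have "Zminus j v p = (\<Sum>m\<in>wts j. if m = p + 1 then v m * ladder j (m - 1) else 0)"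
    unfolding Zminus_def lin_ext_def
    by (intro sum.cong refl) (auto simp: ket_def ladder_def algebra_simps)
  also have "\<dots> = ladder j p * v (p + 1)"
    using assms by (simp add: W_def)
  finally show ?thesis .
qed

lemma Hop_apply:
  assumes "j \<in> spins" "v \<in> W j"
  shows "Hop j v p = complex_of_real (2 * p) * v p"
proof -
  have "Hop j v p = (\<Sum>m\<in>wts j. if m = p then v m * complex_of_real (2 * m) else 0)"
    unfolding Hop_def lin_ext_def by (intro sum.cong refl) (auto simp: ket_def)
  also have "\<dots> = complex_of_real (2 * p) * v p"
    using assms by (simp add: W_def)
  finally show ?thesis .
qed

lemma ladder_bottom [simp]: "ladder j (- j - 1) = 0" and ladder_top [simp]: "ladder j j = 0"
  by (simp_all add: ladder_def)

lemma cnj_ladder [simp]: "cnj (ladder j m) = ladder j m"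
  by (simp add: ladder_def)

lemma Zplus_W:
  assumes "j \<in> spins" "v \<in> W j" shows "Zplus j v \<in> W j"
proof (rule W_eqI)
  fix p assume p: "p \<notin> wts j"
  obtain N where j: "j = real N / 2" using assms(1) spins_half by blast
  show "Zplus j v p = 0"
  proof (cases "p - 1 \<in> wts j")
    case True
    then obtain k where k: "k \<le> N" "p - 1 = - j + real k" by (auto simp: j wts_half)
    then have "p = - j + real (Suc k)" by simp
    then have "\<not> Suc k \<le> N" using p unfolding j wts_half by (metis atMost_iff imageI)
    then have "p - 1 = j" using k by (simp add: j)
    then show ?thesis using Zplus_apply[OF assms] by simp
  qed (use assms Zplus_apply[OF assms] in \<open>simp add: W_def\<close>)
qed

lemma Hop_W: "j \<in> spins \<Longrightarrow> v \<in> W j \<Longrightarrow> Hop j v \<in> W j"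
  by (intro W_eqI) (simp add: Hop_apply, simp add: W_def)

text \<open>The norm of \<open>Z\<^sub>+\<^sup>k |j, -j\<rangle>\<close> for \<open>N = 2j\<close>; beyond the top weight this vector is zero.\<close>

definition monomial_norm :: "nat \<Rightarrow> nat \<Rightarrow> real" where
  "monomial_norm N k = (if k \<le> N then sqrt (fact k * fact N / fact (N - k)) else 0)"

lemma monomial_norm_nonzero: "k \<le> N \<Longrightarrow> monomial_norm N k \<noteq> 0"
  by (simp add: monomial_norm_def)

lemma monomial_norm_Suc:
  "monomial_norm N (Suc k)
      = monomial_norm N k * sqrt ((real N / 2 - (- (real N / 2) + real k)) * (real N / 2 + (- (real N / 2) + real k) + 1))"
proof -
  have e: "(real N / 2 - (- (real N / 2) + real k)) * (real N / 2 + (- (real N / 2) + real k) + 1)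
     = (real N - real k) * (real k + 1)" by simp
  show ?thesis
  proof (cases "Suc k \<le> N")
    case True
    then have "fact (N - k) = (real N - real k) * fact (N - Suc k)"
      using fact_Suc[of "N - Suc k", where 'a = real] by (simp add: of_nat_diff Suc_diff_Suc)
    moreover have "real N - real k \<noteq> 0" using True by simp
    ultimately have "fact (Suc k) * fact N / fact (N - Suc k)
        = fact k * fact N / fact (N - k) * ((real N - real k) * (real k + 1))"
      by simp
    then show ?thesis using True unfolding e monomial_norm_def
    by (simp only: real_sqrt_mult[symmetric] if_True Suc_leD)
  next
    case False
    then show ?thesis unfolding e by (cases "k = N") (simp_all add: monomial_norm_def)
  qed
qed

definition monomial :: "nat \<Rightarrow> nat \<Rightarrow> real \<Rightarrow> complex" where
  "monomial N k = (\<lambda>p. complex_of_real (monomial_norm N k) * ket (- (real N / 2) + real k) p)"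

lemma monomial_W: "monomial N k \<in> W (real N / 2)"
  by (intro W_eqI) (auto simp: monomial_def monomial_norm_def ket_def wts_half)

lemma half_spins [simp]: "real N / 2 \<in> spins"
  using spins_half by blast

lemma Zplus_monomial: "Zplus (real N / 2) (monomial N k) = monomial N (Suc k)"
proof
  fix p
  show "Zplus (real N / 2) (monomial N k) p = monomial N (Suc k) p"
    unfolding Zplus_apply[OF half_spins monomial_W] unfolding monomial_def monomial_norm_Suc of_real_mult
    by (auto simp: ket_def ladder_def)
qed

lemma Hop_monomial:
  "Hop (real N / 2) (monomial N k) = (\<lambda>p. complex_of_real (2 * real k - real N) * monomial N k p)"
  by (rule ext, unfold Hop_apply[OF half_spins monomial_W], unfold monomial_def) (auto simp: ket_def)

lemma Zplus_power_monomial: "(Zplus (real N / 2) ^^ n) (monomial N k) = monomial N (n + k)"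
  by (induction n) (simp_all add: Zplus_monomial)

lemma ket_monomial:
  "k \<le> N \<Longrightarrow> ket (- (real N / 2) + real k) = (\<lambda>p. of_real (1 / monomial_norm N k) * monomial N k p)"
  using monomial_norm_nonzero[of k N] by (auto simp: monomial_def)

lemma linear_Zplus: "linear_op (Zplus j)" and linear_Hop: "linear_op (Hop j)"
  by (simp_all add: Zplus_def Hop_def linear_lin_ext)

lemma Zplus_nilpotent: "nilpotent (Zplus (real N / 2)) (Suc N)"
  unfolding nilpotent_def
proof (intro conjI allI)
  let ?Z = "Zplus (real N / 2)"
  show lin: "linear_op ?Z" by (rule linear_Zplus)
  fix v
  have kill: "(?Z ^^ Suc N) (ket m) = (\<lambda>p. 0)" if "m \<in> wts (real N / 2)" for m
  proof -
    from that obtain k where k: "k \<le> N" "m = - (real N / 2) + real k" by (auto simp: wts_half)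
    show ?thesis
      unfolding k(2) ket_monomial[OF k(1)] linear_op_scale[OF linear_op_funpow[OF lin]] Zplus_power_monomial
      by (simp add: monomial_def monomial_norm_def)
  qed
  have "?Z v = (\<lambda>p. \<Sum>m\<in>wts (real N / 2). v m * ?Z (ket m) p)"
    unfolding Zplus_def lin_ext_def[of _ _ v] by (intro ext sum.cong refl) (simp add: lin_ext_ket)
  then have "(?Z ^^ Suc N) v = (?Z ^^ N) (\<lambda>p. \<Sum>m\<in>wts (real N / 2). v m * ?Z (ket m) p)"
    by (simp add: funpow_swap1)
  also have "\<dots> = (\<lambda>p. \<Sum>m\<in>wts (real N / 2). v m * (?Z ^^ N) (?Z (ket m)) p)"
    by (rule linear_op_sum[OF linear_op_funpow[OF lin]])
  also have "\<dots> = (\<lambda>p. 0)"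
    using kill by (simp add: funpow_swap1)
  finally show "(?Z ^^ Suc N) v = (\<lambda>p. 0)" .
qed

lemma half_hZ_power: "(half_hZ h j ^^ k) v = (\<lambda>p. (h / 2) ^ k * (Zplus j ^^ k) v p)"
proof (induction k)
  case (Suc k)
  then show ?case by (simp add: half_hZ_def[abs_def] linear_op_scale[OF linear_Zplus] mult.assoc)
qed simp

lemma linear_half_hZ: "linear_op (half_hZ h j)"
  using linear_Zplus[of j] unfolding linear_between_def half_hZ_def[abs_def]
  by (auto simp: algebra_simps)

lemma half_hZ_nilpotent: "nilpotent (half_hZ h (real N / 2)) (Suc N)"
  using Zplus_nilpotent[of N] by (simp add: nilpotent_def linear_half_hZ half_hZ_power del: funpow.simps)

abbreviation "X_series h \<equiv> fps_const (2 / h) * fps_arctanh"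

lemma X_series_0: "fps_nth (X_series h) 0 = 0" by (simp add: fps_arctanh_def)

lemma irrep_X: "irrep h (real N / 2) gX = fps_op (X_series h) (half_hZ h (real N / 2))"
  by (rule ext) (simp add: irrep.simps fps_op_const_mult[OF half_hZ_nilpotent])

lemma half_hZ_W: "v \<in> W (real N / 2) \<Longrightarrow> half_hZ h (real N / 2) v \<in> W (real N / 2)"
  using Zplus_W[OF half_spins, of v N] vspace_W[of "real N / 2"] unfolding vspace_def half_hZ_def[abs_def]
  by blast

lemma irrep_X_nilpotent: "nilpotent (irrep h (real N / 2) gX) (Suc N)"
  unfolding irrep_X by (rule nilpotent_fps_op[OF half_hZ_nilpotent X_series_0])

lemma irrep_X_W: "v \<in> W (real N / 2) \<Longrightarrow> irrep h (real N / 2) gX v \<in> W (real N / 2)"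
  unfolding irrep_X by (rule fps_op_in[OF half_hZ_nilpotent vspace_W]) (simp_all add: half_hZ_W)

abbreviation "expX s h N \<equiv> fps_op (fps_exp s) (irrep h (real N / 2) gX)"

lemma expX_compose: "expX s h N v = fps_op (fps_exp s oo X_series h) (half_hZ h (real N / 2)) v"
  unfolding irrep_X by (rule fps_op_compose[OF half_hZ_nilpotent X_series_0])

lemma one_minus_half_hZ:
  "(\<lambda>p. v p - half_hZ h (real N / 2) v p) = fps_op (1 - fps_X) (half_hZ h (real N / 2)) v"
  and one_plus_half_hZ: "(\<lambda>p. v p + half_hZ h (real N / 2) v p)
      = fps_op (1 + fps_X) (half_hZ h (real N / 2)) v"
  by (simp_all add: fps_op_diff[OF half_hZ_nilpotent] fps_op_add[OF half_hZ_nilpotent]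
     fps_op_1[OF half_hZ_nilpotent] fps_op_X[OF half_hZ_nilpotent])

text \<open>As \<open>hX = 2 arctanh(a Z\<^sub>+)\<close>, the operator \<open>exp(hX)\<close> is the Cayley transform of \<open>a Z\<^sub>+\<close>.  Clearing the
  denominator in the three ways used below keeps everything linear in \<open>Z\<^sub>+\<close>.\<close>

lemma expX_cayley:
  assumes "h \<noteq> 0"
  shows "expX h h N (\<lambda>p. v p - half_hZ h (real N / 2) v p) = (\<lambda>p. v p + half_hZ h (real N / 2) v p)"
    and "expX (- h) h N (\<lambda>p. v p + half_hZ h (real N / 2) v p)
        = (\<lambda>p. v p - half_hZ h (real N / 2) v p)"
    and "expX h h N v = w \<Longrightarrow> (\<lambda>p. w p - half_hZ h (real N / 2) w p) = (\<lambda>p. v p + half_hZ h (real N / 2) v p)"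
proof -
  have "(fps_exp h oo X_series h) * (1 - fps_X) = 1 + fps_X"
    using fps_exp_arctanh[OF assms] by (simp only: mult.commute)
  then show "expX h h N (\<lambda>p. v p - half_hZ h (real N / 2) v p)
      = (\<lambda>p. v p + half_hZ h (real N / 2) v p)"
    unfolding one_minus_half_hZ one_plus_half_hZ expX_compose fps_op_mult[OF half_hZ_nilpotent]
    by (simp only:)
next
  have "(fps_exp (- h) oo X_series h) * (1 + fps_X) = 1 - fps_X"
    using fps_exp_minus_arctanh[OF assms] by (simp only: mult.commute)
  then show "expX (- h) h N (\<lambda>p. v p + half_hZ h (real N / 2) v p)
      = (\<lambda>p. v p - half_hZ h (real N / 2) v p)"
    unfolding one_minus_half_hZ one_plus_half_hZ expX_compose fps_op_mult[OF half_hZ_nilpotent]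
    by (simp only:)
next
  assume w: "expX h h N v = w"
  show "(\<lambda>p. w p - half_hZ h (real N / 2) w p) = (\<lambda>p. v p + half_hZ h (real N / 2) v p)"
    unfolding w[symmetric] one_minus_half_hZ one_plus_half_hZ expX_compose fps_op_mult[OF half_hZ_nilpotent]
      fps_exp_arctanh[OF assms] ..
qed

lemma expX_inverse: "expX h h N (expX (- h) h N v) = v" "expX (- h) h N (expX h h N v) = v"
  by (simp_all add: fps_op_mult[OF irrep_X_nilpotent] fps_exp_add_mult[symmetric] fps_op_1[OF irrep_X_nilpotent])

section \<open>Generating functions of the twist coefficients\<close>

text \<open>A linear form on polynomials in \<open>z1, z2\<close> is given by its values \<open>\<chi> k1 k2\<close> on monomials.  Then
  \<open>correlation N1 N2 \<gamma> \<chi> k1 k2\<close> is its value on \<open>z1\<^sup>k\<^sup>1 z2\<^sup>k\<^sup>2 \<Sum> \<gamma> p1 p2 z1\<^sup>p\<^sup>1 z2\<^sup>p\<^sup>2\<close>; for forms that vanish on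
  monomials of degree above \<open>N1\<close> or \<open>N2\<close> in the respective variable, the finite sum stands for the full
  power series.\<close>

definition correlation :: "nat \<Rightarrow> nat \<Rightarrow> (nat \<Rightarrow> nat \<Rightarrow> complex) \<Rightarrow> (nat \<Rightarrow> nat \<Rightarrow> complex) \<Rightarrow> nat \<Rightarrow> nat \<Rightarrow> complex" where
  "correlation N1 N2 \<gamma> \<chi> k1 k2 = (\<Sum>p1\<le>N1. \<Sum>p2\<le>N2. \<gamma> p1 p2 * \<chi> (k1 + p1) (k2 + p2))"

definition supported :: "nat \<Rightarrow> nat \<Rightarrow> (nat \<Rightarrow> nat \<Rightarrow> complex) \<Rightarrow> bool" where
  "supported N1 N2 \<chi> \<longleftrightarrow> (\<forall>l1 l2. N1 < l1 \<or> N2 < l2 \<longrightarrow> \<chi> l1 l2 = 0)"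

text \<open>Multiplying the power series by \<open>z2\<close> is the same as shifting the monomial.\<close>

lemma correlation_shift2:
  assumes "supported N1 N2 \<chi>"
  shows "correlation N1 N2 (\<lambda>p1 p2. case p2 of 0 \<Rightarrow> 0 | Suc q \<Rightarrow> \<gamma> p1 q) \<chi> k1 k2
      = correlation N1 N2 \<gamma> \<chi> k1 (Suc k2)"
proof -
  have "(\<Sum>p2\<le>N2. (case p2 of 0 \<Rightarrow> 0 | Suc q \<Rightarrow> \<gamma> p1 q) * \<chi> (k1 + p1) (k2 + p2))
      = (\<Sum>p2\<le>N2. \<gamma> p1 p2 * \<chi> (k1 + p1) (Suc k2 + p2))" for p1
  proof -
    have "(\<Sum>p2\<le>N2. (case p2 of 0 \<Rightarrow> 0 | Suc q \<Rightarrow> \<gamma> p1 q) * \<chi> (k1 + p1) (k2 + p2))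
        = (\<Sum>p2\<le>Suc N2. (case p2 of 0 \<Rightarrow> 0 | Suc q \<Rightarrow> \<gamma> p1 q) * \<chi> (k1 + p1) (k2 + p2))"
      using assms by (simp add: supported_def)
    also have "\<dots> = (\<Sum>p2\<le>N2. \<gamma> p1 p2 * \<chi> (k1 + p1) (Suc k2 + p2))"
      by (subst sum.atMost_Suc_shift) simp
    finally show ?thesis .
  qed
  then show ?thesis by (simp add: correlation_def)
qed

lemma correlation_swap:
  "correlation N1 N2 \<gamma> \<chi> k1 k2 = correlation N2 N1 (\<lambda>p q. \<gamma> q p) (\<lambda>p q. \<chi> q p) k2 k1"
  unfolding correlation_def by (rule sum.swap)

lemma correlation_shift1:
  assumes "supported N1 N2 \<chi>"
  shows "correlation N1 N2 (\<lambda>p1 p2. case p1 of 0 \<Rightarrow> 0 | Suc q \<Rightarrow> \<gamma> q p2) \<chi> k1 k2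
      = correlation N1 N2 \<gamma> \<chi> (Suc k1) k2"
proof -
  have "supported N2 N1 (\<lambda>p q. \<chi> q p)" using assms by (auto simp: supported_def)
  from correlation_shift2[OF this, of "\<lambda>p q. \<gamma> q p" k2 k1] show ?thesis
    by (subst (1 2) correlation_swap)
qed

lemma correlation_add:
  "correlation N1 N2 (\<lambda>p1 p2. \<gamma> p1 p2 + \<delta> p1 p2) \<chi> k1 k2
      = correlation N1 N2 \<gamma> \<chi> k1 k2 + correlation N1 N2 \<delta> \<chi> k1 k2"
  by (simp add: correlation_def sum.distrib algebra_simps)

lemma correlation_diff:
  "correlation N1 N2 (\<lambda>p1 p2. \<gamma> p1 p2 - \<delta> p1 p2) \<chi> k1 k2
      = correlation N1 N2 \<gamma> \<chi> k1 k2 - correlation N1 N2 \<delta> \<chi> k1 k2"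
  by (simp add: correlation_def sum_subtractf algebra_simps)

lemma correlation_scale:
  "correlation N1 N2 (\<lambda>p1 p2. b * \<gamma> p1 p2) \<chi> k1 k2 = b * correlation N1 N2 \<gamma> \<chi> k1 k2"
  by (simp add: correlation_def sum_distrib_left algebra_simps)

text \<open>Let \<open>x = a z1\<close>, \<open>y = -a z2\<close>, and let \<open>U = 1 + y / V\<close>, \<open>V = 1 + x / U\<close>.  The Lagrange-Good formula makes
  \<open>lagrange_coeff a c1 c2\<close> the coefficients of \<open>U\<^sup>c\<^sup>1\<^sup>+\<^sup>1 V\<^sup>c\<^sup>2\<^sup>+\<^sup>1 / (U + V - 1)\<close> in \<open>z1, z2\<close>, and
  \<open>twist_coeff a c1 c2\<close> those of \<open>U\<^sup>c\<^sup>1 V\<^sup>c\<^sup>2\<close>.  The series \<open>U\<close> and \<open>V\<close> serve as a guide only: the two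
  recurrences that express their defining equations are proved for the coefficients.\<close>

definition lagrange_coeff :: "complex \<Rightarrow> real \<Rightarrow> real \<Rightarrow> nat \<Rightarrow> nat \<Rightarrow> complex" where
  "lagrange_coeff a c1 c2 p1 p2 = (- 1) ^ p2 * a ^ (p1 + p2) *
     of_real (((c1 - real p1) gchoose p2) * ((c2 - real p2) gchoose p1))"

definition twist_coeff :: "complex \<Rightarrow> real \<Rightarrow> real \<Rightarrow> nat \<Rightarrow> nat \<Rightarrow> complex" where
  "twist_coeff a c1 c2 p1 p2
      = lagrange_coeff a c1 (c2 - 1) p1 p2 + lagrange_coeff a (c1 - 1) c2 p1 p2 - lagrange_coeff a (c1 - 1) (c2 - 1) p1 p2"

lemma gbinomial_pascal: "(x::real) gchoose Suc q = ((x - 1) gchoose q) + ((x - 1) gchoose Suc q)"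
  using gbinomial_Suc_Suc[of "x - 1" q] by simp

text \<open>The equation \<open>U = 1 - a z2 / V\<close> on coefficients, which is Pascal's rule in the first binomial coefficient.\<close>

lemma lagrange_coeff_step1:
  "lagrange_coeff a (c1 + 1) c2 p1 p2
      = lagrange_coeff a c1 c2 p1 p2 - a * (case p2 of 0 \<Rightarrow> 0 | Suc q \<Rightarrow> lagrange_coeff a c1 (c2 - 1) p1 q)"
proof (cases p2)
  case (Suc q)
  have "c1 + 1 - real p1 = (c1 - real p1) + 1" "c2 - 1 - real q = c2 - real (Suc q)" by simp_all
  then show ?thesis unfolding Suc lagrange_coeff_def
    by (simp only: gbinomial_Suc_Suc) (simp add: algebra_simps)
qed (simp add: lagrange_coeff_def)

text \<open>The equation \<open>V = 1 + a z1 / U\<close> on coefficients.\<close>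

lemma lagrange_coeff_step2:
  "lagrange_coeff a c1 (c2 + 1) p1 p2
      = lagrange_coeff a c1 c2 p1 p2 + a * (case p1 of 0 \<Rightarrow> 0 | Suc q \<Rightarrow> lagrange_coeff a (c1 - 1) c2 q p2)"
proof (cases p1)
  case (Suc q)
  have "c2 + 1 - real p2 = (c2 - real p2) + 1" "c1 - 1 - real q = c1 - real (Suc q)" by simp_all
  then show ?thesis unfolding Suc lagrange_coeff_def
    by (simp only: gbinomial_Suc_Suc) (simp add: algebra_simps)
qed (simp add: lagrange_coeff_def)

lemma gbinomial_absorb_diff:
  "x * ((x gchoose p) - ((x - 1) gchoose p)) = real p * ((x::real) gchoose p)"
proof (cases p)
  case (Suc q)
  then show ?thesis using gbinomial_pascal[of x q] gbinomial_absorption[of q x] by simp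
qed simp

text \<open>The Euler operator \<open>E\<close>, which multiplies the coefficient of \<open>z1\<^sup>p\<^sup>1 z2\<^sup>p\<^sup>2\<close> by \<open>p1 + p2\<close>, satisfies
  \<open>E U = U (U - 1) / (U + V - 1)\<close> and \<open>E V = V (V - 1) / (U + V - 1)\<close>; this is the resulting formula for
  \<open>E (U\<^sup>c\<^sup>1 V\<^sup>c\<^sup>2)\<close>.\<close>

lemma twist_coeff_euler:
  "of_nat (p1 + p2) * twist_coeff a c1 c2 p1 p2 =
     of_real c1 * (lagrange_coeff a c1 (c2 - 1) p1 p2 - lagrange_coeff a (c1 - 1) (c2 - 1) p1 p2)
   + of_real c2 * (lagrange_coeff a (c1 - 1) c2 p1 p2 - lagrange_coeff a (c1 - 1) (c2 - 1) p1 p2)"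
proof -
  define A B where "A = c1 - real p1" and "B = c2 - real p2"
  define x x' y y' where "x = (A - 1) gchoose p2" and "x' = A gchoose p2"
    and "y = (B - 1) gchoose p1" and "y' = B gchoose p1"
  have ax: "A * (x' - x) = real p2 * x'"
    unfolding x_def x'_def by (rule gbinomial_absorb_diff)
  have ay: "B * (y' - y) = real p1 * y'"
    unfolding y_def y'_def by (rule gbinomial_absorb_diff)
  have "c1 = A + real p1" "c2 = B + real p2" by (simp_all add: A_def B_def)
  then have key: "real (p1 + p2) * (x' * y + x * y' - x * y)
      = c1 * (x' * y - x * y) + c2 * (x * y' - x * y)"
    using ax ay by simp algebra
  have *: "lagrange_coeff a c1 (c2 - 1) p1 p2 = (- 1) ^ p2 * a ^ (p1 + p2) * of_real (x' * y)"
    "lagrange_coeff a (c1 - 1) c2 p1 p2 = (- 1) ^ p2 * a ^ (p1 + p2) * of_real (x * y')"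
    "lagrange_coeff a (c1 - 1) (c2 - 1) p1 p2 = (- 1) ^ p2 * a ^ (p1 + p2) * of_real (x * y)"
    unfolding lagrange_coeff_def x_def x'_def y_def y'_def A_def B_def
    by (simp_all add: algebra_simps)
  have "of_nat (p1 + p2) * twist_coeff a c1 c2 p1 p2 =
      (- 1) ^ p2 * a ^ (p1 + p2) * of_real (real (p1 + p2) * (x' * y + x * y' - x * y))"
    unfolding twist_coeff_def * by (simp add: algebra_simps)
  also have "\<dots>
      = of_real c1 * (lagrange_coeff a c1 (c2 - 1) p1 p2 - lagrange_coeff a (c1 - 1) (c2 - 1) p1 p2)
   + of_real c2 * (lagrange_coeff a (c1 - 1) c2 p1 p2 - lagrange_coeff a (c1 - 1) (c2 - 1) p1 p2)"
    unfolding key * by (simp add: algebra_simps)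
  finally show ?thesis .
qed

text \<open>The value of the form on \<open>(2 E - c1 - c2) (U\<^sup>c\<^sup>1 V\<^sup>c\<^sup>2)\<close> times the monomial.  For \<open>c1 = N1 - 2 k1\<close>,
  \<open>c2 = N2 - 2 k2\<close> it is the value on the undeformed \<open>H\<close> applied to the image of \<open>z1\<^sup>k\<^sup>1 z2\<^sup>k\<^sup>2\<close> under the
  twist, since \<open>H\<close> acts by \<open>2 E - N1 - N2\<close>.\<close>

definition twisted_weight ::
  "complex \<Rightarrow> nat \<Rightarrow> nat \<Rightarrow> (nat \<Rightarrow> nat \<Rightarrow> complex) \<Rightarrow> real \<Rightarrow> real \<Rightarrow> nat \<Rightarrow> nat \<Rightarrow> complex" where
  "twisted_weight a N1 N2 \<chi> c1 c2 k1 k2 =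
     - of_real (c1 + c2) * correlation N1 N2 (twist_coeff a c1 c2) \<chi> k1 k2
     + 2 * of_real c1 * (correlation N1 N2 (lagrange_coeff a c1 (c2 - 1)) \<chi> k1 k2
         - correlation N1 N2 (lagrange_coeff a (c1 - 1) (c2 - 1)) \<chi> k1 k2)
     + 2 * of_real c2 * (correlation N1 N2 (lagrange_coeff a (c1 - 1) c2) \<chi> k1 k2
         - correlation N1 N2 (lagrange_coeff a (c1 - 1) (c2 - 1)) \<chi> k1 k2)"

context
  fixes a :: complex and N1 N2 :: nat and \<chi> :: "nat \<Rightarrow> nat \<Rightarrow> complex"
  assumes supp: "supported N1 N2 \<chi>"
begin

private abbreviation "K c1 c2 k1 k2 \<equiv> correlation N1 N2 (lagrange_coeff a c1 c2) \<chi> k1 k2"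
private abbreviation "P c1 c2 k1 k2 \<equiv> twisted_weight a N1 N2 \<chi> c1 c2 k1 k2"
private abbreviation "G c1 c2 k1 k2 \<equiv> correlation N1 N2 (twist_coeff a c1 c2) \<chi> k1 k2"

text \<open>The relations \<open>a z2 = V - U V\<close> and \<open>a z1 = U V - U\<close> eliminate the variables: a shifted monomial
  becomes a combination of unshifted ones with shifted exponents of \<open>U\<close> and \<open>V\<close>.  Any identity that holds in
  the ring of Laurent polynomials in \<open>U, V\<close> can then be checked linearly.\<close>

lemma K_shift2: "a * K c1 c2 k1 (Suc k2) = K c1 (c2 + 1) k1 k2 - K (c1 + 1) (c2 + 1) k1 k2"
  unfolding correlation_shift2[OF supp, symmetric] correlation_scale[symmetric] correlation_diff[symmetric] lagrange_coeff_step1 add_diff_cancel_right'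
  by simp

lemma K_shift1: "a * K c1 c2 (Suc k1) k2 = K (c1 + 1) (c2 + 1) k1 k2 - K (c1 + 1) c2 k1 k2"
  unfolding correlation_shift1[OF supp, symmetric] correlation_scale[symmetric] correlation_diff[symmetric] lagrange_coeff_step2 add_diff_cancel_right'
  by simp

lemma G_K: "G c1 c2 k1 k2 = K c1 (c2 - 1) k1 k2 + K (c1 - 1) c2 k1 k2 - K (c1 - 1) (c2 - 1) k1 k2"
  unfolding twist_coeff_def correlation_add[symmetric] correlation_diff[symmetric] ..

lemma G_shift2: "a * G c1 c2 k1 (Suc k2) = G c1 (c2 + 1) k1 k2 - G (c1 + 1) (c2 + 1) k1 k2"
  unfolding G_K ring_distribs K_shift1 K_shift2 by simp

lemma G_shift1: "a * G c1 c2 (Suc k1) k2 = G (c1 + 1) (c2 + 1) k1 k2 - G (c1 + 1) c2 k1 k2"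
  unfolding G_K ring_distribs K_shift1 K_shift2 by simp

text \<open>With \<open>w1 = z1 / U\<^sup>2\<close> and \<open>w2 = z2 / V\<^sup>2\<close> this is \<open>w1 + w2 = (z1 + z2) (1 + a\<^sup>2 w1 w2)\<close>, the addition
  theorem of the hyperbolic tangent for \<open>\<Delta>(X) = X \<otimes> 1 + 1 \<otimes> X\<close>: the twist takes the deformed \<open>\<Delta>(Z\<^sub>+)\<close> to
  \<open>z1 + z2\<close>.\<close>

lemma twist_X:
  assumes "a \<noteq> 0"
  shows "G (c1 - 2) c2 (Suc k1) k2 + G c1 (c2 - 2) k1 (Suc k2) =
     (G c1 c2 (Suc k1) k2 + G c1 c2 k1 (Suc k2)) +
     a\<^sup>2 * (G (c1 - 2) (c2 - 2) (Suc (Suc k1)) (Suc k2) + G (c1 - 2) (c2 - 2) (Suc k1) (Suc (Suc k2)))"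
proof -
  have 3: "a * a * a * G c1 c2 (Suc (Suc k1)) (Suc k2)
     = a * (a * (a * G c1 c2 (Suc (Suc k1)) (Suc k2)))"
    "a * a * a * G c1 c2 (Suc k1) (Suc (Suc k2))
     = a * (a * (a * G c1 c2 (Suc k1) (Suc (Suc k2))))" for c1 c2 by simp_all
  have "a * (G (c1 - 2) c2 (Suc k1) k2 + G c1 (c2 - 2) k1 (Suc k2)) =
     a * ((G c1 c2 (Suc k1) k2 + G c1 c2 k1 (Suc k2)) +
     a\<^sup>2 * (G (c1 - 2) (c2 - 2) (Suc (Suc k1)) (Suc k2) + G (c1 - 2) (c2 - 2) (Suc k1) (Suc (Suc k2))))"
    unfolding power2_eq_square ring_distribs mult.assoc G_shift1 right_diff_distrib G_shift2
    by simp
  with assms show ?thesis by simp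
qed

lemma correlation_euler:
  "correlation N1 N2 (twist_coeff a c1 c2) (\<lambda>l1 l2. of_nat (l1 + l2) * \<chi> l1 l2) k1 k2
      = of_nat (k1 + k2) * G c1 c2 k1 k2 
     + of_real c1 * (K c1 (c2 - 1) k1 k2 - K (c1 - 1) (c2 - 1) k1 k2)
     + of_real c2 * (K (c1 - 1) c2 k1 k2 - K (c1 - 1) (c2 - 1) k1 k2)"
proof -
  have "correlation N1 N2 (twist_coeff a c1 c2) (\<lambda>l1 l2. of_nat (l1 + l2) * \<chi> l1 l2) k1 k2
    
         = correlation N1 N2 (\<lambda>p1 p2. of_nat (k1 + k2) * twist_coeff a c1 c2 p1 p2 + of_nat (p1 + p2) * twist_coeff a c1 c2 p1 p2) \<chi> k1 k2"
    unfolding correlation_def by (simp add: algebra_simps)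
  then show ?thesis unfolding twist_coeff_euler correlation_add correlation_scale correlation_diff
  by simp
qed

text \<open>The twist also takes \<open>\<Delta>(H) = H \<otimes> exp(hX) + exp(-hX) \<otimes> H\<close> to the undeformed weight operator.  Both
  sides are evaluated on \<open>(1 + a w1) (1 - a w2)\<close> times a monomial, which clears the denominators of the two
  Cayley transforms.\<close>

lemma twist_H:
  "P c1 c2 k1 k2 + a * P (c1 - 2) c2 (Suc k1) k2 - a * P c1 (c2 - 2) k1 (Suc k2)
     - a\<^sup>2 * P (c1 - 2) (c2 - 2) (Suc k1) (Suc k2)
   = - of_real c1 * (G c1 c2 k1 k2 + a * G c1 (c2 - 2) k1 (Suc k2))
     + a * of_real (2 - c1) * (G (c1 - 2) c2 (Suc k1) k2 + a * G (c1 - 2) (c2 - 2) (Suc k1) (Suc k2))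
     - of_real c2 * (G c1 c2 k1 k2 - a * G (c1 - 2) c2 (Suc k1) k2)
     - a * of_real (2 - c2) * (G c1 (c2 - 2) k1 (Suc k2) - a * G (c1 - 2) (c2 - 2) (Suc k1) (Suc k2))"
proof -
  define u v where "u = complex_of_real c1" and "v = complex_of_real c2"
  define A B C where "A c1 c2 = a * K c1 c2 (Suc k1) k2" and "B c1 c2 = a * K c1 c2 k1 (Suc k2)"
    and "C c1 c2 = a\<^sup>2 * K c1 c2 (Suc k1) (Suc k2)" for c1 c2
  have A: "A c1 c2 = K (c1 + 1) (c2 + 1) k1 k2 - K (c1 + 1) c2 k1 k2" for c1 c2
    unfolding A_def by (rule K_shift1)
  have B: "B c1 c2 = K c1 (c2 + 1) k1 k2 - K (c1 + 1) (c2 + 1) k1 k2" for c1 c2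
    unfolding B_def by (rule K_shift2)
  have C: "C c1 c2 = B (c1 + 1) (c2 + 1) - B (c1 + 1) c2" for c1 c2
    unfolding C_def B_def power2_eq_square mult.assoc K_shift1 by (simp add: right_diff_distrib)
  have GA: "a * G c1 c2 (Suc k1) k2 = A c1 (c2 - 1) + A (c1 - 1) c2 - A (c1 - 1) (c2 - 1)" for c1 c2
    unfolding A_def G_K by (simp add: algebra_simps)
  have GB: "a * G c1 c2 k1 (Suc k2) = B c1 (c2 - 1) + B (c1 - 1) c2 - B (c1 - 1) (c2 - 1)" for c1 c2
    unfolding B_def G_K by (simp add: algebra_simps)
  have GC: "a\<^sup>2 * G c1 c2 (Suc k1) (Suc k2)
      = C c1 (c2 - 1) + C (c1 - 1) c2 - C (c1 - 1) (c2 - 1)" for c1 c2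
    unfolding C_def G_K by (simp add: algebra_simps)
  have PA: "a * P c1 c2 (Suc k1) k2 = - of_real (c1 + c2) * (a * G c1 c2 (Suc k1) k2)
     + 2 * of_real c1 * (A c1 (c2 - 1) - A (c1 - 1) (c2 - 1))
     + 2 * of_real c2 * (A (c1 - 1) c2 - A (c1 - 1) (c2 - 1))" for c1 c2
    unfolding A_def twisted_weight_def by (simp add: algebra_simps)
  have PB: "a * P c1 c2 k1 (Suc k2) = - of_real (c1 + c2) * (a * G c1 c2 k1 (Suc k2))
     + 2 * of_real c1 * (B c1 (c2 - 1) - B (c1 - 1) (c2 - 1))
     + 2 * of_real c2 * (B (c1 - 1) c2 - B (c1 - 1) (c2 - 1))" for c1 c2
    unfolding B_def twisted_weight_def by (simp add: algebra_simps)
  have PC: "a\<^sup>2 * P c1 c2 (Suc k1) (Suc k2)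
      = - of_real (c1 + c2) * (a\<^sup>2 * G c1 c2 (Suc k1) (Suc k2))
     + 2 * of_real c1 * (C c1 (c2 - 1) - C (c1 - 1) (c2 - 1))
     + 2 * of_real c2 * (C (c1 - 1) c2 - C (c1 - 1) (c2 - 1))" for c1 c2
    unfolding C_def twisted_weight_def by (simp add: algebra_simps)
  have 1: "a * of_real (2 - c1) * (G (c1 - 2) c2 (Suc k1) k2 + a * G (c1 - 2) (c2 - 2) (Suc k1) (Suc k2))
   
        = of_real (2 - c1) * (a * G (c1 - 2) c2 (Suc k1) k2 + a\<^sup>2 * G (c1 - 2) (c2 - 2) (Suc k1) (Suc k2))"
   "of_real c2 * (G c1 c2 k1 k2 - a * G (c1 - 2) c2 (Suc k1) k2)
       = of_real c2 * (G c1 c2 k1 k2 - (a * G (c1 - 2) c2 (Suc k1) k2))"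
   "a * of_real (2 - c2) * (G c1 (c2 - 2) k1 (Suc k2) - a * G (c1 - 2) (c2 - 2) (Suc k1) (Suc k2))
   
        = of_real (2 - c2) * (a * G c1 (c2 - 2) k1 (Suc k2) - a\<^sup>2 * G (c1 - 2) (c2 - 2) (Suc k1) (Suc k2))"
    by (simp_all add: algebra_simps power2_eq_square)
  show ?thesis
    unfolding 1 PA PB PC GA GB GC C A B unfolding twisted_weight_def G_K
    by (simp add: u_def[symmetric] v_def[symmetric]) (simp add: algebra_simps)
qed

end

section \<open>Removing the twist\<close>

text \<open>Induction from the top degree downwards, for arrays with bounded support.\<close>

lemma downward_zero:
  assumes supp: "supported N1 N2 f"
    and step: "\<And>k1 k2. (\<And>l1 l2. k1 \<le> l1 \<Longrightarrow> k2 \<le> l2 \<Longrightarrow> k1 + k2 < l1 + l2 \<Longrightarrow> f l1 l2 = 0) \<Longrightarrow> f k1 k2 = 0"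
  shows "f k1 k2 = 0"
proof (induction "N1 + N2 + 1 - (k1 + k2)" arbitrary: k1 k2 rule: less_induct)
  case less
  show ?case
  proof (cases "N1 < k1 \<or> N2 < k2")
    case True
    then show ?thesis using supp unfolding supported_def by blast
  next
    case False
    show ?thesis
    proof (rule step)
      fix l1 l2
      assume "k1 + k2 < l1 + l2"
      then show "f l1 l2 = 0" using False by (intro less.hyps) linarith
    qed
  qed
qed

lemma correlation_split:
  "correlation N1 N2 \<gamma> \<chi> k1 k2 = \<gamma> 0 0 * \<chi> k1 k2
     + (\<Sum>(p1, p2)\<in>{..N1} \<times> {..N2} - {(0, 0)}. \<gamma> p1 p2 * \<chi> (k1 + p1) (k2 + p2))"
  unfolding correlation_def sum.cartesian_product by (subst sum.remove[of _ "(0, 0)"]) simp_all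

lemma supported_correlation:
  "supported N1 N2 \<chi> \<Longrightarrow> supported N1 N2 (\<lambda>k1 k2. correlation N1 N2 (\<gamma> k1 k2) \<chi> k1 k2)"
  unfolding supported_def correlation_def by (auto intro!: sum.neutral)

lemma unitriangular_inj:
  assumes "supported N1 N2 \<delta>" and one: "\<And>k1 k2. \<gamma> k1 k2 0 0 = 1"
    and zero: "\<And>k1 k2. correlation N1 N2 (\<gamma> k1 k2) \<delta> k1 k2 = 0"
  shows "\<delta> k1 k2 = 0"
proof (rule downward_zero[OF assms(1)])
  fix k1 k2
  assume *: "\<delta> l1 l2 = 0" if "k1 \<le> l1" "k2 \<le> l2" "k1 + k2 < l1 + l2" for l1 l2
  have "(\<Sum>(p1, p2)\<in>{..N1} \<times> {..N2} - {(0, 0)}. \<gamma> k1 k2 p1 p2 * \<delta> (k1 + p1) (k2 + p2)) = 0"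
    by (rule sum.neutral) (auto intro!: *)
  then show "\<delta> k1 k2 = 0" using zero[of k1 k2] one by (simp add: correlation_split)
qed

function back_subst ::
  "nat \<Rightarrow> nat \<Rightarrow> (nat \<Rightarrow> nat \<Rightarrow> nat \<Rightarrow> nat \<Rightarrow> complex) \<Rightarrow> (nat \<Rightarrow> nat \<Rightarrow> complex) \<Rightarrow> nat \<Rightarrow> nat \<Rightarrow> complex" where
  "back_subst N1 N2 \<gamma> \<phi> k1 k2 = (if N1 < k1 \<or> N2 < k2 then 0 else
     \<phi> k1 k2 - (\<Sum>(p1, p2)\<in>{..N1} \<times> {..N2} - {(0, 0)}.
       \<gamma> k1 k2 p1 p2 * back_subst N1 N2 \<gamma> \<phi> (k1 + p1) (k2 + p2)))"
  by pat_completeness auto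
termination
  by (relation "measure (\<lambda>(N1, N2, \<gamma>, \<phi>, k1, k2). N1 + N2 + 1 - (k1 + k2))") auto

declare back_subst.simps [simp del]

lemma unitriangular_surj:
  assumes "supported N1 N2 \<phi>" and one: "\<And>k1 k2. \<gamma> k1 k2 0 0 = 1"
  shows "supported N1 N2 (back_subst N1 N2 \<gamma> \<phi>)"
    and "correlation N1 N2 (\<gamma> k1 k2) (back_subst N1 N2 \<gamma> \<phi>) k1 k2 = \<phi> k1 k2"
proof -
  show supp: "supported N1 N2 (back_subst N1 N2 \<gamma> \<phi>)"
    unfolding supported_def
  proof (intro allI impI)
    fix l1 l2 assume "N1 < l1 \<or> N2 < l2"
    then show "back_subst N1 N2 \<gamma> \<phi> l1 l2 = 0" by (subst back_subst.simps) simp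
  qed
  show "correlation N1 N2 (\<gamma> k1 k2) (back_subst N1 N2 \<gamma> \<phi>) k1 k2 = \<phi> k1 k2"
  proof (cases "N1 < k1 \<or> N2 < k2")
    case True
    then show ?thesis
      using supported_correlation[OF supp, of \<gamma>] assms(1) unfolding supported_def by presburger
  next
    case False
    have eq: "back_subst N1 N2 \<gamma> \<phi> k1 k2 = \<phi> k1 k2 - (\<Sum>(p1, p2)\<in>{..N1} \<times> {..N2} - {(0, 0)}.
       \<gamma> k1 k2 p1 p2 * back_subst N1 N2 \<gamma> \<phi> (k1 + p1) (k2 + p2))"
      using False by (subst back_subst.simps) simp
    show ?thesis unfolding correlation_split one by (subst eq) simp
  qed
qed

lemma twist_coeff_0 [simp]: "twist_coeff a c1 c2 0 0 = 1"
  by (simp add: twist_coeff_def lagrange_coeff_def)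

text \<open>Here \<open>\<phi> m\<close> are the components of a map that intertwines the deformed action.  Solving the unitriangular
  system gives \<open>\<chi>\<close>; what fails to be equivariant in \<open>\<chi>\<close> is again a form \<open>\<delta>\<close> with bounded support, and \<open>twist_X\<close>
  and \<open>twist_H\<close> turn the two hypotheses on \<open>\<phi>\<close> into statements that the twist of \<open>\<delta>\<close> at each monomial is a
  combination of its values at higher monomials.  Hence it vanishes, and so does \<open>\<delta>\<close>.\<close>

lemma untwist:
  fixes \<phi> :: "real \<Rightarrow> nat \<Rightarrow> nat \<Rightarrow> complex" and r :: "real \<Rightarrow> complex" and a :: complex and N1 N2 :: nat
  defines "\<gamma> \<equiv> (\<lambda>k1 k2. twist_coeff a (real N1 - 2 * real k1) (real N2 - 2 * real k2))"
  assumes "a \<noteq> 0" and supp: "\<And>m. supported N1 N2 (\<phi> m)"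
    and X: "\<And>m k1 k2. \<phi> m (Suc k1) k2 + \<phi> m k1 (Suc k2)
              = r m * (\<phi> (m - 1) k1 k2 + a\<^sup>2 * \<phi> (m - 1) (Suc k1) (Suc k2))"
    and H: "\<And>m k1 k2. of_real (2 * m) * (\<phi> m k1 k2 + a * \<phi> m (Suc k1) k2 - a * \<phi> m k1 (Suc k2)
                - a\<^sup>2 * \<phi> m (Suc k1) (Suc k2))
      = of_real (2 * real k1 - real N1) * (\<phi> m k1 k2 + a * \<phi> m k1 (Suc k2))
      + a * of_real (2 * real (Suc k1) - real N1) * (\<phi> m (Suc k1) k2 + a * \<phi> m (Suc k1) (Suc k2))
      + of_real (2 * real k2 - real N2) * (\<phi> m k1 k2 - a * \<phi> m (Suc k1) k2)
      - a * of_real (2 * real (Suc k2) - real N2) * (\<phi> m k1 (Suc k2) - a * \<phi> m (Suc k1) (Suc k2))"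
  obtains \<chi> :: "real \<Rightarrow> nat \<Rightarrow> nat \<Rightarrow> complex" where
    "\<And>m. supported N1 N2 (\<chi> m)"
    "\<And>m k1 k2. correlation N1 N2 (\<gamma> k1 k2) (\<chi> m) k1 k2 = \<phi> m k1 k2"
    "\<And>m k1 k2. \<chi> m (Suc k1) k2 + \<chi> m k1 (Suc k2) = r m * \<chi> (m - 1) k1 k2"
    "\<And>m k1 k2. of_real (2 * m) * \<chi> m k1 k2
        = of_real (2 * real k1 + 2 * real k2 - real N1 - real N2) * \<chi> m k1 k2"
proof -
  define \<chi> where "\<chi> m = back_subst N1 N2 \<gamma> (\<phi> m)" for m
  have \<gamma>1: "\<gamma> k1 k2 0 0 = 1" for k1 k2 by (simp add: \<gamma>_def)
  have s\<chi>: "supported N1 N2 (\<chi> m)" for m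
    unfolding \<chi>_def by (rule unitriangular_surj(1)[OF supp]) (rule \<gamma>1)
  have \<phi>: "correlation N1 N2 (\<gamma> k1 k2) (\<chi> m) k1 k2 = \<phi> m k1 k2" for m k1 k2
    unfolding \<chi>_def by (rule unitriangular_surj(2)[OF supp]) (rule \<gamma>1)
  have SucN: "real N - 2 * real (Suc k) = real N - 2 * real k - 2" for N k by simp
  show thesis
  proof (rule that[of \<chi>, OF s\<chi> \<phi>])
    fix m k1 k2
    define \<delta> where "\<delta> l1 l2 = \<chi> m (Suc l1) l2 + \<chi> m l1 (Suc l2) - r m * \<chi> (m - 1) l1 l2" for l1 l2
    have s\<delta>: "supported N1 N2 \<delta>"
      using s\<chi> unfolding supported_def \<delta>_def by auto
    have "correlation N1 N2 (\<gamma> k1 k2) \<delta> k1 k2 = 0" for k1 k2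
    proof (rule downward_zero[OF supported_correlation[OF s\<delta>, of \<gamma>]])
      fix k1 k2
      assume higher: "correlation N1 N2 (\<gamma> l1 l2) \<delta> l1 l2
          = 0" if "k1 \<le> l1" "k2 \<le> l2" "k1 + k2 < l1 + l2" for l1 l2
      have expand: "correlation N1 N2 (twist_coeff a c1 c2) \<delta> k1 k2 =
          correlation N1 N2 (twist_coeff a c1 c2) (\<chi> m) (Suc k1) k2 + correlation N1 N2 (twist_coeff a c1 c2) (\<chi> m) k1 (Suc k2)
          - r m * correlation N1 N2 (twist_coeff a c1 c2) (\<chi> (m - 1)) k1 k2" for c1 c2 k1 k2
        unfolding correlation_def \<delta>_def
        by (simp add: sum.distrib sum_subtractf sum_distrib_left algebra_simps)
      have "correlation N1 N2 (\<gamma> k1 k2) \<delta> k1 k2 + a\<^sup>2 * correlation N1 N2 (\<gamma> (Suc k1) (Suc k2)) \<delta> (Suc k1) (Suc k2)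
         = (\<phi> m (Suc k1) k2 + \<phi> m k1 (Suc k2))
           - r m * (\<phi> (m - 1) k1 k2 + a\<^sup>2 * \<phi> (m - 1) (Suc k1) (Suc k2))"
        unfolding \<phi>[symmetric] unfolding \<gamma>_def expand SucN twist_X[OF s\<chi> \<open>a \<noteq> 0\<close>]
        by (simp add: algebra_simps)
      then show "correlation N1 N2 (\<gamma> k1 k2) \<delta> k1 k2 = 0" by (simp add: X higher)
    qed
    then have "\<delta> k1 k2 = 0" by (rule unitriangular_inj[OF s\<delta>, of \<gamma>, OF \<gamma>1])
    then show "\<chi> m (Suc k1) k2 + \<chi> m k1 (Suc k2) = r m * \<chi> (m - 1) k1 k2"
      by (simp add: \<delta>_def)
  next
    fix m k1 k2
    define \<delta> where "\<delta> l1 l2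
        = of_real (2 * m + real N1 + real N2) * \<chi> m l1 l2 - 2 * (of_nat (l1 + l2) * \<chi> m l1 l2)" for l1 l2
    have s\<delta>: "supported N1 N2 \<delta>"
      using s\<chi>[of m] unfolding supported_def \<delta>_def by auto
    have "correlation N1 N2 (\<gamma> k1 k2) \<delta> k1 k2 = 0" for k1 k2
    proof (rule downward_zero[OF supported_correlation[OF s\<delta>, of \<gamma>]])
      fix k1 k2
      assume higher: "correlation N1 N2 (\<gamma> l1 l2) \<delta> l1 l2
          = 0" if "k1 \<le> l1" "k2 \<le> l2" "k1 + k2 < l1 + l2" for l1 l2
      have "correlation N1 N2 (twist_coeff a c1 c2) \<delta> k1 k2 =
          of_real (2 * m + real N1 + real N2) * correlation N1 N2 (twist_coeff a c1 c2) (\<chi> m) k1 k2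
          - 2 * correlation N1 N2 (twist_coeff a c1 c2) (\<lambda>l1 l2. of_nat (l1 + l2) * \<chi> m l1 l2) k1 k2" for c1 c2 k1 k2
        unfolding correlation_def \<delta>_def sum_distrib_left sum_subtractf[symmetric]
        by (intro sum.cong refl) (simp add: algebra_simps)
      note * = this
      have expand0: "correlation N1 N2 (twist_coeff a c1 c2) \<delta> k1 k2 =
          of_real (2 * m + real N1 + real N2 - 2 * real (k1 + k2) - c1 - c2) * correlation N1 N2 (twist_coeff a c1 c2) (\<chi> m) k1 k2
          - twisted_weight a N1 N2 (\<chi> m) c1 c2 k1 k2" for c1 c2 k1 k2
      proof -
        have scalar: "of_real (2 * m + real N1 + real N2 - 2 * real (k1 + k2) - c1 - c2)
           
                = of_real (2 * m + real N1 + real N2) - 2 * of_nat (k1 + k2) - complex_of_real c1 - complex_of_real c2"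
          by simp
        have ring: "s * g - 2 * (n * g + x * y + z * w)
            = (s - 2 * n - x - z) * g - (- (x + z) * g + 2 * x * y + 2 * z * w)"
          for s g n x y z w :: complex by (simp add: algebra_simps)
        show ?thesis
          unfolding * correlation_euler[OF s\<chi>] twisted_weight_def scalar of_real_add[of c1 c2]
          by (rule ring)
      qed
      have expand: "correlation N1 N2 (\<gamma> k1 k2) \<delta> k1 k2 = of_real (2 * m) * \<phi> m k1 k2
          - twisted_weight a N1 N2 (\<chi> m) (real N1 - 2 * real k1) (real N2 - 2 * real k2) k1 k2" for k1 k2
        unfolding \<phi>[symmetric] \<gamma>_def expand0 by simp
      have ring: "(M * x - p) + a * (M * y - q) - a * (M * z - r) - a\<^sup>2 * (M * w - s)
         = M * (x + a * y - a * z - a\<^sup>2 * w) - (p + a * q - a * r - a\<^sup>2 * s)"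
        for M x y z w p q r s by (simp add: algebra_simps)
      have "correlation N1 N2 (\<gamma> k1 k2) \<delta> k1 k2 + a * correlation N1 N2 (\<gamma> (Suc k1) k2) \<delta> (Suc k1) k2
         - a * correlation N1 N2 (\<gamma> k1 (Suc k2)) \<delta> k1 (Suc k2)
         - a\<^sup>2 * correlation N1 N2 (\<gamma> (Suc k1) (Suc k2)) \<delta> (Suc k1) (Suc k2)
         = of_real (2 * m) * (\<phi> m k1 k2 + a * \<phi> m (Suc k1) k2 - a * \<phi> m k1 (Suc k2)
                - a\<^sup>2 * \<phi> m (Suc k1) (Suc k2))
          - (twisted_weight a N1 N2 (\<chi> m) (real N1 - 2 * real k1) (real N2 - 2 * real k2) k1 k2
            + a * twisted_weight a N1 N2 (\<chi> m) (real N1 - 2 * real k1 - 2) (real N2 - 2 * real k2) (Suc k1) k2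
            - a * twisted_weight a N1 N2 (\<chi> m) (real N1 - 2 * real k1) (real N2 - 2 * real k2 - 2) k1 (Suc k2)
            - a\<^sup>2 * twisted_weight a N1 N2 (\<chi> m) (real N1 - 2 * real k1 - 2) (real N2 - 2 * real k2 - 2) (Suc k1) (Suc k2))"
        unfolding expand SucN by (rule ring)
      also have "\<dots> = 0"
      proof -
        have scalar: "complex_of_real (2 * real k - real N) = - of_real (real N - 2 * real k)"
          "complex_of_real (2 * real (Suc k) - real N)
              = of_real (2 - (real N - 2 * real k))" for k N
          by simp_all
        show ?thesis
          unfolding H unfolding twist_H[OF s\<chi>] scalar \<phi>[symmetric, unfolded \<gamma>_def] SucN
          by simp algebra
      qed
      finally show "correlation N1 N2 (\<gamma> k1 k2) \<delta> k1 k2 = 0" by (simp add: higher)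
    qed
    then have "\<delta> k1 k2 = 0" by (rule unitriangular_inj[OF s\<delta>, of \<gamma>, OF \<gamma>1])
    moreover have "of_real (2 * m) * \<chi> m k1 k2 - of_real (2 * real k1 + 2 * real k2 - real N1 - real N2) * \<chi> m k1 k2
        = \<delta> k1 k2"
      by (simp add: \<delta>_def algebra_simps)
    ultimately show "of_real (2 * m) * \<chi> m k1 k2
        = of_real (2 * real k1 + 2 * real k2 - real N1 - real N2) * \<chi> m k1 k2"
      by simp
  qed
qed


section \<open>From tensor operators to an intertwining map\<close>

definition tensor_map :: "nat \<Rightarrow> (real \<Rightarrow> (real \<Rightarrow> complex) \<Rightarrow> real \<Rightarrow> complex) \<Rightarrow>
    (real \<Rightarrow> complex) \<Rightarrow> (real \<Rightarrow> complex) \<Rightarrow> real \<Rightarrow> complex" where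
  "tensor_map N1 t v x = (\<lambda>p. \<Sum>m\<in>wts (real N1 / 2). v m * t m x p)"

definition tensor_coeff :: "nat \<Rightarrow> nat \<Rightarrow> (real \<Rightarrow> (real \<Rightarrow> complex) \<Rightarrow> real \<Rightarrow> complex) \<Rightarrow>
    real \<Rightarrow> nat \<Rightarrow> nat \<Rightarrow> complex" where
  "tensor_coeff N1 N2 t m k1 k2 = tensor_map N1 t (monomial N1 k1) (monomial N2 k2) m"

lemma tensor_map_sum_left:
  "tensor_map N1 t (\<lambda>q. \<Sum>i\<in>I. c i * f i q) x = (\<lambda>p. \<Sum>i\<in>I. c i * tensor_map N1 t (f i) x p)"
  unfolding tensor_map_def
  by (simp add: sum_distrib_left sum_distrib_right mult.assoc sum.swap[of _ I])

lemma tensor_map_add_left: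
  "tensor_map N1 t (\<lambda>q. v q + w q) x = (\<lambda>p. tensor_map N1 t v x p + tensor_map N1 t w x p)"
  and tensor_map_scale_left: "tensor_map N1 t (\<lambda>q. c * v q) x = (\<lambda>p. c * tensor_map N1 t v x p)"
  by (simp_all add: tensor_map_def sum.distrib sum_distrib_left algebra_simps)

lemma tensor_map_ket:
  assumes "m1 \<in> wts (real N1 / 2)"
  shows "tensor_map N1 t (ket m1) x = t m1 x"
  using assms unfolding tensor_map_def
  by (intro ext) (simp add: wts_half ket_def if_distrib[of "\<lambda>c. c * _"] cong: if_cong)

context
  fixes h :: complex and N1 N2 N :: nat and t :: "real \<Rightarrow> (real \<Rightarrow> complex) \<Rightarrow> real \<Rightarrow> complex"
  assumes h: "h \<noteq> 0"
    and tens: "tensor_operators h (real N1 / 2) (real N2 / 2) (real N / 2) t"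
begin

private abbreviation "V1 \<equiv> W (real N1 / 2)"
private abbreviation "V2 \<equiv> W (real N2 / 2)"
private abbreviation "V3 \<equiv> W (real N / 2)"
private abbreviation "I1 \<equiv> wts (real N1 / 2)"
private abbreviation "\<Phi> \<equiv> tensor_map N1 t"
private abbreviation "\<phi> \<equiv> tensor_coeff N1 N2 t"

lemma t_linear: "m \<in> I1 \<Longrightarrow> linear_between V2 V3 (t m)"
  using tens by (simp add: tensor_operators_def)

lemma tensor_map_W: "x \<in> V2 \<Longrightarrow> \<Phi> v x \<in> V3"
  unfolding tensor_map_def using t_linear
  by (intro vspace_sum vspace_W) (simp add: linear_between_def)

lemma tensor_map_sum_right:
  assumes "\<And>i. i \<in> I \<Longrightarrow> f i \<in> V2"
  shows "\<Phi> v (\<lambda>q. \<Sum>i\<in>I. c i * f i q) = (\<lambda>p. \<Sum>i\<in>I. c i * \<Phi> v (f i) p)"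
proof -
  have "t m (\<lambda>q. \<Sum>i\<in>I. c i * f i q) = (\<lambda>p. \<Sum>i\<in>I. c i * t m (f i) p)" if "m \<in> I1" for m
    by (rule linear_between_sum[OF vspace_W t_linear[OF that] assms])
  then show ?thesis
    unfolding tensor_map_def by (simp add: sum_distrib_left mult.left_commute sum.swap[of _ I])
qed

lemma tensor_map_add_right: "x \<in> V2 \<Longrightarrow> y \<in> V2 \<Longrightarrow> \<Phi> v (\<lambda>q. x q + y q) = (\<lambda>p. \<Phi> v x p + \<Phi> v y p)"
  and tensor_map_scale_right: "x \<in> V2 \<Longrightarrow> \<Phi> v (\<lambda>q. c * x q) = (\<lambda>p. c * \<Phi> v x p)"
  using t_linear by (auto simp: tensor_map_def linear_between_def sum.distrib sum_distrib_left algebra_simps)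

lemma ad_gen:
  assumes "m \<in> I1" "x \<in> V2"
  shows "ad h (irrep h (real N / 2)) (irrep h (real N2 / 2)) (s_gen g) (t m) x
      = \<Phi> (irrep h (real N1 / 2) g (ket m)) x"
proof -
  obtain C where "C \<in> U_h h" "s_gen g \<in> C" using mem_U_h_class[OF s_gen_free_alg] by blast
  with tens assms have "ad h (irrep h (real N / 2)) (irrep h (real N2 / 2)) (s_gen g) (t m) x
      = (\<lambda>p. \<Sum>k\<in>I1. rep_matrix h (real N1 / 2) (s_gen g) k m * t k x p)"
    unfolding tensor_operators_def by blast
  then show ?thesis by (simp add: tensor_map_def rep_matrix_def act_s_gen)
qed

lemma linear_irrep_X: "linear_op (irrep h (real M / 2) gX)"
  using irrep_X_nilpotent by (simp add: nilpotent_def)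

lemma irrep_H: "irrep h (real M / 2) gH = Hop (real M / 2)"
  by (simp add: irrep.simps)

lemma tensor_map_op_left:
  assumes "linear_op A" "v \<in> V1"
  shows "\<Phi> (A v) x = (\<lambda>p. \<Sum>m\<in>I1. v m * \<Phi> (A (ket m)) x p)"
  unfolding linear_op_expand[OF assms(1) half_spins assms(2)] by (rule tensor_map_sum_left)

lemma tensor_map_X:
  assumes v: "v \<in> V1" and x: "x \<in> V2"
  shows "irrep h (real N / 2) gX (\<Phi> v x)
    = (\<lambda>p. \<Phi> (irrep h (real N1 / 2) gX v) x p + \<Phi> v (irrep h (real N2 / 2) gX x) p)"
proof
  fix p
  have *: "irrep h (real N / 2) gX (t m x) p
    
         = \<Phi> (irrep h (real N1 / 2) gX (ket m)) x p + t m (irrep h (real N2 / 2) gX x) p" if "m \<in> I1" for m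
    using fun_cong[OF ad_X[OF t_linear[OF that] x, of "irrep h (real N2 / 2)" h "irrep h (real N / 2)"], of p]
      irrep_X_W[OF x] ad_gen[OF that x, of gX] by simp
  have "irrep h (real N / 2) gX (\<Phi> v x) p = (\<Sum>m\<in>I1. v m * irrep h (real N / 2) gX (t m x) p)"
    unfolding tensor_map_def linear_op_sum[OF linear_irrep_X] ..
  also have "\<dots> = \<Phi> (irrep h (real N1 / 2) gX v) x p + \<Phi> v (irrep h (real N2 / 2) gX x) p"
    unfolding tensor_map_op_left[OF linear_irrep_X v] tensor_map_def[of N1 t v] sum.distrib[symmetric]
    by (intro sum.cong refl) (simp add: * algebra_simps)
  finally show "irrep h (real N / 2) gX (\<Phi> v x) p = \<dots>" .
qed

text \<open>Since \<open>X \<otimes> 1\<close> and \<open>1 \<otimes> X\<close> commute, the exponential of the derivation property \<open>tensor_map_X\<close> is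
  multiplicativity.\<close>

lemma tensor_map_exp:
  assumes v: "v \<in> V1" and x: "x \<in> V2"
  shows "expX s h N (\<Phi> v x) = \<Phi> (expX s h N1 v) (expX s h N2 x)"
proof
  fix p
  let ?X = "irrep h (real N / 2) gX" and ?X1 = "irrep h (real N1 / 2) gX" and ?X2 = "irrep h (real N2 / 2) gX"
  have V1: "(?X1 ^^ i) v \<in> V1" for i by (induction i) (simp_all add: v irrep_X_W)
  have V2: "(?X2 ^^ i) x \<in> V2" for i by (induction i) (simp_all add: x irrep_X_W)
  define w where "w i k p = \<Phi> ((?X1 ^^ i) v) ((?X2 ^^ k) x) p / (fact i * fact k)" for i k p
  have Xw: "?X (w i k)
      = (\<lambda>p. of_nat (i + 1) * w (i + 1) k p + of_nat (k + 1) * w i (k + 1) p)" for i k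
  proof -
    have "w i k = (\<lambda>p. (1 / (fact i * fact k)) * \<Phi> ((?X1 ^^ i) v) ((?X2 ^^ k) x) p)"
      by (simp add: w_def[abs_def])
    then have "?X (w i k) = (\<lambda>p. (1 / (fact i * fact k)) * ?X (\<Phi> ((?X1 ^^ i) v) ((?X2 ^^ k) x)) p)"
      by (simp only: linear_op_scale[OF linear_irrep_X])
    moreover have "(a + b) / (fact i * fact k)
        = (1 + of_nat i) * (a / ((1 + of_nat i) * fact i * fact k)) + (1 + of_nat k) * (b / (fact i * ((1 + of_nat k) * fact k)))"
      for a b :: complex
    proof -
      have "(1 + of_nat i :: complex) \<noteq> 0" "(1 + of_nat k :: complex) \<noteq> 0"
        by (metis of_nat_Suc of_nat_neq_0)+
      then show ?thesis by (simp add: add_divide_distrib)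
    qed
    ultimately show ?thesis
      unfolding tensor_map_X[OF V1 V2] by (simp add: w_def[abs_def])
  qed
  \<comment> \<open>Leibniz rule in divided powers: \<open>w i k\<close> stands for \<open>\<Phi>(X\<^sup>i/i! v \<otimes> X\<^sup>k/k! x)\<close>, which avoids binomial coefficients\<close>
  have leibniz: "(?X ^^ n) (\<Phi> v x) = (\<lambda>p. fact n * (\<Sum>i\<le>n. w i (n - i) p))" for n
  proof (induction n)
    case 0
    then show ?case by (simp add: w_def)
  next
    case (Suc n)
    have "?X (\<lambda>p. fact n * (\<Sum>i\<le>n. 1 * w i (n - i) p))
        = (\<lambda>p. fact n * (\<Sum>i\<le>n. 1 * ?X (w i (n - i)) p))"
      unfolding linear_op_scale[OF linear_irrep_X] linear_op_sum[OF linear_irrep_X] ..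
    then have "(?X ^^ Suc n) (\<Phi> v x) = (\<lambda>p. fact n * (\<Sum>i\<le>n. ?X (w i (n - i)) p))"
      using Suc by simp
    moreover have "(\<Sum>i\<le>n. ?X (w i (n - i)) p)
        = of_nat (Suc n) * (\<Sum>i\<le>Suc n. w i (Suc n - i) p)" for p
    proof -
      have "(\<Sum>i\<le>n. ?X (w i (n - i)) p) = (\<Sum>i\<le>n. of_nat (Suc i) * w (Suc i) (Suc n - Suc i) p)
          + (\<Sum>i\<le>n. of_nat (Suc n - i) * w i (Suc n - i) p)"
        unfolding Xw sum.distrib[symmetric] by (intro sum.cong refl) (simp add: Suc_diff_le)
      also have "(\<Sum>i\<le>n. of_nat (Suc i) * w (Suc i) (Suc n - Suc i) p)
          = (\<Sum>i\<le>Suc n. of_nat i * w i (Suc n - i) p)"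
        by (subst sum.atMost_Suc_shift) simp
      also have "(\<Sum>i\<le>n. of_nat (Suc n - i) * w i (Suc n - i) p)
          = (\<Sum>i\<le>Suc n. of_nat (Suc n - i) * w i (Suc n - i) p)"
        by simp
      finally show ?thesis
        unfolding sum.distrib[symmetric] sum_distrib_left
        by (simp only:) (intro sum.cong refl, simp add: of_nat_diff algebra_simps)
    qed
    ultimately show ?case by (simp add: mult_ac)
  qed
  \<comment> \<open>large enough that a term of total degree \<open>M\<close> has a vanishing power of \<open>X\<close> in one of the two factors\<close>
  define M where "M = N + N1 + N2 + 2"
  have nil: "nilpotent ?X M" "nilpotent ?X1 M" "nilpotent ?X2 M"
    by (rule nilpotent_mono[OF irrep_X_nilpotent], simp add: M_def)+
  have p0: "\<Phi> (\<lambda>q. 0) y = (\<lambda>p. 0)" for y by (simp add: tensor_map_def)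
  have p0': "\<Phi> y (\<lambda>q. 0) = (\<lambda>p. 0)" for y
    using tensor_map_scale_right[of "\<lambda>q. 0" y 0] by (simp add: W_def)
  have "expX s h N (\<Phi> v x) p = (\<Sum>n<M. \<Sum>i\<le>n. s ^ i * s ^ (n - i) * w i (n - i) p)"
    unfolding fps_op_eq_sum[OF nil(1)] leibniz
    by (intro sum.cong refl) (simp add: sum_distrib_left flip: power_add)
  also have "\<dots> = (\<Sum>i<M. \<Sum>k<M. s ^ i * s ^ k * w i k p)"
  proof (rule sum_square_eq_triangle[symmetric])
    fix i k assume "M \<le> i + k"
    then consider "Suc N1 \<le> i" | "Suc N2 \<le> k" unfolding M_def by linarith
    then show "s ^ i * s ^ k * w i k p = 0"
      by cases (simp_all add: w_def nilpotentD[OF irrep_X_nilpotent] p0 p0')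
  qed
  also have "\<dots>
      = (\<Sum>i<M. fps_nth (fps_exp s) i * (\<Sum>k<M. fps_nth (fps_exp s) k * \<Phi> ((?X1 ^^ i) v) ((?X2 ^^ k) x) p))"
    by (simp add: w_def sum_distrib_left mult_ac)
  also have "\<dots> = \<Phi> (expX s h N1 v) (expX s h N2 x) p"
    unfolding fps_op_eq_sum[OF nil(2)] fps_op_eq_sum[OF nil(3)] tensor_map_sum_left tensor_map_sum_right[OF V2] ..
  finally show "expX s h N (\<Phi> v x) p = \<Phi> (expX s h N1 v) (expX s h N2 x) p" .
qed

lemma expX_W: "v \<in> W (real M / 2) \<Longrightarrow> expX s h M v \<in> W (real M / 2)"
  by (rule fps_op_in[OF irrep_X_nilpotent vspace_W]) (simp_all add: irrep_X_W)

lemma linear_expX: "linear_op (expX s h M)"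
  by (rule linear_op_fps_op[OF irrep_X_nilpotent])

text \<open>The adjoint action carries \<open>exp(-hX)\<close> to the right of the tensor operator; replacing \<open>x\<close> by
  \<open>exp(hX) x\<close> moves it to the other side, and \<open>tensor_map_exp\<close> distributes the remaining factor
  \<open>exp(-hX)\<close> over both tensor factors.\<close>

lemma tensor_map_H:
  assumes v: "v \<in> V1" and x: "x \<in> V2"
  shows "Hop (real N / 2) (\<Phi> v x) = (\<lambda>p. \<Phi> (Hop (real N1 / 2) v) (expX h h N2 x) p
     + \<Phi> (expX (- h) h N1 v) (Hop (real N2 / 2) x) p)"
proof
  fix p
  let ?x = "expX h h N2 x" and ?H = "Hop (real N / 2)" and ?H1 = "Hop (real N1 / 2)" and ?H2 = "Hop (real N2 / 2)"
  define y where "y = expX h h N2 (?H2 x)"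
  define M where "M = N + N2 + 1"
  have nil: "nilpotent (irrep h (real N2 / 2) gX) M" "nilpotent (irrep h (real N / 2) gX) M"
    by (rule nilpotent_mono[OF irrep_X_nilpotent], simp add: M_def)+
  have lin: "linear_op (irrep h (real M / 2) gH)" for M by (simp add: irrep_H linear_Hop)
  have HW: "v \<in> V2 \<Longrightarrow> irrep h (real N2 / 2) gH v \<in> V2" for v unfolding irrep_H
  by (rule Hop_W[OF half_spins])
  have yW: "y \<in> V2" unfolding y_def using x by (intro expX_W Hop_W half_spins)
  have *: "?H (t m x) p = \<Phi> (?H1 (ket m)) ?x p + expX (- h) h N (t m y) p" if "m \<in> I1" for m
    using fun_cong[OF ad_H[OF t_linear[OF that] vspace_W expX_W[OF x, of h] irrep_X_W HW nil lin lin, of h], of p]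
    unfolding ad_gen[OF that expX_W[OF x]] irrep_H expX_inverse y_def[symmetric] by simp
  have "?H (\<Phi> v x) p = (\<Sum>m\<in>I1. v m * ?H (t m x) p)"
    unfolding tensor_map_def linear_op_sum[OF linear_Hop] ..
  also have "\<dots> = (\<Sum>m\<in>I1. v m * \<Phi> (?H1 (ket m)) ?x p) + (\<Sum>m\<in>I1. v m * expX (- h) h N (t m y) p)"
    unfolding sum.distrib[symmetric] by (intro sum.cong refl) (simp add: * algebra_simps)
  also have "(\<Sum>m\<in>I1. v m * \<Phi> (?H1 (ket m)) ?x p) = \<Phi> (?H1 v) ?x p"
    unfolding tensor_map_op_left[OF linear_Hop v] ..
  also have "(\<Sum>m\<in>I1. v m * expX (- h) h N (t m y) p) = expX (- h) h N (\<Phi> v y) p"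
    unfolding tensor_map_def linear_op_sum[OF linear_expX] ..
  also have "expX (- h) h N (\<Phi> v y) = \<Phi> (expX (- h) h N1 v) (?H2 x)"
    unfolding tensor_map_exp[OF v yW] unfolding y_def expX_inverse ..
  finally show "?H (\<Phi> v x) p = \<Phi> (?H1 v) ?x p + \<Phi> (expX (- h) h N1 v) (?H2 x) p" .
qed

lemma tensor_coeff_supported: "supported N1 N2 (\<phi> m)"
proof -
  have "monomial N k
      = (\<lambda>p. 0)" if "N < k" for N k using that by (simp add: monomial_def monomial_norm_def)
  moreover have "\<Phi> (\<lambda>q. 0) y = (\<lambda>p. 0)" for y by (simp add: tensor_map_def)
  moreover have "\<Phi> y (\<lambda>q. 0) = (\<lambda>p. 0)" for y
    using tensor_map_scale_right[of "\<lambda>q. 0" y 0] by (simp add: W_def)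
  ultimately show ?thesis by (auto simp: supported_def tensor_coeff_def)
qed

lemma tensor_coeff_W: "m \<notin> wts (real N / 2) \<Longrightarrow> \<phi> m k1 k2 = 0"
  using tensor_map_W[OF monomial_W] by (simp add: tensor_coeff_def W_def)

lemma half_hZ_monomial: "half_hZ h (real M / 2) (monomial M k) = (\<lambda>p. h / 2 * monomial M (Suc k) p)"
  by (rule ext) (simp add: half_hZ_def Zplus_monomial)

private abbreviation "a \<equiv> h / 2"

lemma monomial_comb: "(\<lambda>q. b * monomial M k q + c * monomial M l q) \<in> W (real M / 2)"
  using monomial_W[of M k] monomial_W[of M l] by (simp add: W_def)

lemma tensor_map_four:
  "\<Phi> (\<lambda>q. monomial N1 k1 q + b * monomial N1 (Suc k1) q) (\<lambda>q. monomial N2 k2 q + c * monomial N2 (Suc k2) q) p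
   = \<phi> p k1 k2 + b * \<phi> p (Suc k1) k2 + c * \<phi> p k1 (Suc k2) + b * c * \<phi> p (Suc k1) (Suc k2)"
proof -
  have "(\<lambda>q. c * monomial N2 (Suc k2) q) \<in> V2" using monomial_comb[of 0 _ 0 c] by simp
  then show ?thesis
    unfolding tensor_map_add_left tensor_map_scale_left
    by (simp add: tensor_map_add_right monomial_W tensor_map_scale_right tensor_coeff_def algebra_simps)
qed

text \<open>The addition theorem of the hyperbolic tangent as a relation between components.  With \<open>P\<close> and \<open>Q\<close> the values of \<open>\<Phi>\<close> on
  \<open>(1 - a z1) (1 - a z2)\<close> and \<open>(1 + a z1) (1 + a z2)\<close> times a monomial, multiplicativity of \<open>exp(hX)\<close> gives
  \<open>(1 - a Z\<^sub>+) Q = (1 + a Z\<^sub>+) P\<close>, and the terms without a factor \<open>2a\<close> cancel.\<close>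

lemma tensor_coeff_Z: "\<phi> m (Suc k1) k2 + \<phi> m k1 (Suc k2)
    = ladder (real N / 2) (m - 1) * (\<phi> (m - 1) k1 k2 + a\<^sup>2 * \<phi> (m - 1) (Suc k1) (Suc k2))"
proof -
  let ?e1 = "monomial N1 k1" and ?f1 = "monomial N1 (Suc k1)" and ?e2 = "monomial N2 k2" and ?f2 = "monomial N2 (Suc k2)"
  let ?A = "half_hZ h (real N / 2)"
  define P Q where "P = \<Phi> (\<lambda>q. ?e1 q + - a * ?f1 q) (\<lambda>q. ?e2 q + - a * ?f2 q)"
    and "Q = \<Phi> (\<lambda>q. ?e1 q + a * ?f1 q) (\<lambda>q. ?e2 q + a * ?f2 q)"
  have in1: "(\<lambda>q. ?e1 q + c * ?f1 q) \<in> V1" and in2: "(\<lambda>q. ?e2 q + c * ?f2 q) \<in> V2" for c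
    using monomial_comb[of 1 _ _ c] by simp_all
  have "expX h h N P = Q"
    unfolding P_def Q_def tensor_map_exp[OF in1 in2]
    using expX_cayley(1)[OF h, of N1 ?e1] expX_cayley(1)[OF h, of N2 ?e2] by (simp add: half_hZ_monomial)
  from fun_cong[OF expX_cayley(3)[OF h this], of m]
  have *: "Q m - ?A Q m = P m + ?A P m" .
  have PW: "P \<in> V3" and QW: "Q \<in> V3" unfolding P_def Q_def by (intro tensor_map_W in2)+
  have A: "?A v m = a * (ladder (real N / 2) (m - 1) * v (m - 1))" if "v \<in> V3" for v
    unfolding half_hZ_def Zplus_apply[OF half_spins that] ..
  have P: "P p
      = \<phi> p k1 k2 - a * \<phi> p (Suc k1) k2 - a * \<phi> p k1 (Suc k2) + a\<^sup>2 * \<phi> p (Suc k1) (Suc k2)" for p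
    unfolding P_def tensor_map_four by (simp add: power2_eq_square)
  have Q: "Q p
      = \<phi> p k1 k2 + a * \<phi> p (Suc k1) k2 + a * \<phi> p k1 (Suc k2) + a\<^sup>2 * \<phi> p (Suc k1) (Suc k2)" for p
    unfolding Q_def tensor_map_four by (simp add: power2_eq_square)
  have ring: "2 * b * (y + z) = 2 * b * (r * (x' + w'))"
    if "(x + b * y + b * z + w) - b * (r * (x' + b * y' + b * z' + w'))
        = (x - b * y - b * z + w) + b * (r * (x' - b * y' - b * z' + w'))"
    for b x y z w x' y' z' w' r :: complex
    using that by algebra
  have "2 * a * (\<phi> m (Suc k1) k2 + \<phi> m k1 (Suc k2))
    = 2 * a * (ladder (real N / 2) (m - 1) * (\<phi> (m - 1) k1 k2 + a\<^sup>2 * \<phi> (m - 1) (Suc k1) (Suc k2)))"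
    by (rule ring) (rule *[unfolded A[OF PW] A[OF QW] P Q])
  then show ?thesis using h by simp
qed

text \<open>The relation \<open>tensor_map_H\<close> on \<open>(1 + a z1) (1 - a z2)\<close> times a monomial, on which both exponentials
  act without a denominator.\<close>

lemma tensor_coeff_H:
  "of_real (2 * m) * (\<phi> m k1 k2 + a * \<phi> m (Suc k1) k2 - a * \<phi> m k1 (Suc k2) - a\<^sup>2 * \<phi> m (Suc k1) (Suc k2))
   = of_real (2 * real k1 - real N1) * (\<phi> m k1 k2 + a * \<phi> m k1 (Suc k2))
   + a * of_real (2 * real (Suc k1) - real N1) * (\<phi> m (Suc k1) k2 + a * \<phi> m (Suc k1) (Suc k2))
   + of_real (2 * real k2 - real N2) * (\<phi> m k1 k2 - a * \<phi> m (Suc k1) k2)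
   - a * of_real (2 * real (Suc k2) - real N2) * (\<phi> m k1 (Suc k2) - a * \<phi> m (Suc k1) (Suc k2))"
proof -
  let ?e1 = "monomial N1 k1" and ?f1 = "monomial N1 (Suc k1)" and ?e2 = "monomial N2 k2" and ?f2 = "monomial N2 (Suc k2)"
  define u1 u1' u2 u2' where "u1 = complex_of_real (2 * real k1 - real N1)" and "u1' = complex_of_real (2 * real (Suc k1) - real N1)"
    and "u2 = complex_of_real (2 * real k2 - real N2)" and "u2' = complex_of_real (2 * real (Suc k2) - real N2)"
  have in1: "(\<lambda>q. b * ?e1 q + c * ?f1 q) \<in> V1" and in2: "(\<lambda>q. b * ?e2 q + c * ?f2 q) \<in> V2" for b c
    by (rule monomial_comb)+
  let ?v = "\<lambda>q. ?e1 q + a * ?f1 q" and ?x = "\<lambda>q. ?e2 q + - a * ?f2 q"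
  have v: "?v \<in> V1" and x: "?x \<in> V2" using in1[of 1 a] in2[of 1 "- a"] by simp_all
  have Ev: "expX (- h) h N1 ?v = (\<lambda>q. ?e1 q + - a * ?f1 q)"
    using expX_cayley(2)[OF h, of N1 ?e1] by (simp add: half_hZ_monomial)
  have Ex: "expX h h N2 ?x = (\<lambda>q. ?e2 q + a * ?f2 q)"
    using expX_cayley(1)[OF h, of N2 ?e2] by (simp add: half_hZ_monomial)
  have Hv: "Hop (real N1 / 2) ?v = (\<lambda>q. u1 * ?e1 q + a * (u1' * ?f1 q))"
    unfolding linear_op_add[OF linear_Hop] linear_op_scale[OF linear_Hop] Hop_monomial u1_def u1'_def ..
  have Hx: "Hop (real N2 / 2) ?x = (\<lambda>q. u2 * ?e2 q + - a * (u2' * ?f2 q))"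
    unfolding linear_op_add[OF linear_Hop] linear_op_scale[OF linear_Hop] Hop_monomial u2_def u2'_def ..
  have sc: "(\<lambda>q. c * ?f2 q) \<in> V2" "(\<lambda>q. c * ?e2 q) \<in> V2" for c
    using monomial_comb[of 0 _ 0 c] by simp_all
  have sc2: "(\<lambda>q. c * (c' * ?f2 q)) \<in> V2" for c c' using sc(1)[of "c * c'"] by (simp add: mult.assoc)
  have "of_real (2 * m) * \<Phi> ?v ?x m
     = \<Phi> (\<lambda>q. u1 * ?e1 q + a * (u1' * ?f1 q)) (\<lambda>q. ?e2 q + a * ?f2 q) m
     + \<Phi> (\<lambda>q. ?e1 q + - a * ?f1 q) (\<lambda>q. u2 * ?e2 q + - a * (u2' * ?f2 q)) m"
    using fun_cong[OF tensor_map_H[OF v x], of m] unfolding Ev Ex Hv Hx Hop_apply[OF half_spins tensor_map_W[OF x]] .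
  note eq = this
  have ring: "M * (x + b * y - b * z - b\<^sup>2 * w)
      = v1 * (x + b * z) + b * v1' * (y + b * w) + v2 * (x - b * y) - b * v2' * (z - b * w)"
    if "M * (x + b * y + - b * z + b * - b * w) = v1 * (x + b * z) + b * (v1' * (y + b * w))
      + (v2 * x + - b * (v2' * z) + - b * (v2 * y + - b * (v2' * w)))"
    for M b x y z w v1 v1' v2 v2' :: complex
    using that by algebra
  show ?thesis
    unfolding u1_def[symmetric] u1'_def[symmetric] u2_def[symmetric] u2'_def[symmetric]
    by (rule ring, rule eq[unfolded tensor_map_four, unfolded tensor_map_add_left tensor_map_scale_left,
        unfolded tensor_map_add_right[OF monomial_W sc(1)] tensor_map_add_right[OF sc(2) sc2] tensor_map_scale_right[OF monomial_W]
          tensor_map_scale_right[OF sc(1)], folded tensor_coeff_def])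
qed

end


section \<open>Equivariant families and Clebsch-Gordan coefficients\<close>

lemma wts_iff: "n \<in> wts (real N / 2) \<longleftrightarrow> (\<exists>k\<le>N. n = - (real N / 2) + real k)"
  by (auto simp: wts_half)

lemma ladder_in:
  assumes "n \<notin> wts (real N / 2)" "n + 1 \<in> wts (real N / 2)"
  shows "ladder (real N / 2) n = 0"
proof -
  from assms(2) obtain k where k: "k \<le> N" "n + 1 = - (real N / 2) + real k" by (auto simp: wts_iff)
  have "k = 0"
  proof (rule ccontr)
    assume "k \<noteq> 0"
    then have "k - 1 \<le> N" "n = - (real N / 2) + real (k - 1)" using k by (auto simp: of_nat_diff)
    then show False using assms(1) wts_iff by blast
  qed
  then have "n = - (real N / 2) - 1" using k by simp
  then show ?thesis by simp
qed

lemma ladder_out: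
  assumes "n \<in> wts (real N / 2)" "n + 1 \<notin> wts (real N / 2)"
  shows "ladder (real N / 2) n = 0"
proof -
  from assms(1) obtain k where k: "k \<le> N" "n = - (real N / 2) + real k" by (auto simp: wts_iff)
  have "k = N"
  proof (rule ccontr)
    assume "k \<noteq> N"
    then have "Suc k \<le> N" "n + 1 = - (real N / 2) + real (Suc k)" using k by auto
    then show False using assms(2) wts_iff by blast
  qed
  then show ?thesis using k by (simp add: ladder_def)
qed

lemma ladder_nonzero:
  assumes "n \<in> wts (real N / 2)" "n + 1 \<in> wts (real N / 2)"
  shows "ladder (real N / 2) n \<noteq> 0"
proof -
  from assms obtain k l where k: "k \<le> N" "n = - (real N / 2) + real k" and l: "l \<le> N" "n + 1 = - (real N / 2) + real l"
    by (auto simp: wts_iff)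
  then have "real l = real k + 1" by simp
  then have "real k + 1 \<le> real N" using l(1) by (metis of_nat_le_iff)
  then show ?thesis using k(2) by (simp add: ladder_def)
qed

lemma ladder_sq:
  assumes "n \<in> wts (real N / 2)"
  shows "ladder (real N / 2) n ^ 2 - ladder (real N / 2) (n - 1) ^ 2 = - 2 * of_real n"
proof -
  let ?j = "real N / 2"
  from assms have b: "- ?j \<le> n" "n \<le> ?j" by (auto simp: wts_def)
  have "sqrt ((?j - n) * (?j + n + 1)) ^ 2 = (?j - n) * (?j + n + 1)"
    using b by (intro real_sqrt_pow2 mult_nonneg_nonneg) auto
  moreover have "sqrt ((?j - (n - 1)) * (?j + (n - 1) + 1)) ^ 2
      = (?j - (n - 1)) * (?j + (n - 1) + 1)"
    using b by (intro real_sqrt_pow2 mult_nonneg_nonneg) auto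
  moreover have "(J - n) * (J + n + 1) - (J - (n - 1)) * (J + (n - 1) + 1) = - 2 * n" for J :: real
    by (simp add: algebra_simps)
  ultimately have "sqrt ((?j - n) * (?j + n + 1)) ^ 2 - sqrt ((?j - (n - 1)) * (?j + (n - 1) + 1)) ^ 2
      = - 2 * n"
    by (simp only:)
  then show ?thesis unfolding ladder_def of_real_power[symmetric] of_real_diff[symmetric] by simp
qed

lemma shift_adjoint:
  assumes u: "u \<in> W (real N / 2)" and v: "v \<in> W (real N / 2)"
  shows "(\<Sum>n\<in>wts (real N / 2). cnj (u n) * (ladder (real N / 2) n * v (n + 1)))
       = (\<Sum>n\<in>wts (real N / 2). cnj (ladder (real N / 2) (n - 1) * u (n - 1)) * v n)"
proof -
  let ?j = "real N / 2" and ?I = "wts (real N / 2)"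
  have fin: "finite ?I" by (simp add: wts_half)
  let ?F = "\<lambda>n. cnj (u n) * (ladder ?j n * v (n + 1))"
  have "sum ?F ?I = sum ?F {n \<in> ?I. n + 1 \<in> ?I}"
    by (rule sum.mono_neutral_right[OF fin]) (use v in \<open>auto simp: W_def\<close>)
  also have "\<dots> = (\<Sum>n\<in>{n \<in> ?I. n - 1 \<in> ?I}. cnj (ladder ?j (n - 1) * u (n - 1)) * v n)"
    by (rule sum.reindex_bij_witness[of _ "\<lambda>n. n - 1" "\<lambda>n. n + 1"]) auto
  also have "\<dots> = (\<Sum>n\<in>?I. cnj (ladder ?j (n - 1) * u (n - 1)) * v n)"
    by (rule sum.mono_neutral_left[OF fin]) (use u in \<open>auto simp: W_def\<close>)
  finally show ?thesis .
qed

context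
  fixes N1 N2 N :: nat
begin

private abbreviation "j1 \<equiv> real N1 / 2"
private abbreviation "j2 \<equiv> real N2 / 2"
private abbreviation "j \<equiv> real N / 2"

definition coupled_support :: "(real \<Rightarrow> real \<times> real \<Rightarrow> complex) \<Rightarrow> bool" where
  "coupled_support f \<longleftrightarrow> (\<forall>m n1 n2. m \<notin> wts j \<or> n1 \<notin> wts j1 \<or> n2 \<notin> wts j2 \<longrightarrow> f m (n1, n2) = 0)"

definition coupled_weight :: "(real \<Rightarrow> real \<times> real \<Rightarrow> complex) \<Rightarrow> bool" where
  "coupled_weight f \<longleftrightarrow> (\<forall>m n1 n2. f m (n1, n2) \<noteq> 0 \<longrightarrow> n1 + n2 = m)"

text \<open>\<open>lowering_defect f\<close> and \<open>raising_defect f\<close> are the two sides of the coupled basis equations for \<open>Z\<^sub>-\<close> and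
  \<open>Z\<^sub>+\<close> subtracted from each other.  Regarding \<open>f\<close> as a vector in the threefold tensor product of
  \<open>W(j1)\<close>, \<open>W(j2)\<close> and the dual of \<open>W(j)\<close>, they are the actions of \<open>Z\<^sub>-\<close> and \<open>Z\<^sub>+\<close> on it.\<close>

definition lowering_defect :: "(real \<Rightarrow> real \<times> real \<Rightarrow> complex) \<Rightarrow> real \<Rightarrow> real \<Rightarrow> real \<Rightarrow> complex" where
  "lowering_defect f m n1 n2
      = ladder j1 n1 * f m (n1 + 1, n2) + ladder j2 n2 * f m (n1, n2 + 1) - ladder j (m - 1) * f (m - 1) (n1, n2)"

definition raising_defect :: "(real \<Rightarrow> real \<times> real \<Rightarrow> complex) \<Rightarrow> real \<Rightarrow> real \<Rightarrow> real \<Rightarrow> complex" where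
  "raising_defect f m n1 n2
      = ladder j1 (n1 - 1) * f m (n1 - 1, n2) + ladder j2 (n2 - 1) * f m (n1, n2 - 1) - ladder j m * f (m + 1) (n1, n2)"

lemma lowering_defect_outside:
  assumes f: "coupled_support f" and out: "m - 1 \<notin> wts j \<and> m \<notin> wts j \<or> n1 \<notin> wts j1 \<or> n2 \<notin> wts j2"
  shows "lowering_defect f m n1 n2 = 0"
proof -
  have 1: "ladder j1 n1 * f m (n1 + 1, n2) = 0"
    using f out ladder_in[of n1 N1] unfolding coupled_support_def by (metis mult_eq_0_iff)
  have 2: "ladder j2 n2 * f m (n1, n2 + 1) = 0"
    using f out ladder_in[of n2 N2] unfolding coupled_support_def by (metis mult_eq_0_iff)
  have 3: "f (m - 1) (n1, n2) = 0" using f out unfolding coupled_support_def by metis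
  show ?thesis unfolding lowering_defect_def 1 2 3 by simp
qed

lemma raising_defect_support:
  assumes f: "coupled_support f"
  shows "coupled_support (\<lambda>m (n1, n2). raising_defect f m n1 n2)"
  unfolding coupled_support_def
proof (intro allI impI)
  fix m n1 n2 assume out: "m \<notin> wts j \<or> n1 \<notin> wts j1 \<or> n2 \<notin> wts j2"
  have 1: "ladder j1 (n1 - 1) * f m (n1 - 1, n2) = 0"
    using f out ladder_out[of "n1 - 1" N1] unfolding coupled_support_def
    by (metis diff_add_cancel mult_eq_0_iff)
  have 2: "ladder j2 (n2 - 1) * f m (n1, n2 - 1) = 0"
    using f out ladder_out[of "n2 - 1" N2] unfolding coupled_support_def
    by (metis diff_add_cancel mult_eq_0_iff)
  have 3: "ladder j m * f (m + 1) (n1, n2) = 0"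
    using f out ladder_in[of m N] unfolding coupled_support_def by (metis mult_eq_0_iff)
  show "(case (n1, n2) of (n1, n2) \<Rightarrow> raising_defect f m n1 n2) = 0"
    unfolding prod.case raising_defect_def 1 2 3 by simp
qed

lemma weight_nonzero: "coupled_weight f \<Longrightarrow> f m (n1, n2) \<noteq> 0 \<Longrightarrow> n1 + n2 = m"
  unfolding coupled_weight_def by blast

text \<open>The commutator of \<open>Z\<^sub>-\<close> and \<open>Z\<^sub>+\<close> in the threefold tensor product is minus the total weight, and the total
  weight of \<open>f\<close> is zero.  Hence \<open>Z\<^sub>- Z\<^sub>+ f = Z\<^sub>+ Z\<^sub>- f = 0\<close>.\<close>

lemma lowering_raising_defect:
  assumes f: "coupled_support f" and w: "coupled_weight f" and low: "\<And>m n1 n2. lowering_defect f m n1 n2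
      = 0"
  shows "lowering_defect (\<lambda>m (n1, n2). raising_defect f m n1 n2) m n1 n2 = 0"
proof -
  define x y z where "x = ladder j1 n1" and "y = ladder j2 n2" and "z = ladder j m"
  define x' y' z' where "x' = ladder j1 (n1 - 1)" and "y' = ladder j2 (n2 - 1)" and "z' = ladder j (m - 1)"
  define F where "F = f m (n1, n2)"
  have 1: "x' * F + y * f m (n1 - 1, n2 + 1) = z' * f (m - 1) (n1 - 1, n2)"
    using low[of m "n1 - 1" n2] by (simp add: lowering_defect_def x'_def y_def z'_def F_def)
  have 2: "x * f m (n1 + 1, n2 - 1) + y' * F = z' * f (m - 1) (n1, n2 - 1)"
    using low[of m n1 "n2 - 1"] by (simp add: lowering_defect_def x_def y'_def z'_def F_def)
  have 3: "x * f (m + 1) (n1 + 1, n2) + y * f (m + 1) (n1, n2 + 1) = z * F"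
    using low[of "m + 1" n1 n2] by (simp add: lowering_defect_def x_def y_def z_def F_def)
  have 4: "((x\<^sup>2 - x'\<^sup>2) + (y\<^sup>2 - y'\<^sup>2) - (z\<^sup>2 - z'\<^sup>2)) * F = 0"
  proof (cases "F = 0")
    case False
    then have "m \<in> wts j" "n1 \<in> wts j1" "n2 \<in> wts j2"
      using f unfolding coupled_support_def F_def by blast+
    moreover have "m = n1 + n2" using weight_nonzero[OF w] False unfolding F_def by metis
    ultimately show ?thesis
      unfolding x_def x'_def y_def y'_def z_def z'_def by (simp only: ladder_sq) simp
  qed simp
  have L: "lowering_defect (\<lambda>m (n1, n2). raising_defect f m n1 n2) m n1 n2
     = x * (x * F + y' * f m (n1 + 1, n2 - 1) - z * f (m + 1) (n1 + 1, n2))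
     + y * (x' * f m (n1 - 1, n2 + 1) + y * F - z * f (m + 1) (n1, n2 + 1))
     - z' * (x' * f (m - 1) (n1 - 1, n2) + y' * f (m - 1) (n1, n2 - 1) - z' * F)"
    by (simp add: lowering_defect_def raising_defect_def x_def x'_def y_def y'_def z_def z'_def F_def)
  show ?thesis unfolding L using 1 2 3 4 by algebra
qed

definition triple :: "(real \<Rightarrow> real \<Rightarrow> real \<Rightarrow> complex) \<Rightarrow> complex" where
  "triple F = (\<Sum>m\<in>wts j. \<Sum>n1\<in>wts j1. \<Sum>n2\<in>wts j2. F m n1 n2)"

lemma raising_defect_adjoint:
  assumes f: "coupled_support f" and g: "coupled_support g"
  shows "triple (\<lambda>m n1 n2. cnj (raising_defect f m n1 n2) * g m (n1, n2))
      = triple (\<lambda>m n1 n2. cnj (f m (n1, n2)) * lowering_defect g m n1 n2)"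
proof -
  have W1: "(\<lambda>r. f m (r, n2)) \<in> W j1" "(\<lambda>r. g m (r, n2)) \<in> W j1" for m n2
    using f g by (auto simp: W_def coupled_support_def)
  have W2: "(\<lambda>r. f m (n1, r)) \<in> W j2" "(\<lambda>r. g m (n1, r)) \<in> W j2" for m n1
    using f g by (auto simp: W_def coupled_support_def)
  have W3: "(\<lambda>r. cnj (g r (n1, n2))) \<in> W j" "(\<lambda>r. cnj (f r (n1, n2))) \<in> W j" for n1 n2
    using f g by (auto simp: W_def coupled_support_def)
  have swap1: "triple F = (\<Sum>m\<in>wts j. \<Sum>n2\<in>wts j2. \<Sum>n1\<in>wts j1. F m n1 n2)" for F
    unfolding triple_def by (intro sum.cong refl sum.swap)
  have 1: "triple (\<lambda>m n1 n2. cnj (ladder j1 (n1 - 1) * f m (n1 - 1, n2)) * g m (n1, n2))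
     = triple (\<lambda>m n1 n2. cnj (f m (n1, n2)) * (ladder j1 n1 * g m (n1 + 1, n2)))"
    unfolding swap1
    by (rule sum.cong[OF refl], rule sum.cong[OF refl], rule shift_adjoint[OF W1, symmetric])
  have 2: "triple (\<lambda>m n1 n2. cnj (ladder j2 (n2 - 1) * f m (n1, n2 - 1)) * g m (n1, n2))
     = triple (\<lambda>m n1 n2. cnj (f m (n1, n2)) * (ladder j2 n2 * g m (n1, n2 + 1)))"
    unfolding triple_def
    by (rule sum.cong[OF refl], rule sum.cong[OF refl], rule shift_adjoint[OF W2, symmetric])
  have swap3: "triple F = (\<Sum>n1\<in>wts j1. \<Sum>n2\<in>wts j2. \<Sum>m\<in>wts j. F m n1 n2)" for F
    unfolding triple_def by (subst sum.swap) (intro sum.cong refl sum.swap)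
  have 3: "triple (\<lambda>m n1 n2. cnj (f m (n1, n2)) * (ladder j (m - 1) * g (m - 1) (n1, n2)))
     = triple (\<lambda>m n1 n2. cnj (ladder j m * f (m + 1) (n1, n2)) * g m (n1, n2))"
  proof -
    have "(\<Sum>m\<in>wts j. cnj (f m (n1, n2)) * (ladder j (m - 1) * g (m - 1) (n1, n2)))
        = (\<Sum>m\<in>wts j. cnj (ladder j m * f (m + 1) (n1, n2)) * g m (n1, n2))" for n1 n2
      using shift_adjoint[OF W3[of n1 n2]] by (simp add: mult_ac)
    then show ?thesis unfolding swap3 by simp
  qed
  have add: "triple (\<lambda>m n1 n2. F m n1 n2 + G m n1 n2) = triple F + triple G"
    and diff: "triple (\<lambda>m n1 n2. F m n1 n2 - G m n1 n2) = triple F - triple G" for F G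
    by (simp_all add: triple_def sum.distrib sum_subtractf)
  show ?thesis
    unfolding raising_defect_def lowering_defect_def complex_cnj_diff complex_cnj_add left_diff_distrib distrib_right right_diff_distrib distrib_left add diff 1 2 3 ..
qed

text \<open>\<open>Z\<^sub>+\<close> and \<open>Z\<^sub>-\<close> are adjoint to each other, so the squared norm of \<open>Z\<^sub>+ f\<close> is the inner product of \<open>f\<close>
  with \<open>Z\<^sub>- Z\<^sub>+ f = 0\<close>.\<close>

lemma raising_defect_zero:
  assumes f: "coupled_support f" and w: "coupled_weight f" and low: "\<And>m n1 n2. lowering_defect f m n1 n2
      = 0"
  shows "raising_defect f m n1 n2 = 0"
proof -
  let ?g = "\<lambda>m (n1, n2). raising_defect f m n1 n2"
  have fin: "finite (wts j)" "finite (wts j1)" "finite (wts j2)" by simp_all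
  have "triple (\<lambda>m n1 n2. cnj (raising_defect f m n1 n2) * raising_defect f m n1 n2) = 0"
    using raising_defect_adjoint[OF f raising_defect_support[OF f]] lowering_raising_defect[OF f w low] by (simp add: triple_def)
  moreover have "triple (\<lambda>m n1 n2. cnj (raising_defect f m n1 n2) * raising_defect f m n1 n2)
     = of_real (\<Sum>m\<in>wts j. \<Sum>n1\<in>wts j1. \<Sum>n2\<in>wts j2. (norm (raising_defect f m n1 n2))\<^sup>2)"
  proof -
    have "cnj z * z = of_real ((norm z)\<^sup>2)" for z by (metis complex_norm_square mult.commute)
    then show ?thesis unfolding triple_def of_real_sum by simp
  qed
  ultimately have "(\<Sum>m\<in>wts j. \<Sum>n1\<in>wts j1. \<Sum>n2\<in>wts j2. (norm (raising_defect f m n1 n2))\<^sup>2) = 0"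
    by (simp only: of_real_eq_0_iff)
  then have "\<forall>m\<in>wts j. \<forall>n1\<in>wts j1. \<forall>n2\<in>wts j2. raising_defect f m n1 n2 = 0"
    by (simp add: sum_nonneg_eq_0_iff fin sum_nonneg)
  then show ?thesis
    using raising_defect_support[OF f] unfolding coupled_support_def by fastforce
qed

definition coupled :: "(real \<Rightarrow> real \<times> real \<Rightarrow> complex) \<Rightarrow> bool" where
  "coupled f \<longleftrightarrow> coupled_support f \<and> coupled_weight f \<and> (\<forall>m n1 n2. lowering_defect f m n1 n2 = 0) \<and> (\<forall>m n1 n2. raising_defect f m n1 n2 = 0)"

text \<open>At the top weight the raising equation expresses the coordinate at \<open>(n1 - 1, n2)\<close>, whose coefficient is
  nonzero, through the one at \<open>(n1, n2 - 1)\<close>, so that a zero at the largest \<open>n1\<close> propagates to all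
  smaller ones.\<close>

lemma highest_component_zero:
  assumes "coupled f" and "f j (j1, j - j1) = 0"
  shows "f j (n1, n2) = 0"
proof -
  have "j1 + n2 = j" if "f j (j1, n2) \<noteq> 0" for n2
    using assms(1) weight_nonzero[of f j j1 n2] that unfolding coupled_def by blast
  then have top: "f j (j1, n2) = 0" for n2
    using assms(2) by (metis add_diff_cancel_left')
  have "f j (j1 - real k, n2) = 0" for k n2
  proof (induction k arbitrary: n2)
    case 0
    then show ?case using top by simp
  next
    case (Suc k)
    let ?n = "j1 - real (Suc k)"
    have n: "j1 - real k - 1 = ?n" by simp
    have "raising_defect f j (j1 - real k) n2 = 0" using assms(1) unfolding coupled_def by blast
    from this[unfolded raising_defect_def n Suc ladder_top] have "ladder j1 ?n * f j (?n, n2)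
        = 0" by simp
    moreover have "ladder j1 ?n \<noteq> 0" if "?n \<in> wts j1"
    proof (rule ladder_nonzero[OF that])
      from that obtain i where "i \<le> N1" "?n = - j1 + real i" by (auto simp: wts_iff)
      then show "?n + 1 \<in> wts j1" unfolding wts_iff by (intro exI[of _ "Suc i"]) auto
    qed
    ultimately show ?case using assms(1) unfolding coupled_def coupled_support_def
    by (metis mult_eq_0_iff)
  qed
  moreover have "\<exists>k. n1 = j1 - real k" if "n1 \<in> wts j1"
  proof -
    from that obtain i where "i \<le> N1" "n1 = - j1 + real i" by (auto simp: wts_iff)
    then show ?thesis by (intro exI[of _ "N1 - i"]) (simp add: of_nat_diff)
  qed
  ultimately show ?thesis using assms(1) unfolding coupled_def coupled_support_def by metis
qed

text \<open>The lowering equation expresses \<open>f (m - 1)\<close> through \<open>f m\<close> as long as \<open>m - 1\<close> is a weight.\<close>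

lemma highest_determines:
  assumes "coupled f" and "\<And>n1 n2. f j (n1, n2) = 0"
  shows "f = (\<lambda>m p. 0)"
proof -
  have "f (j - real k) (n1, n2) = 0" for k n1 n2
  proof (induction k arbitrary: n1 n2)
    case (Suc k)
    let ?m = "j - real (Suc k)"
    have m: "j - real k - 1 = ?m" by simp
    have "lowering_defect f (j - real k) n1 n2 = 0" using assms(1) unfolding coupled_def by blast
    from this[unfolded lowering_defect_def m Suc] have "ladder j ?m * f ?m (n1, n2) = 0" by simp
    moreover have "ladder j ?m \<noteq> 0" if "?m \<in> wts j"
    proof (rule ladder_nonzero[OF that])
      from that obtain i where "i \<le> N" "?m = - j + real i" by (auto simp: wts_iff)
      then show "?m + 1 \<in> wts j" unfolding wts_iff by (intro exI[of _ "Suc i"]) auto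
    qed
    ultimately show ?case using assms(1) unfolding coupled_def coupled_support_def
    by (metis mult_eq_0_iff)
  qed (simp add: assms(2))
  moreover have "\<exists>k. m = j - real k" if "m \<in> wts j" for m
  proof -
    from that obtain i where "i \<le> N" "m = - j + real i" by (auto simp: wts_iff)
    then show ?thesis by (intro exI[of _ "N - i"]) (simp add: of_nat_diff)
  qed
  ultimately have "f m (n1, n2) = 0" for m n1 n2
    using assms(1) unfolding coupled_def coupled_support_def by metis
  then show ?thesis by (intro ext) auto
qed

lemma coupled_unique: "coupled f \<Longrightarrow> f j (j1, j - j1) = 0 \<Longrightarrow> f = (\<lambda>m p. 0)"
  using highest_component_zero highest_determines by blast

lemma coupled_diff:
  assumes "coupled f" "coupled g"
  shows "coupled (\<lambda>m p. f m p - c * g m p)"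
proof -
  have "lowering_defect (\<lambda>m p. f m p - c * g m p) m n1 n2
      = lowering_defect f m n1 n2 - c * lowering_defect g m n1 n2"
    and "raising_defect (\<lambda>m p. f m p - c * g m p) m n1 n2
        = raising_defect f m n1 n2 - c * raising_defect g m n1 n2" for m n1 n2
    by (simp_all add: lowering_defect_def raising_defect_def algebra_simps)
  moreover have "coupled_weight (\<lambda>m p. f m p - c * g m p)"
    using assms unfolding coupled_def coupled_weight_def by (metis diff_self mult_zero_right)
  moreover have "coupled_support (\<lambda>m p. f m p - c * g m p)"
    using assms unfolding coupled_def coupled_support_def by auto
  ultimately show ?thesis using assms unfolding coupled_def by simp
qed

end


lemma coupled_swap: "coupled N1 N2 N f \<Longrightarrow> coupled N2 N1 N (\<lambda>m (a, b). f m (b, a))"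
proof -
  assume f: "coupled N1 N2 N f"
  have "lowering_defect N2 N1 N (\<lambda>m (a, b). f m (b, a)) m n2 n1 = lowering_defect N1 N2 N f m n1 n2"
    and "raising_defect N2 N1 N (\<lambda>m (a, b). f m (b, a)) m n2 n1
        = raising_defect N1 N2 N f m n1 n2" for m n1 n2
    by (simp_all add: lowering_defect_def raising_defect_def)
  moreover have "coupled_weight (\<lambda>m (a, b). f m (b, a))"
    using f unfolding coupled_def coupled_weight_def prod.case by (metis add.commute)
  moreover have "coupled_support N2 N1 N (\<lambda>m (a, b). f m (b, a))"
    using f unfolding coupled_def coupled_support_def prod.case by blast
  ultimately show ?thesis using f unfolding coupled_def by simp
qed

text \<open>The second coordinate is the first one after exchanging the two tensor factors.\<close>

lemma coupled_extremal:
  assumes "coupled N1 N2 N f" "f \<noteq> (\<lambda>m p. 0)"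
  shows "f (real N / 2) (real N1 / 2, real N / 2 - real N1 / 2) \<noteq> 0"
    and "f (real N / 2) (real N / 2 - real N2 / 2, real N2 / 2) \<noteq> 0"
proof -
  show "f (real N / 2) (real N1 / 2, real N / 2 - real N1 / 2) \<noteq> 0"
    using coupled_unique[OF assms(1)] assms(2) by blast
  show "f (real N / 2) (real N / 2 - real N2 / 2, real N2 / 2) \<noteq> 0"
  proof
    assume "f (real N / 2) (real N / 2 - real N2 / 2, real N2 / 2) = 0"
    then have "(\<lambda>m (a, b). f m (b, a)) = (\<lambda>m p. 0)"
      by (intro coupled_unique[OF coupled_swap[OF assms(1)]]) simp
    then have "f m (a, b) = 0" for m a b by (auto dest!: fun_cong[where x = m] fun_cong[where x = "(b, a)"])
    then have "f = (\<lambda>m p. 0)" by (intro ext) auto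
    with assms(2) show False by blast
  qed
qed

text \<open>The two extremal coordinates can be nonzero only if \<open>j - j1\<close> is a weight of \<open>W(j2)\<close> and \<open>j - j2\<close> a weight
  of \<open>W(j1)\<close>; together these are the triangle inequalities and the integrality condition.\<close>

lemma coupled_triangle:
  assumes "coupled N1 N2 N f" "f \<noteq> (\<lambda>m p. 0)"
  shows "real N / 2 \<in> {\<bar>real N1 / 2 - real N2 / 2\<bar> + real k | k. \<bar>real N1 / 2 - real N2 / 2\<bar> + real k \<le> real N1 / 2 + real N2 / 2}"
proof -
  have supp: "n1 \<in> wts (real N1 / 2) \<and> n2 \<in> wts (real N2 / 2)" if "f m (n1, n2) \<noteq> 0" for m n1 n2
    using assms(1) that unfolding coupled_def coupled_support_def by blast
  from supp[OF coupled_extremal(1)[OF assms]] obtain k where k: "k \<le> N2" "real N / 2 - real N1 / 2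
      = - (real N2 / 2) + real k"
    by (auto simp: wts_iff)
  from supp[OF coupled_extremal(2)[OF assms]] obtain l where l: "l \<le> N1" "real N / 2 - real N2 / 2
      = - (real N1 / 2) + real l"
    by (auto simp: wts_iff)
  from k have "real k \<le> real N2" by simp
  then have le: "real N / 2 \<le> real N1 / 2 + real N2 / 2" using k(2) by linarith
  show ?thesis
  proof (cases "N2 \<le> N1")
    case True
    then have "real N / 2 = \<bar>real N1 / 2 - real N2 / 2\<bar> + real k" using k(2) by simp
    with le show ?thesis by (metis (mono_tags, lifting) mem_Collect_eq)
  next
    case False
    then have "real N / 2 = \<bar>real N1 / 2 - real N2 / 2\<bar> + real l" using l(2) by simp
    with le show ?thesis by (metis (mono_tags, lifting) mem_Collect_eq)
  qed
qed

lemma tensor_sum_coupled: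
  assumes "coupled_support N1 N2 N f"
  shows "tensor_sum (Hop (real N1 / 2)) (Hop (real N2 / 2)) (f m)
      = (\<lambda>(n1, n2). of_real (2 * (n1 + n2)) * f m (n1, n2))" (is ?H)
    and "tensor_sum (Zplus (real N1 / 2)) (Zplus (real N2 / 2)) (f m)
     
          = (\<lambda>(n1, n2). raising_defect N1 N2 N f m n1 n2 + ladder (real N / 2) m * f (m + 1) (n1, n2))" (is ?P)
    and "tensor_sum (Zminus (real N1 / 2)) (Zminus (real N2 / 2)) (f m)
     
          = (\<lambda>(n1, n2). lowering_defect N1 N2 N f m n1 n2 + ladder (real N / 2) (m - 1) * f (m - 1) (n1, n2))" (is ?M)
proof -
  have W: "(\<lambda>r. f m (r, n2)) \<in> W (real N1 / 2)" "(\<lambda>r. f m (n1, r)) \<in> W (real N2 / 2)" for n1 n2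
    using assms by (auto simp: W_def coupled_support_def)
  show ?H ?P ?M
    unfolding tensor_sum_def lowering_defect_def raising_defect_def
    by (auto simp: Hop_apply[OF half_spins W(1)] Hop_apply[OF half_spins W(2)] Zplus_apply[OF half_spins W(1)] Zplus_apply[OF half_spins W(2)]
      Zminus_apply[OF half_spins W(1)] Zminus_apply[OF half_spins W(2)] algebra_simps)
qed

lemma coupled_basis_iff:
  "coupled_basis (real N1 / 2) (real N2 / 2) (real N / 2) \<Psi> \<longleftrightarrow> coupled N1 N2 N \<Psi>
     \<and> (\<Sum>p\<in>wts (real N1 / 2) \<times> wts (real N2 / 2). (norm (\<Psi> (real N / 2) p))\<^sup>2) = 1
     \<and> (\<exists>r>0. \<Psi> (real N / 2) (real N1 / 2, real N / 2 - real N1 / 2) = complex_of_real r)"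
proof -
  let ?j = "real N / 2"
  have L: "complex_of_real (sqrt ((?j + m) * (?j - m + 1))) = ladder ?j (m - 1)" for m
    by (simp add: ladder_def mult.commute algebra_simps)
  have core: "(\<forall>m\<in>wts ?j.
        tensor_sum (Hop (real N1 / 2)) (Hop (real N2 / 2)) (\<Psi> m)
            = (\<lambda>p. complex_of_real (2 * m) * \<Psi> m p) \<and>
        tensor_sum (Zplus (real N1 / 2)) (Zplus (real N2 / 2)) (\<Psi> m)
            = (\<lambda>p. ladder ?j m * \<Psi> (m + 1) p) \<and>
        tensor_sum (Zminus (real N1 / 2)) (Zminus (real N2 / 2)) (\<Psi> m)
            = (\<lambda>p. ladder ?j (m - 1) * \<Psi> (m - 1) p))
     \<longleftrightarrow> coupled N1 N2 N \<Psi>" if s: "coupled_support N1 N2 N \<Psi>"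
  proof -
    have "coupled N1 N2 N \<Psi> \<longleftrightarrow> (\<forall>m\<in>wts ?j. \<forall>n1 n2. (\<Psi> m (n1, n2) \<noteq> 0 \<longrightarrow> n1 + n2 = m)
       \<and> lowering_defect N1 N2 N \<Psi> m n1 n2 = 0 \<and> raising_defect N1 N2 N \<Psi> m n1 n2 = 0)"
    proof -
      have out: "(\<Psi> m (n1, n2) \<noteq> 0 \<longrightarrow> n1 + n2 = m)
       \<and> lowering_defect N1 N2 N \<Psi> m n1 n2 = 0 \<and> raising_defect N1 N2 N \<Psi> m n1 n2 = 0" if m: "m \<notin> wts ?j" for m n1 n2
      proof -
        have z: "\<Psi> m p = 0" for p using s m unfolding coupled_support_def by (cases p) blast
        have "ladder ?j (m - 1) * \<Psi> (m - 1) (n1, n2) = 0"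
          using s m ladder_out[of "m - 1" N] unfolding coupled_support_def
          by (metis diff_add_cancel mult_eq_0_iff)
        moreover have "ladder ?j m * \<Psi> (m + 1) (n1, n2) = 0"
          using s m ladder_in[of m N] unfolding coupled_support_def by (metis mult_eq_0_iff)
        ultimately show ?thesis by (simp only: lowering_defect_def raising_defect_def z) simp
      qed
      then show ?thesis using s unfolding coupled_def coupled_weight_def by blast
    qed
    moreover have "(\<lambda>(n1, n2). of_real (2 * (n1 + n2)) * \<Psi> m (n1, n2))
        = (\<lambda>p. complex_of_real (2 * m) * \<Psi> m p)
      \<longleftrightarrow> (\<forall>n1 n2. \<Psi> m (n1, n2) \<noteq> 0 \<longrightarrow> n1 + n2 = m)" for m
      by (auto simp: fun_eq_iff simp del: of_real_add of_real_mult distrib_left_numeral)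
    ultimately show ?thesis
      unfolding tensor_sum_coupled[OF s] by (simp add: fun_eq_iff) blast
  qed
  have supp: "coupled_support N1 N2 N \<Psi> \<longleftrightarrow> (\<forall>m p. m \<notin> wts ?j \<or> p \<notin> wts (real N1 / 2) \<times> wts (real N2 / 2) \<longrightarrow> \<Psi> m p
      = 0)"
    unfolding coupled_support_def by auto
  show ?thesis
    unfolding coupled_basis_def L ladder_def[symmetric] supp[symmetric]
    using core coupled_def[of N1 N2 N \<Psi>] by blast
qed

text \<open>A nonzero family, divided by a scalar that fixes norm and phase at the extremal coordinate, is a
  coupled basis; any other coupled basis is a positive multiple of it, hence equal to it by the norm.  This makes
  the definite description of the Clebsch-Gordan coefficients meaningful.\<close>

lemma coupled_clebsch_gordan:
  assumes f: "coupled N1 N2 N f"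
  shows "\<exists>I. \<forall>m n1 n2. f m (n1, n2)
      = I * clebsch_gordan (real N1 / 2) (real N2 / 2) (real N / 2) n1 n2 m"
proof (cases "f = (\<lambda>m p. 0)")
  case True
  then show ?thesis by (intro exI[of _ 0]) simp
next
  case False
  let ?j1 = "real N1 / 2" and ?j2 = "real N2 / 2" and ?j = "real N / 2"
  let ?P = "wts ?j1 \<times> wts ?j2" and ?top = "(?j1, ?j - ?j1)"
  have fin: "finite ?P" by simp
  define w where "w = f ?j ?top"
  have w: "w \<noteq> 0" unfolding w_def by (rule coupled_extremal(1)[OF f False])
  have topP: "?top \<in> ?P" using f w unfolding w_def coupled_def coupled_support_def by auto
  define S where "S = (\<Sum>p\<in>?P. (norm (f ?j p))\<^sup>2)"
  have "0 < (norm w)\<^sup>2" using w by simp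
  also have "\<dots> \<le> S" unfolding S_def w_def by (rule member_le_sum[OF topP]) (simp_all add: fin)
  finally have S: "0 < S" .
  \<comment> \<open>\<open>c\<close> carries the phase of the extremal coordinate and the norm of the top vector\<close>
  define c where "c = w / of_real (norm w) * of_real (sqrt S)"
  have c0: "c \<noteq> 0" and cn: "(norm c)\<^sup>2 = S" using w S by (simp_all add: c_def norm_mult norm_divide)
  define \<Psi> where "\<Psi> m p = f m p / c" for m p
  have zero: "coupled N1 N2 N (\<lambda>m p. 0)"
    by (simp add: coupled_def coupled_support_def coupled_weight_def lowering_defect_def raising_defect_def)
  have \<Psi>c: "coupled N1 N2 N \<Psi>"
    using coupled_diff[OF zero f, of "- 1 / c"] by (simp add: \<Psi>_def[abs_def])
  have \<Psi>t: "\<Psi> ?j ?top = of_real (norm w / sqrt S)"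
    unfolding \<Psi>_def w_def[symmetric] c_def using w S by (simp add: field_simps)
  have \<Psi>n: "(\<Sum>p\<in>?P. (norm (\<Psi> ?j p))\<^sup>2) = 1"
    unfolding \<Psi>_def norm_divide power_divide cn sum_divide_distrib[symmetric] S_def[symmetric] using S
    by simp
  have basis: "coupled_basis ?j1 ?j2 ?j \<Psi>"
    unfolding coupled_basis_iff using \<Psi>c \<Psi>n \<Psi>t w S
    by (intro conjI exI[of _ "norm w / sqrt S"]) simp_all
  have uniq: "\<Psi>' = \<Psi>" if "coupled_basis ?j1 ?j2 ?j \<Psi>'" for \<Psi>'
  proof -
    from that[unfolded coupled_basis_iff] obtain r where \<Psi>': "coupled N1 N2 N \<Psi>'"
      and n': "(\<Sum>p\<in>?P. (norm (\<Psi>' ?j p))\<^sup>2) = 1" and r: "0 < r" "\<Psi>' ?j ?top = of_real r" by blast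
    define b where "b = r / (norm w / sqrt S)"
    have b: "0 < b" using r w S by (simp add: b_def)
    have "\<Psi>' ?j ?top - of_real b * \<Psi> ?j ?top = 0"
      unfolding r(2) \<Psi>t b_def using w S by simp
    then have "(\<lambda>m p. \<Psi>' m p - of_real b * \<Psi> m p) = (\<lambda>m p. 0)"
      by (rule coupled_unique[OF coupled_diff[OF \<Psi>' \<Psi>c]])
    then have eq: "\<Psi>' m p
        = of_real b * \<Psi> m p" for m p by (metis (no_types, lifting) eq_iff_diff_eq_0)
    have "(\<Sum>p\<in>?P. (norm (\<Psi>' ?j p))\<^sup>2) = b\<^sup>2 * (\<Sum>p\<in>?P. (norm (\<Psi> ?j p))\<^sup>2)"
      unfolding eq by (simp add: norm_mult power_mult_distrib sum_distrib_left)
    then have "b\<^sup>2 = 1" unfolding n' \<Psi>n by simp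
    then have "b = 1" using b by (simp add: power2_eq_1_iff)
    then show ?thesis by (intro ext) (simp add: eq)
  qed
  have "(THE \<Psi>. coupled_basis ?j1 ?j2 ?j \<Psi>)
      = \<Psi>" by (rule the_equality[of "coupled_basis ?j1 ?j2 ?j", OF basis uniq])
  then have "clebsch_gordan ?j1 ?j2 ?j n1 n2 m = \<Psi> m (n1, n2)" for n1 n2 m
    unfolding clebsch_gordan_def using coupled_triangle[OF f False] by simp
  then show ?thesis using c0 by (intro exI[of _ c]) (simp add: \<Psi>_def)
qed

section \<open>Identification of the coefficients\<close>

lemma rbinom_of_nat: "rbinom x (real n) = x gchoose n"
  by (simp add: rbinom_def)

lemma b_coeff_diff:
  "b_coeff (- n1) (- n2) (- m1) (- m2) - b_coeff (- n1) (- n2) (- m1 - 1) (- m2 - 1)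
   = (let A = - n1 - m1; B = - n2 - m2 in
      rbinom A (n2 - m2) * rbinom B (n1 - m1) - rbinom (A - 1) (n2 - m2 - 1) * rbinom (B - 1) (n1 - m1 - 1))"
proof -
  have "- n1 + - m1 = - n1 - m1" "- n2 + - m2 = - n2 - m2" "- m1 - - n1 = n1 - m1" "- m2 - - n2 = n2 - m2"
    "- n1 + (- m1 - 1) = - n1 - m1 - 1" "- n2 + (- m2 - 1) = - n2 - m2 - 1"
    "- m1 - 1 - - n1 = n1 - m1 - 1" "- m2 - 1 - - n2 = n2 - m2 - 1" by simp_all
  then show ?thesis by (simp only: b_coeff_def Let_def)
qed

lemma alpha_below:
  assumes "l1 < k1 \<or> l2 < k2"
  shows "alpha h (real N1 / 2) (real N2 / 2) (- (- (real N1 / 2) + real l1)) (- (- (real N2 / 2) + real l2))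
      (- (- (real N1 / 2) + real k1)) (- (- (real N2 / 2) + real k2)) = 0"
  unfolding alpha_def b_coeff_diff Let_def using assms by (auto simp: rbinom_def)

text \<open>With \<open>x\<close>, \<open>x'\<close> for \<open>A - 1\<close> and \<open>A\<close> choose \<open>p2\<close>, where \<open>A = c1 - p1\<close>, and \<open>y\<close>, \<open>y'\<close> likewise, this is
  \<open>x' y + x y' - x y = x' y' - (x' - x) (y' - y)\<close>, where Pascal's rule turns each difference into the shifted
  binomial coefficient of the second product.\<close>

lemma twist_coeff_binomial:
  "twist_coeff a c1 c2 p1 p2 = (- 1) ^ p2 * a ^ (p1 + p2) * of_real
     (rbinom (c1 - real p1) (real p2) * rbinom (c2 - real p2) (real p1)
      - rbinom (c1 - real p1 - 1) (real p2 - 1) * rbinom (c2 - real p2 - 1) (real p1 - 1))"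
proof -
  have pas: "rbinom (x - 1) (real p - 1) = (x gchoose p) - ((x - 1) gchoose p)" for x p
  proof (cases p)
    case (Suc q)
    then show ?thesis using gbinomial_pascal[of x q] by (simp add: rbinom_of_nat)
  qed (simp add: rbinom_def)
  have e: "c1 - 1 - real p1 = c1 - real p1 - 1" "c2 - 1 - real p2 = c2 - real p2 - 1" by simp_all
  show ?thesis
    unfolding twist_coeff_def lagrange_coeff_def rbinom_of_nat pas e of_real_mult of_real_diff
    by (simp add: algebra_simps)
qed

lemma rfact_of_nat: "x = real n \<Longrightarrow> rfact x = fact n"
  by (simp add: rfact_def)

lemma D_coeff_monomial_norm:
  assumes "k1 \<le> N1" "k2 \<le> N2" "l1 \<le> N1" "l2 \<le> N2"
  shows "D_coeff (real N1 / 2) (real N2 / 2) (- (- (real N1 / 2) + real l1)) (- (- (real N2 / 2) + real l2))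
      (- (- (real N1 / 2) + real k1)) (- (- (real N2 / 2) + real k2))
    = monomial_norm N1 l1 * monomial_norm N2 l2 / (monomial_norm N1 k1 * monomial_norm N2 k2)"
proof -
  have f: "rfact (real N / 2 - - (- (real N / 2) + real l)) = fact l" "rfact (real N / 2 + - (- (real N / 2) + real l)) = fact (N - l)"
    if "l \<le> N" for N l
    using that by (auto intro!: rfact_of_nat simp: of_nat_diff)
  have "fact l1 * fact (N1 - k1) * fact l2 * fact (N2 - k2) / (fact (N1 - l1) * fact k1 * fact (N2 - l2) * fact k2)
    = (fact l1 * fact N1 / fact (N1 - l1)) * (fact l2 * fact N2 / fact (N2 - l2))
      / ((fact k1 * fact N1 / fact (N1 - k1)) * (fact k2 * fact N2 / fact (N2 - k2)) :: real)"
    by (simp add: field_simps)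
  then show ?thesis
    unfolding D_coeff_def f[OF assms(1)] f[OF assms(2)] f[OF assms(3)] f[OF assms(4)]
    using assms by (simp only: monomial_norm_def if_True real_sqrt_mult real_sqrt_divide)
qed

text \<open>The square root \<open>D_coeff\<close> is the quotient of the norms of the monomial basis vectors, so \<open>\<alpha>\<close> is the
  matrix of the twist in the orthonormal bases.\<close>

lemma alpha_twist_coeff:
  assumes "k1 + p1 \<le> N1" "k2 + p2 \<le> N2"
  shows "alpha h (real N1 / 2) (real N2 / 2) (- (- (real N1 / 2) + real (k1 + p1))) (- (- (real N2 / 2) + real (k2 + p2)))
      (- (- (real N1 / 2) + real k1)) (- (- (real N2 / 2) + real k2))
    = twist_coeff (h / 2) (real N1 - 2 * real k1) (real N2 - 2 * real k2) p1 p2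
      * of_real (monomial_norm N1 (k1 + p1) * monomial_norm N2 (k2 + p2) / (monomial_norm N1 k1 * monomial_norm N2 k2))"
proof -
  have le: "k1 \<le> N1" "k2 \<le> N2" using assms by simp_all
  have fl: "\<lfloor>- (- (real N2 / 2) + real k2) - - (- (real N2 / 2) + real (k2 + p2))\<rfloor> = int p2"
    "\<lfloor>- (- (real N1 / 2) + real k1) + - (- (real N2 / 2) + real k2) - - (- (real N1 / 2) + real (k1 + p1)) - - (- (real N2 / 2) + real (k2 + p2))\<rfloor>
        = int (p1 + p2)"
    by (simp_all add: floor_eq_iff)
  have A: "- (- (real N1 / 2) + real (k1 + p1)) - (- (real N1 / 2) + real k1)
      = real N1 - 2 * real k1 - real p1"
    "- (- (real N2 / 2) + real (k2 + p2)) - (- (real N2 / 2) + real k2)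
        = real N2 - 2 * real k2 - real p2"
    "(- (real N1 / 2) + real (k1 + p1)) - (- (real N1 / 2) + real k1) = real p1"
    "(- (real N2 / 2) + real (k2 + p2)) - (- (real N2 / 2) + real k2) = real p2"
    by simp_all
  show ?thesis
    unfolding alpha_def b_coeff_diff Let_def D_coeff_monomial_norm[OF le assms] fl A twist_coeff_binomial power_int_of_nat of_real_mult
    by (simp add: mult_ac)
qed

lemma sum_shift:
  fixes g :: "nat \<Rightarrow> 'a::comm_monoid_add"
  assumes "\<And>l. M < l \<Longrightarrow> g l = 0" "\<And>l. l < k \<Longrightarrow> g l = 0"
  shows "(\<Sum>p\<le>M. g (k + p)) = (\<Sum>l\<le>M. g l)"
proof -
  have "(\<Sum>p\<le>M. g (k + p)) = (\<Sum>p\<in>{p. k + p \<le> M}. g (k + p))"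
    by (rule sum.mono_neutral_right) (use assms(1) in \<open>auto simp: not_le\<close>)
  also have "\<dots> = (\<Sum>l\<in>{k..M}. g l)"
    by (rule sum.reindex_bij_witness[of _ "\<lambda>l. l - k" "\<lambda>p. k + p"]) auto
  also have "\<dots> = (\<Sum>l\<le>M. g l)"
    by (rule sum.mono_neutral_left) (use assms(2) in auto)
  finally show ?thesis .
qed


section \<open>The Wigner-Eckart theorem\<close>

theorem theorem2:
  fixes h :: complex and j1 j2 j :: real
    and t :: "real \<Rightarrow> (real \<Rightarrow> complex) \<Rightarrow> real \<Rightarrow> complex"
  assumes "h \<noteq> 0"
    and "j1 \<in> spins" and "j2 \<in> spins" and "j \<in> spins"
    and "tensor_operators h j1 j2 j t"
  shows "\<exists>I :: complex. \<forall>m1\<in>wts j1. \<forall>m2\<in>wts j2. \<forall>m\<in>wts j.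
           t m1 (ket m2) m =
             I * (\<Sum>n1\<in>wts j1. \<Sum>n2\<in>wts j2.
                    alpha h j1 j2 (- n1) (- n2) (- m1) (- m2) * clebsch_gordan j1 j2 j n1 n2 m)"
proof -
  obtain N1 N2 N where N: "j1 = real N1 / 2" "j2 = real N2 / 2" "j = real N / 2"
    using assms(2-4) spins_half by blast
  note tens = assms(5)[unfolded N]
  define f1 f2 where "f1 k = - (real N1 / 2) + real k" and "f2 k = - (real N2 / 2) + real k" for k
  let ?\<phi> = "tensor_coeff N1 N2 t" and ?a = "h / 2" and ?\<gamma> = "\<lambda>k1 k2. twist_coeff (h / 2) (real N1 - 2 * real k1) (real N2 - 2 * real k2)"
  obtain \<chi> :: "real \<Rightarrow> nat \<Rightarrow> nat \<Rightarrow> complex" where s\<chi>: "\<And>m. supported N1 N2 (\<chi> m)"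
    and \<phi>: "\<And>m k1 k2. correlation N1 N2 (?\<gamma> k1 k2) (\<chi> m) k1 k2 = ?\<phi> m k1 k2"
    and Z: "\<And>m k1 k2. \<chi> m (Suc k1) k2 + \<chi> m k1 (Suc k2) = ladder j (m - 1) * \<chi> (m - 1) k1 k2"
    and H: "\<And>m k1 k2. of_real (2 * m) * \<chi> m k1 k2
        = of_real (2 * real k1 + 2 * real k2 - real N1 - real N2) * \<chi> m k1 k2"
  proof -
    have "?a \<noteq> 0" using assms(1) by simp
    from untwist[OF this tensor_coeff_supported[OF assms(1) tens] tensor_coeff_Z[OF assms(1) tens] tensor_coeff_H[OF assms(1) tens]]
    show thesis using that unfolding N by metis
  qed
  have \<chi>out: "\<chi> m k1 k2 = 0" if "m \<notin> wts j" for m k1 k2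
    by (rule unitriangular_inj[OF s\<chi>, of ?\<gamma>]) (use tensor_coeff_W[OF assms(1) tens] that in \<open>simp_all add: \<phi> N\<close>)
  \<comment> \<open>positions of the weights, so that \<open>f\<close> is \<open>\<chi>\<close> in the orthonormal bases, read with the weight \<open>m\<close> first\<close>
  define i1 i2 where "i1 n = nat \<lfloor>n + real N1 / 2\<rfloor>" and "i2 n = nat \<lfloor>n + real N2 / 2\<rfloor>" for n
  define f where "f = (\<lambda>m (n1, n2). if n1 \<in> wts j1 \<and> n2 \<in> wts j2
     then \<chi> m (i1 n1) (i2 n2) / of_real (monomial_norm N1 (i1 n1) * monomial_norm N2 (i2 n2)) else 0)"
  have i: "i1 (f1 k) = k" "i2 (f2 k) = k" for k by (simp_all add: i1_def i2_def f1_def f2_def)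
  have wts1: "n \<in> wts j1 \<longleftrightarrow> (\<exists>k\<le>N1. n = f1 k)" and wts2: "n \<in> wts j2 \<longleftrightarrow> (\<exists>k\<le>N2. n = f2 k)" for n
    by (simp_all add: N wts_iff f1_def f2_def)
  have f: "f m (f1 k1, f2 k2)
      = \<chi> m k1 k2 / of_real (monomial_norm N1 k1 * monomial_norm N2 k2)" if "k1 \<le> N1" "k2 \<le> N2" for m k1 k2
    using that unfolding f_def prod.case wts1 wts2 i by auto
  have supp: "coupled_support N1 N2 N f"
    unfolding coupled_support_def f_def N[symmetric] using \<chi>out by simp
  have weight: "coupled_weight f"
    unfolding coupled_weight_def
  proof (intro allI impI)
    fix m n1 n2 assume nz: "f m (n1, n2) \<noteq> 0"
    then have "n1 \<in> wts j1" "n2 \<in> wts j2" using supp unfolding coupled_support_def N by blast+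
    then obtain k1 k2 where k: "k1 \<le> N1" "n1 = f1 k1" "k2 \<le> N2" "n2 = f2 k2" unfolding wts1 wts2
    by blast
    then have "\<chi> m k1 k2 \<noteq> 0" using nz f by auto
    then have "2 * m = 2 * real k1 + 2 * real k2 - real N1 - real N2"
      using H[of m k1 k2] by (metis mult_cancel_right of_real_eq_iff)
    then show "n1 + n2 = m" unfolding k f1_def f2_def by simp
  qed
  have low: "lowering_defect N1 N2 N f m n1 n2 = 0" for m n1 n2
  proof (cases "n1 \<in> wts j1 \<and> n2 \<in> wts j2")
    case False
    then show ?thesis unfolding N by (intro lowering_defect_outside[OF supp]) blast
  next
    case True
    then obtain k1 k2 where k: "k1 \<le> N1" "n1 = f1 k1" "k2 \<le> N2" "n2 = f2 k2" unfolding wts1 wts2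
    by blast
    let ?s = "complex_of_real (monomial_norm N1 k1 * monomial_norm N2 k2)"
    \<comment> \<open>the ladder coefficient is the quotient of consecutive norms; at the top weight both sides vanish\<close>
    have 1: "ladder (real N1 / 2) n1 * f m (n1 + 1, n2) = \<chi> m (Suc k1) k2 / ?s"
    proof (cases "Suc k1 \<le> N1")
      case True
      have e: "n1 + 1 = f1 (Suc k1)" by (simp add: k f1_def)
      have "monomial_norm N1 (Suc k1)
          = monomial_norm N1 k1 * sqrt ((real N1 / 2 - n1) * (real N1 / 2 + n1 + 1))"
        unfolding k f1_def by (rule monomial_norm_Suc)
      then have l: "complex_of_real (monomial_norm N1 (Suc k1))
          = of_real (monomial_norm N1 k1) * ladder (real N1 / 2) n1"
        by (simp add: ladder_def)
      moreover have "monomial_norm N1 (Suc k1) \<noteq> 0" by (rule monomial_norm_nonzero[OF True])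
      ultimately have "ladder (real N1 / 2) n1 \<noteq> 0" by auto
      then show ?thesis unfolding e k(4) f[OF True k(3)] of_real_mult l by simp
    next
      case False
      then have "k1 = N1" using k by simp
      then have "ladder (real N1 / 2) n1 = 0" by (simp add: k f1_def)
      moreover have "\<chi> m (Suc k1) k2 = 0" using s\<chi> \<open>k1 = N1\<close> by (simp add: supported_def)
      ultimately show ?thesis by simp
    qed
    have 2: "ladder (real N2 / 2) n2 * f m (n1, n2 + 1) = \<chi> m k1 (Suc k2) / ?s"
    proof (cases "Suc k2 \<le> N2")
      case True
      have e: "n2 + 1 = f2 (Suc k2)" by (simp add: k f2_def)
      have "monomial_norm N2 (Suc k2)
          = monomial_norm N2 k2 * sqrt ((real N2 / 2 - n2) * (real N2 / 2 + n2 + 1))"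
        unfolding k f2_def by (rule monomial_norm_Suc)
      then have l: "complex_of_real (monomial_norm N2 (Suc k2))
          = of_real (monomial_norm N2 k2) * ladder (real N2 / 2) n2"
        by (simp add: ladder_def)
      moreover have "monomial_norm N2 (Suc k2) \<noteq> 0" by (rule monomial_norm_nonzero[OF True])
      ultimately have "ladder (real N2 / 2) n2 \<noteq> 0" by auto
      then show ?thesis unfolding e k(2) f[OF k(1) True] of_real_mult l by simp
    next
      case False
      then have "k2 = N2" using k by simp
      then have "ladder (real N2 / 2) n2 = 0" by (simp add: k f2_def)
      moreover have "\<chi> m k1 (Suc k2) = 0" using s\<chi> \<open>k2 = N2\<close> by (simp add: supported_def)
      ultimately show ?thesis by simp
    qed
    have 3: "ladder (real N / 2) (m - 1) * f (m - 1) (n1, n2)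
        = (\<chi> m (Suc k1) k2 + \<chi> m k1 (Suc k2)) / ?s"
      unfolding Z k(2,4) f[OF k(1,3)] N by simp
    show ?thesis unfolding lowering_defect_def 1 2 3 by (simp add: add_divide_distrib)
  qed
  have "coupled N1 N2 N f"
    unfolding coupled_def using supp weight low raising_defect_zero[OF supp weight low] by blast
  then obtain I where I: "\<And>m n1 n2. f m (n1, n2) = I * clebsch_gordan j1 j2 j n1 n2 m"
    using coupled_clebsch_gordan unfolding N by meson
  show ?thesis
  proof (intro exI[of _ I] ballI)
    fix m1 m2 m assume "m1 \<in> wts j1" "m2 \<in> wts j2" "m \<in> wts j"
    then obtain k1 k2 where k: "k1 \<le> N1" "m1 = f1 k1" "k2 \<le> N2" "m2 = f2 k2" unfolding wts1 wts2
    by blast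
    let ?s = "complex_of_real (monomial_norm N1 k1 * monomial_norm N2 k2)"
    let ?A = "\<lambda>l1 l2. alpha h j1 j2 (- f1 l1) (- f2 l2) (- m1) (- m2)"
    have s: "?s \<noteq> 0" using monomial_norm_nonzero k by simp
    have "?\<phi> m k1 k2 = ?s * t m1 (ket m2) m"
    proof -
      have m2: "ket m2 \<in> W (real N2 / 2)" using \<open>m2 \<in> wts j2\<close> ket_W unfolding N by blast
      have m1: "m1 \<in> wts (real N1 / 2)" using \<open>m1 \<in> wts j1\<close> unfolding N .
      show ?thesis
        unfolding tensor_coeff_def monomial_def f1_def[symmetric] f2_def[symmetric] k(2)[symmetric] k(4)[symmetric]
          tensor_map_scale_left tensor_map_scale_right[OF assms(1) tens m2]
        unfolding tensor_map_ket[OF m1] by simp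
    qed
    then have "?s * t m1 (ket m2) m = correlation N1 N2 (?\<gamma> k1 k2) (\<chi> m) k1 k2" unfolding \<phi> by simp
    also have "\<dots> = (\<Sum>p1\<le>N1. \<Sum>p2\<le>N2. ?\<gamma> k1 k2 p1 p2 * \<chi> m (k1 + p1) (k2 + p2))"
      by (simp add: correlation_def)
    also have "\<dots>
        = (\<Sum>p1\<le>N1. \<Sum>p2\<le>N2. ?s * (?A (k1 + p1) (k2 + p2) * f m (f1 (k1 + p1), f2 (k2 + p2))))"
    proof (intro sum.cong refl)
      fix p1 p2
      show "?\<gamma> k1 k2 p1 p2 * \<chi> m (k1 + p1) (k2 + p2)
          = ?s * (?A (k1 + p1) (k2 + p2) * f m (f1 (k1 + p1), f2 (k2 + p2)))"
      proof (cases "k1 + p1 \<le> N1 \<and> k2 + p2 \<le> N2")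
        case True
        then have "monomial_norm N1 (k1 + p1) \<noteq> 0" "monomial_norm N2 (k2 + p2) \<noteq> 0" using monomial_norm_nonzero by blast+
        moreover have "?A (k1 + p1) (k2 + p2) = ?\<gamma> k1 k2 p1 p2
            * of_real (monomial_norm N1 (k1 + p1) * monomial_norm N2 (k2 + p2) / (monomial_norm N1 k1 * monomial_norm N2 k2))"
          unfolding N k f1_def f2_def by (rule alpha_twist_coeff) (use True in auto)
        moreover have "f m (f1 (k1 + p1), f2 (k2 + p2))
           
                = \<chi> m (k1 + p1) (k2 + p2) / of_real (monomial_norm N1 (k1 + p1) * monomial_norm N2 (k2 + p2))"
          by (rule f) (use True in auto)
        ultimately show ?thesis using s by simp
      next
        case False
        then have "\<chi> m (k1 + p1) (k2 + p2) = 0" using s\<chi> by (auto simp: supported_def)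
        moreover have "f m (f1 (k1 + p1), f2 (k2 + p2)) = 0"
          using False unfolding f_def prod.case wts1 wts2 f1_def f2_def by auto
        ultimately show ?thesis by simp
      qed
    qed
    \<comment> \<open>the triangular sum over \<open>p1, p2\<close> becomes the full sum over weights, as \<open>\<alpha>\<close> vanishes below the diagonal\<close>
    also have "\<dots> = ?s * (\<Sum>l1\<le>N1. \<Sum>l2\<le>N2. ?A l1 l2 * f m (f1 l1, f2 l2))"
    proof -
      let ?F = "\<lambda>l1 l2. ?A l1 l2 * f m (f1 l1, f2 l2)"
      have above: "?F l1 l2 = 0" if "N1 < l1 \<or> N2 < l2" for l1 l2
      proof -
        have "f m (f1 l1, f2 l2) = 0"
          using that unfolding f_def prod.case wts1 wts2 f1_def f2_def by auto
        then show ?thesis by simp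
      qed
      have below: "?F l1 l2 = 0" if "l1 < k1 \<or> l2 < k2" for l1 l2
        using alpha_below[OF that, of h N1 N2] unfolding N k f1_def f2_def by simp
      have "(\<Sum>p1\<le>N1. \<Sum>p2\<le>N2. ?F (k1 + p1) (k2 + p2)) = (\<Sum>p1\<le>N1. \<Sum>l2\<le>N2. ?F (k1 + p1) l2)"
        by (intro sum.cong refl sum_shift) (use above below in blast)+
      also have "\<dots> = (\<Sum>l1\<le>N1. \<Sum>l2\<le>N2. ?F l1 l2)"
        by (rule sum_shift[of N1 "\<lambda>l1. \<Sum>l2\<le>N2. ?F l1 l2"]; intro sum.neutral ballI) (use above below in blast)+
      finally show ?thesis by (simp only: sum_distrib_left[symmetric])
    qed
    also have "\<dots>
        = ?s * (I * (\<Sum>n1\<in>wts j1. \<Sum>n2\<in>wts j2. alpha h j1 j2 (- n1) (- n2) (- m1) (- m2) * clebsch_gordan j1 j2 j n1 n2 m))"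
    proof -
      have "wts j1 = f1 ` {..N1}" "wts j2 = f2 ` {..N2}" "inj_on f1 {..N1}" "inj_on f2 {..N2}"
        by (auto simp: wts1 wts2 inj_on_def f1_def f2_def)
      then show ?thesis by (simp add: sum.reindex I sum_distrib_left mult_ac)
    qed
    finally show "t m1 (ket m2) m = I * (\<Sum>n1\<in>wts j1. \<Sum>n2\<in>wts j2.
        alpha h j1 j2 (- n1) (- n2) (- m1) (- m2) * clebsch_gordan j1 j2 j n1 n2 m)"
      using s by simp
  qed
qed

end
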